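(* Let $\mu$ be a locally finite signed Borel measure on $\mathbb{R}$, with distribution function $\mu(x):=\mu((-\infty,x])$, such that: $\operatorname{supp}(\mu)\subset[0,\infty)$; $0\le\mu(x)\le1$ for all $x\in\mathbb{R}$; and $\int_0^\infty\lambda^{-2}\mu(\lambda)\,d\lambda<\infty$. Let $\mathscr{F}_\mu$ be the $1$-periodic function defined in the context. Let $\vartheta$ be a nontrivial probability measure on $\mathbb{R}/\mathbb{Z}$ and let $N\in\mathbb{Z}^+$. Let $\mathscr{K}_N$ and $\mathscr{B}_{N+1}$ be as defined in the context (they depend on $\vartheta$). (i) If $\mathscr{L}:\mathbb{C}\to\mathbb{C}$ is a real trigonometric polynomial of degree at most $N$ such that $$\mathscr{L}(x)\le\mathscr{F}_\mu(x)\quad\text{for all }x\in\mathbb{R}/\mathbb{Z},\qquad(\ast)$$ then $$\int_{\mathbb{R}/\mathbb{Z}}\mathscr{L}(x)\,d\vartheta(x)\le\frac{\mathscr{F}_\mu(0)}{\mathscr{K}_N(1,1)}+\sum_{\substack{\xi\in\mathbb{R}/\mathbb{Z},\ \xi\neq0\\ \mathscr{B}_{N+1}(e(\xi))=0}}\frac{\mathscr{F}_\mu(\xi)}{\mathscr{K}_N(e(\xi),e(\xi))}.\qquad(\ast\ast)$$ Moreover, there is a unique real trigonometric polynomial $\mathscr{L}_\mu:\mathbb{C}\to\mathbb{C}$ of degree at most $N$ satisfying $(\ast)$ for which equality in $(\ast\ast)$ holds. (ii) Assume that $\mu$ also satisfies $\lim_{y\to\infty}\frac1y\int_{-\infty}^y\mu(x)\,dx=1$.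 If $\mathscr{M}:\mathbb{C}\to\mathbb{C}$ is a real trigonometric polynomial of degree at most $N$ such that $$\mathscr{F}_\mu(x)\le\mathscr{M}(x)\quad\text{for all }x\in\mathbb{R}/\mathbb{Z},\qquad(\dagger)$$ then $$\int_{\mathbb{R}/\mathbb{Z}}\mathscr{M}(x)\,d\vartheta(x)\ge\frac{\mathscr{F}_\mu(0^+)}{\mathscr{K}_N(1,1)}+\sum_{\substack{\xi\in\mathbb{R}/\mathbb{Z},\ \xi\neq0\\ \mathscr{B}_{N+1}(e(\xi))=0}}\frac{\mathscr{F}_\mu(\xi)}{\mathscr{K}_N(e(\xi),e(\xi))}.\qquad(\dagger\dagger)$$ Moreover, there is a unique real trigonometric polynomial $\mathscr{M}_\mu:\mathbb{C}\to\mathbb{C}$ of degree at most $N$ satisfying $(\dagger)$ for which equality in $(\dagger\dagger)$ holds.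
   Context: $e(z)=e^{2\pi i z}$. $\mathbb{Z}^+$ denotes the nonnegative integers. A trigonometric polynomial of degree at most $N$ is an entire function $\mathscr{W}(z)=\sum_{k=-N}^N a_k e(kz)$ with $a_k\in\mathbb{C}$; it is real if it is real valued on $\mathbb{R}$. A probability measure on $\mathbb{R}/\mathbb{Z}$ is trivial if it is supported on finitely many points, nontrivial otherwise. Definition of $\mathscr{F}_\mu$. For $\lambda>0$ let $v(\lambda,x)=xe^{-\lambda x}$ if $x>0$ and $v(\lambda,x)=0$ if $x\le0$, and $h(\lambda,x)=\sum_{n\in\mathbb{Z}}v(\lambda,x+n)$. Then $$\mathscr{F}_\mu(x)=\int_0^\infty h(\lambda,x)\,\mu(\lambda)\,d\lambda=\sum_{n\in\mathbb{Z}}f_\mu(x+n),$$ where $f_\mu(x)=\int e^{-\lambda x}d\mu(\lambda)=\int_0^\infty xe^{-\lambda x}\mu(\lambda)\,d\lambda$ for $x>0$ and $f_\mu(x)=0$ for $x\le0$. $\mathscr{F}_\mu(0^+)$ denotes $\lim_{x\to0^+}\mathscr{F}_\mu(x)$ (which exists under the hypotheses of (ii)). Orthogonal polynomials. Identify $\mathbb{R}/\mathbb{Z}$ with the unit circle $\partial\mathbb{D}$ via $x\mapsto e(x)$, and let $\langle f,g\rangle=\int_{\mathbb{R}/\mathbb{Z}}f(e(x))\overline{g(e(x))}\,d\vartheta(x)$. $\Phi_n$ is the monic polynomial of degree $n$ with $\langle\Phi_n,z^j\rangle=0$ for $0\le j<n$, and $\varphi_n=c_n\Phi_n/\|\Phi_n\|$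 with $|c_n|=1$ chosen so that $\varphi_n(1)\in\mathbb{R}$ (norm in $L^2(\vartheta)$). For $Q$ of exact degree $n$, $Q^*(z)=z^n\,\overline{Q(\overline z^{\,-1})}$. Define $$\mathscr{K}_N(w,z)=\frac{\varphi_{N+1}^*(z)\overline{\varphi_{N+1}^*(w)}-\varphi_{N+1}(z)\overline{\varphi_{N+1}(w)}}{1-\overline w z},\qquad \mathscr{B}_{N+1}(z)=\frac i2\{\varphi_{N+1}^*(z)-\varphi_{N+1}(z)\}.$$ $\mathscr{K}_N$ is a polynomial in $\overline w,z$ (the quotient being extended by continuity when $\overline wz=1$); it is the reproducing kernel of the space of polynomials of degree at most $N$ with the inner product $\langle\cdot,\cdot\rangle$, and $\mathscr{K}_N(w,w)>0$ for all $w\in\mathbb{C}$. *)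

theory Defs
  imports "HOL-Probability.Probability" "HOL-Computational_Algebra.Polynomial"
begin

text \<open>A locally finite signed measure need not have a meaningful value on unbounded sets (think of
  unit masses of alternating sign at the integers), so it is a countably additive real function on the
  bounded Borel sets. Its values on all other sets are irrelevant.\<close>

definition locally_finite_signed_measure :: "(real set \<Rightarrow> real) \<Rightarrow> bool" where
  "locally_finite_signed_measure \<mu> \<longleftrightarrow>
     (\<forall>A :: nat \<Rightarrow> real set. range A \<subseteq> sets borel \<and> disjoint_family A \<and> bounded (\<Union>i. A i)
        \<longrightarrow> (\<lambda>i. \<mu> (A i)) sums \<mu> (\<Union>i. A i))"

text \<open>This is the support of the total variation measure: the complement of the largest open set
  on all of whose bounded Borel subsets the measure vanishes.\<close>

definition signed_support :: "(real set \<Rightarrow> real) \<Rightarrow> real set" where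
  "signed_support \<mu> =
     {x. \<forall>U. open U \<and> x \<in> U \<longrightarrow> (\<exists>A \<in> sets borel. bounded A \<and> A \<subseteq> U \<and> \<mu> A \<noteq> 0)}"

text \<open>The value on \<open>{..x}\<close>, obtained from bounded sets by exhaustion. If the support is contained in
  \<open>{0..}\<close>, the sequence is eventually constant with value \<open>\<mu> {0..x}\<close> (which is 0 for negative \<open>x\<close>).\<close>

definition distribution_function :: "(real set \<Rightarrow> real) \<Rightarrow> real \<Rightarrow> real" where
  "distribution_function \<mu> x = lim (\<lambda>n. \<mu> {- real n <.. x})"

definition trunc_exp :: "real \<Rightarrow> real \<Rightarrow> real" where
  "trunc_exp l x = (if x > 0 then x * exp (- l * x) else 0)"

definition periodic_trunc_exp :: "real \<Rightarrow> real \<Rightarrow> real" where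
  "periodic_trunc_exp l x = (\<Sum>\<^sub>\<infinity>n\<in>(UNIV :: int set). trunc_exp l (x + of_int n))"

definition periodic_transform :: "(real set \<Rightarrow> real) \<Rightarrow> real \<Rightarrow> real" where
  "periodic_transform \<mu> x =
     (LINT l:{0<..}|lborel. periodic_trunc_exp l x * distribution_function \<mu> l)"

definition e :: "complex \<Rightarrow> complex" where
  "e z = exp (2 * of_real pi * \<i> * z)"

definition trig_poly :: "nat \<Rightarrow> (complex \<Rightarrow> complex) \<Rightarrow> bool" where
  "trig_poly N W \<longleftrightarrow>
     (\<exists>a :: int \<Rightarrow> complex. W = (\<lambda>z. \<Sum>k = - int N..int N. a k * e (of_int k * z)))"

definition real_trig_poly :: "nat \<Rightarrow> (complex \<Rightarrow> complex) \<Rightarrow> bool" where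
  "real_trig_poly N W \<longleftrightarrow> trig_poly N W \<and> (\<forall>x :: real. W (of_real x) \<in> \<real>)"

text \<open>The group of reals modulo 1 is represented by its fundamental domain \<open>{0..<1}\<close>. Its Borel sets
  are exactly the Borel subsets of \<open>{0..<1}\<close>; the topology of the circle plays no other role here.\<close>

definition circle_prob :: "real measure \<Rightarrow> bool" where
  "circle_prob \<theta> \<longleftrightarrow> prob_space \<theta> \<and> sets \<theta> = sets (restrict_space borel {0..<1})"

definition trivial_measure :: "real measure \<Rightarrow> bool" where
  "trivial_measure \<theta> \<longleftrightarrow> (\<exists>S. finite S \<and> (AE x in \<theta>. x \<in> S))"

definition circle_inner :: "real measure \<Rightarrow> (complex \<Rightarrow> complex) \<Rightarrow> (complex \<Rightarrow> complex) \<Rightarrow> complex" where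
  "circle_inner \<theta> f g = (LINT x|\<theta>. f (e (of_real x)) * cnj (g (e (of_real x))))"

definition circle_norm :: "real measure \<Rightarrow> (complex \<Rightarrow> complex) \<Rightarrow> real" where
  "circle_norm \<theta> f = sqrt (Re (circle_inner \<theta> f f))"

definition monic_orth_poly :: "real measure \<Rightarrow> nat \<Rightarrow> complex poly" where
  "monic_orth_poly \<theta> n =
     (THE p. degree p = n \<and> lead_coeff p = 1 \<and> (\<forall>j<n. circle_inner \<theta> (poly p) (\<lambda>z. z ^ j) = 0))"

definition orthonormal_poly :: "real measure \<Rightarrow> (nat \<Rightarrow> complex) \<Rightarrow> nat \<Rightarrow> complex poly" where
  "orthonormal_poly \<theta> c n =
     smult (c n / of_real (circle_norm \<theta> (poly (monic_orth_poly \<theta> n)))) (monic_orth_poly \<theta> n)"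

text \<open>The normalisation determines each \<open>c n\<close> only up to sign (and not at all should the \<open>n\<close>-th
  polynomial vanish at 1), so the phases remain a parameter.\<close>

definition admissible_phases :: "real measure \<Rightarrow> (nat \<Rightarrow> complex) \<Rightarrow> bool" where
  "admissible_phases \<theta> c \<longleftrightarrow>
     (\<forall>n. norm (c n) = 1 \<and> poly (orthonormal_poly \<theta> c n) 1 \<in> \<real>)"

definition star :: "complex poly \<Rightarrow> complex poly" where
  "star Q = map_poly cnj (reflect_poly Q)"

lemma poly_star:
  assumes "z \<noteq> 0"
  shows "poly (star Q) z = z ^ degree Q * cnj (poly Q (inverse (cnj z)))"
proof -
  have *: "poly (map_poly cnj p) w = cnj (poly p (cnj w))" for p w
    by (induction p) (auto simp: map_poly_pCons)
  show ?thesis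
    using assms by (simp add: star_def * poly_reflect_poly_nz)
qed

definition kernel_quotient ::
  "real measure \<Rightarrow> (nat \<Rightarrow> complex) \<Rightarrow> nat \<Rightarrow> complex \<Rightarrow> complex \<Rightarrow> complex" where
  "kernel_quotient \<theta> c N w z =
     (let \<phi> = orthonormal_poly \<theta> c (N + 1) in
        (poly (star \<phi>) z * cnj (poly (star \<phi>) w) - poly \<phi> z * cnj (poly \<phi> w)) / (1 - cnj w * z))"

text \<open>At the removable singularity the value is the continuous extension, not the library's
  value of a division by zero.\<close>

definition kernel ::
  "real measure \<Rightarrow> (nat \<Rightarrow> complex) \<Rightarrow> nat \<Rightarrow> complex \<Rightarrow> complex \<Rightarrow> complex" where
  "kernel \<theta> c N w z =
     (if cnj w * z = 1 then Lim (at z) (kernel_quotient \<theta> c N w) else kernel_quotient \<theta> c N w z)"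

definition companion :: "real measure \<Rightarrow> (nat \<Rightarrow> complex) \<Rightarrow> nat \<Rightarrow> complex \<Rightarrow> complex" where
  "companion \<theta> c n z =
     \<i> / 2 * (poly (star (orthonormal_poly \<theta> c n)) z - poly (orthonormal_poly \<theta> c n) z)"

text \<open>The quadrature sum with value \<open>F0\<close> at the node \<open>\<xi> = 0\<close> and \<open>F \<xi>\<close> at the other nodes. The
  diagonal of the kernel is real and positive, so taking real parts loses nothing; the sum is over
  the roots of a nonzero polynomial, hence finite.\<close>

definition quadrature ::
  "real measure \<Rightarrow> (nat \<Rightarrow> complex) \<Rightarrow> nat \<Rightarrow> real \<Rightarrow> (real \<Rightarrow> real) \<Rightarrow> real" where
  "quadrature \<theta> c N F0 F =
     F0 / Re (kernel \<theta> c N 1 1) +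
     (\<Sum>\<xi> | 0 < \<xi> \<and> \<xi> < 1 \<and> companion \<theta> c (N + 1) (e (of_real \<xi>)) = 0.
        F \<xi> / Re (kernel \<theta> c N (e (of_real \<xi>)) (e (of_real \<xi>))))"

end

theory Submission
  imports Defs "HOL-Computational_Algebra.Fundamental_Theorem_Algebra" "HOL-Real_Asymp.Real_Asymp"
begin

text \<open>Three facts carry the proof.

Quadrature. Let \<open>\<phi>\<close> be the orthonormal polynomial of degree \<open>N + 1\<close>. The difference
\<open>star \<phi> - \<phi>\<close> is orthogonal to \<open>z, \<dots>, z ^ N\<close>, which forces its zeros to be simple and to lie on the
unit circle; there are \<open>N + 1\<close> of them, and the phase of \<open>\<phi>\<close> makes 1 one of them. At these nodes
the kernel sections are orthogonal and reproduce point values, so integration against \<open>\<theta>\<close> is a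
quadrature with positive weights that is exact for trigonometric polynomials of degree at most \<open>N\<close>
(\<open>quadrature_exact\<close>). Both inequalities follow at once. Equality forces a minorant (majorant) to agree
with the function at the nodes.

Interpolation. Write \<open>m\<close> for the distribution function. The transform is the integral of
\<open>h l\<close> against \<open>m l\<close>, where \<open>h l\<close> is the periodized truncated exponential. A trigonometric polynomial
of degree at most \<open>N\<close> can be prescribed at 0 and, with its slope, at the \<open>N\<close> other nodes. The one that
interpolates \<open>h l\<close> is a minorant of \<open>h l\<close>: multiplying the difference by \<open>exp (l * x)\<close> and applying
Rolle's theorem twice would otherwise produce a nonzero trigonometric polynomial of degree at most
\<open>N\<close> with \<open>2 * N + 1\<close> zeros (\<open>minorant_interpolant\<close>). Integrating over \<open>l\<close>, with \<open>m \<ge> 0\<close>, gives a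
minorant \<open>L\<close> of the transform that agrees with it at the nodes.

Comparison with the sawtooth. Since \<open>m \<le> 1\<close>, the difference between the transform and \<open>L\<close> is at most
the integral of the nonnegative interpolation errors of all \<open>h l\<close>. The functions \<open>h l\<close> are derivatives
in \<open>l\<close>, so this integral is the interpolation error of the sawtooth \<open>1 / 2 - x\<close> with value
\<open>- 1 / 2\<close> at 0. If \<open>\<Psi>\<close> denotes the nonnegative trigonometric polynomial that equals 1 at 0 and has a
double zero at every other node, a second zero count (\<open>sawtooth_majorant_interpolant\<close>) bounds the error
by \<open>\<Psi>\<close>. Hence the transform lies between \<open>L\<close> and \<open>L + \<Psi>\<close>. The two bounds touch at the nodes other
than 0 and have equal slopes there; so a one-sided approximation that attains equality has these
slopes as well, and it is determined by them. The minorant is \<open>L\<close>. Under the averaging condition the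
transform jumps by exactly 1 at 0, and then \<open>L + \<Psi>\<close> is the majorant.\<close>

definition E :: "real \<Rightarrow> complex" where "E x = e (complex_of_real x)"

lemma E_eq_cis: "E x = cis (2 * pi * x)"
  by (simp add: E_def e_def cis_conv_exp mult_ac)

lemma norm_E [simp]: "cmod (E x) = 1"
  by (simp add: E_eq_cis)

lemma E_nz [simp]: "E x \<noteq> 0"
  by (metis norm_E norm_zero zero_neq_one)

lemma E_0 [simp]: "E 0 = 1"
  by (simp add: E_eq_cis)

lemma E_add: "E (x + y) = E x * E y"
  by (simp add: E_eq_cis cis_mult ring_distribs)

lemma E_of_int [simp]: "E (of_int n) = 1"
  using cis_multiple_2pi[of "of_int n"] by (simp add: E_eq_cis mult_ac)

lemma E_add_int [simp]: "E (x + of_int n) = E x"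
  by (simp only: E_add E_of_int mult_1_right)

lemma inj_on_E: "inj_on E {0..<1}"
proof (rule inj_onI)
  fix x y :: real assume xy: "x \<in> {0..<1}" "y \<in> {0..<1}" "E x = E y"
  hence "cis (2 * pi * x - 2 * pi * y) = 1"
    using xy(3) by (simp add: E_eq_cis flip: cis_divide)
  hence "cos (2 * pi * (x - y)) = 1" by (metis cis.sel(1) one_complex.sel(1) right_diff_distrib)
  then obtain n :: int where "2 * pi * (x - y) = real_of_int n * 2 * pi"
    using cos_one_2pi_int by blast
  hence n: "x - y = of_int n" by simp
  have "\<bar>x - y\<bar> < 1" using xy by auto
  hence "n = 0" unfolding n by linarith
  thus "x = y" using n by simp
qed

lemma E_surj_circle: assumes "cmod z = 1" shows "\<exists>x\<in>{0..<1}. E x = z"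
proof -
  have "z = cis (Arg z)" using assms by (subst cis_Arg) (auto simp: sgn_eq)
  hence z: "z = E (Arg z / (2*pi))" by (simp add: E_eq_cis)
  have "E (frac (Arg z / (2*pi))) = z"
    using E_add_int[of "frac (Arg z / (2*pi))" "\<lfloor>Arg z / (2*pi)\<rfloor>"] z by (simp add: frac_def)
  thus ?thesis by (intro bexI[of _ "frac (Arg z / (2*pi))"]) (auto simp: frac_ge_0 frac_lt_1)
qed

lemma mult_cnj_self: "z * cnj z = complex_of_real ((cmod z)\<^sup>2)"
  using complex_norm_square[of z] by simp

lemma cnj_on_circle: "cmod z = 1 \<Longrightarrow> z * cnj z = 1"
  using complex_norm_square[of z] by simp

section \<open>The inner product of a nontrivial measure on the circle\<close>

locale nontrivial_circle_measure =
  fixes \<theta> :: "real measure"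
  assumes circle: "circle_prob \<theta>" and nontrivial: "\<not> trivial_measure \<theta>"
begin

lemma prob_space_measure: "prob_space \<theta>" and sets_measure: "sets \<theta> = sets (restrict_space borel {0..<1})"
  using circle by (auto simp: circle_prob_def)

lemma space_measure: "space \<theta> = {0..<1}"
  using sets_eq_imp_space_eq[OF sets_measure] by (simp add: space_restrict_space)

sublocale prob_space \<theta> by (rule prob_space_measure)

lemma borel_measurable_measure:
  fixes f :: "real \<Rightarrow> 'b :: topological_space"
  assumes "f \<in> borel_measurable borel" shows "f \<in> borel_measurable \<theta>"
  using measurable_restrict_space1[OF assms, of "{0..<1}"] measurable_cong_sets[OF sets_measure refl]
  by blast

lemma integrable_poly_mult [simp]:
  "integrable \<theta> (\<lambda>x. poly p (E x) * cnj (poly q (E x)))"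
proof -
  have c: "continuous_on UNIV (\<lambda>x::real. poly p (E x) * cnj (poly q (E x)))"
    unfolding E_eq_cis cis_conv_exp by (intro continuous_intros)
  have b: "\<exists>B. \<forall>z. cmod z = 1 \<longrightarrow> cmod (poly r z) \<le> B" for r
  proof -
    have "compact (poly r ` sphere 0 1)" by (intro compact_continuous_image continuous_intros compact_sphere)
    hence "bounded (poly r ` sphere 0 1)" by (rule compact_imp_bounded)
    then obtain B where "\<forall>w\<in>poly r ` sphere 0 1. cmod w \<le> B" unfolding bounded_iff by blast
    thus ?thesis by (intro exI[of _ B]) auto
  qed
  obtain B where B: "\<And>z. cmod z = 1 \<Longrightarrow> cmod (poly p z) \<le> B" using b by blast
  obtain C where C: "\<And>z. cmod z = 1 \<Longrightarrow> cmod (poly q z) \<le> C" using b by blast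
  show ?thesis
  proof (rule integrable_const_bound[of _ "B * C"])
    show "AE x in \<theta>. cmod (poly p (E x) * cnj (poly q (E x))) \<le> B * C"
      using B C by (auto simp: norm_mult intro!: mult_mono order_trans[OF norm_ge_zero B[of 1]])
  qed (intro borel_measurable_measure borel_measurable_continuous_onI c)
qed

definition ip :: "complex poly \<Rightarrow> complex poly \<Rightarrow> complex" where
  "ip p q = circle_inner \<theta> (poly p) (poly q)"

lemma ip_eq: "ip p q = (LINT x|\<theta>. poly p (E x) * cnj (poly q (E x)))"
  by (simp add: ip_def circle_inner_def E_def)

lemma ip_add_left: "ip (p + q) r = ip p r + ip q r"
  by (simp add: ip_eq ring_distribs)

lemma ip_diff_left: "ip (p - q) r = ip p r - ip q r"
  by (simp add: ip_eq left_diff_distrib)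

lemma ip_smult_left: "ip (smult a p) r = a * ip p r"
  by (simp add: ip_eq mult.assoc)

lemma ip_cnj: "ip q p = cnj (ip p q)"
  unfolding ip_eq by (subst Bochner_Integration.integral_cnj[symmetric]) (simp add: mult.commute)

lemma ip_add_right: "ip r (p + q) = ip r p + ip r q"
  by (simp add: ip_cnj[of r] ip_add_left)

lemma ip_diff_right: "ip r (p - q) = ip r p - ip r q"
  by (simp add: ip_cnj[of r] ip_diff_left)

lemma ip_smult_right: "ip r (smult a p) = cnj a * ip r p"
  by (simp add: ip_cnj[of r] ip_smult_left)

lemma ip_0_left [simp]: "ip 0 q = 0" and ip_0_right [simp]: "ip q 0 = 0"
  by (simp_all add: ip_eq)

lemma ip_sum_left: "ip (\<Sum>i\<in>A. f i) q = (\<Sum>i\<in>A. ip (f i) q)"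
  by (induction A rule: infinite_finite_induct) (auto simp: ip_add_left)

lemma ip_sum_right: "ip q (\<Sum>i\<in>A. f i) = (\<Sum>i\<in>A. ip q (f i))"
  by (induction A rule: infinite_finite_induct) (auto simp: ip_add_right)

lemma ip_shift: "ip (pCons 0 p) (pCons 0 q) = ip p q"
proof -
  have *: "E x * a * (cnj (E x) * b) = a * b" for x a b
    using cnj_on_circle[OF norm_E[of x]] by (metis mult.assoc mult.left_commute mult_1)
  show ?thesis by (simp add: ip_eq *)
qed

lemma ip_self: "ip p p = of_real (LINT x|\<theta>. (cmod (poly p (E x)))\<^sup>2)"
  unfolding ip_eq mult_cnj_self by (rule integral_complex_of_real)

text \<open>Nontriviality of the measure makes the inner product definite: a nonzero polynomial has finitely
many zeros, and the measure does not live on a finite set.\<close>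

lemma ip_self_eq_0_iff: "ip p p = 0 \<longleftrightarrow> p = 0"
proof
  assume "ip p p = 0"
  hence z: "(LINT x|\<theta>. (cmod (poly p (E x)))\<^sup>2) = 0" by (simp add: ip_self)
  have i: "integrable \<theta> (\<lambda>x. (cmod (poly p (E x)))\<^sup>2)"
    using integrable_Re[OF integrable_poly_mult[of p p]] unfolding mult_cnj_self by simp
  have "AE x in \<theta>. (cmod (poly p (E x)))\<^sup>2 = 0"
    using integral_nonneg_eq_0_iff_AE[OF i] z by simp
  hence ae: "AE x in \<theta>. x \<in> {x \<in> {0..<1}. poly p (E x) = 0}"
    by (rule AE_mp) (auto intro!: AE_I2 simp: space_measure)
  show "p = 0"
  proof (rule ccontr)
    assume "p \<noteq> 0"
    hence "finite (E ` {x \<in> {0..<1}. poly p (E x) = 0})"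
      by (intro finite_subset[OF _ poly_roots_finite[of p]]) auto
    moreover have "inj_on E {x \<in> {0..<1}. poly p (E x) = 0}"
      by (rule inj_on_subset[OF inj_on_E]) auto
    ultimately have "finite {x \<in> {0..<1}. poly p (E x) = 0}" by (rule finite_imageD)
    with ae nontrivial show False unfolding trivial_measure_def by blast
  qed
qed simp

lemma ip_self_pos: "p \<noteq> 0 \<Longrightarrow> Re (ip p p) > 0"
proof -
  assume "p \<noteq> 0"
  hence "Re (ip p p) \<noteq> 0" using ip_self_eq_0_iff[of p] by (simp add: ip_self)
  moreover have "Re (ip p p) \<ge> 0" by (simp add: ip_self)
  ultimately show ?thesis by simp
qed

lemma ip_self_real: "ip p p = of_real (Re (ip p p))"
  by (simp add: ip_self)

lemma ip_eq_0_left: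
  assumes "degree p < n" "\<And>j. j < n \<Longrightarrow> ip (monom 1 j) q = 0"
  shows "ip p q = 0"
proof -
  have "p = (\<Sum>j\<le>degree p. smult (coeff p j) (monom 1 j))"
    by (simp add: smult_monom poly_as_sum_of_monoms)
  hence "ip p q = (\<Sum>j\<le>degree p. coeff p j * ip (monom 1 j) q)"
    by (metis (no_types, lifting) ip_smult_left ip_sum_left sum.cong)
  thus ?thesis using assms by (auto intro!: sum.neutral)
qed

lemma ip_monom_right: "circle_inner \<theta> (poly p) (\<lambda>z. z ^ j) = ip p (monom 1 j)"
  by (simp add: ip_def circle_inner_def poly_monom)

text \<open>This is the Gram-Schmidt process: projecting the next monomial first gives a vector \<open>u\<close>
orthogonal to all lower degrees, and the projection is then corrected along \<open>u\<close>.\<close>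

lemma orthogonal_projection:
  "\<exists>r. (r = 0 \<or> degree r < n) \<and> (\<forall>j<n. ip (q - r) (monom 1 j) = 0)"
proof (induction n arbitrary: q)
  case 0 show ?case by auto
next
  case (Suc n)
  obtain s where s: "s = 0 \<or> degree s < n" "\<And>j. j < n \<Longrightarrow> ip (monom 1 n - s) (monom 1 j) = 0"
    using Suc.IH by blast
  obtain r where r: "r = 0 \<or> degree r < n" "\<And>j. j < n \<Longrightarrow> ip (q - r) (monom 1 j) = 0"
    using Suc.IH by blast
  define u where "u = monom 1 n - s"
  have deg: "degree u \<le> n" unfolding u_def
    by (rule degree_diff_le) (use s in \<open>auto simp: degree_monom_le\<close>)
  have cs: "coeff s n = 0" using s(1) by (auto intro: coeff_eq_0)
  have "coeff u n = 1" using cs by (simp add: u_def)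
  hence "u \<noteq> 0" by auto
  hence uu: "ip u u \<noteq> 0" by (simp add: ip_self_eq_0_iff)
  define t where "t = r + smult (ip q u / ip u u) u"
  have us: "ip u (monom 1 j) = 0" if "j < n" for j using s(2)[OF that] by (simp add: u_def)
  have tl: "ip (q - t) (monom 1 j) = 0" if "j < n" for j
    using r(2)[OF that] us[OF that] by (simp add: t_def ip_add_left ip_diff_left ip_smult_left)
  have low: "ip p v = 0" if "p = 0 \<or> degree p < n" "\<And>j. j < n \<Longrightarrow> ip v (monom 1 j) = 0" for p v
    using that ip_eq_0_left[of p n v] by (auto simp: ip_cnj[of _ v])
  have "ip u r = 0" using low[OF r(1) us] by (simp add: ip_cnj[of u r])
  hence ru: "ip r u = 0" by (simp add: ip_cnj[of r u])
  have tu: "ip (q - t) u = 0"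
    using uu ru by (simp add: t_def ip_add_left ip_diff_left ip_smult_left)
  have "ip (q - t) s = 0" using low[OF s(1) tl] by (simp add: ip_cnj[of "q - t" s])
  hence "ip (q - t) (monom 1 n) = 0"
    using tu by (simp add: u_def ip_diff_right)
  hence "\<forall>j<Suc n. ip (q - t) (monom 1 j) = 0"
    using tl by (auto simp: less_Suc_eq)
  moreover have "degree t < Suc n" unfolding t_def less_Suc_eq_le
    by (intro degree_add_le order.trans[OF degree_smult_le] deg) (use r in auto)
  ultimately show ?case by blast
qed

lemma monic_orth_poly:
  defines "P \<equiv> monic_orth_poly \<theta>"
  shows "degree (P n) = n" "lead_coeff (P n) = 1" "j < n \<Longrightarrow> ip (P n) (monom 1 j) = 0"
proof -
  let ?Q = "\<lambda>p. degree p = n \<and> lead_coeff p = 1 \<and> (\<forall>j<n. circle_inner \<theta> (poly p) (\<lambda>z. z ^ j) = 0)"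
  have "\<exists>!p. ?Q p"
  proof (rule ex_ex1I)
    obtain r where r: "r = 0 \<or> degree r < n" "\<forall>j<n. ip (monom 1 n - r) (monom 1 j) = 0"
      using orthogonal_projection by blast
    have c: "coeff (monom 1 n - r) n = 1" using r(1) by (auto simp: coeff_eq_0)
    have "degree (monom 1 n - r) \<le> n"
      by (rule degree_diff_le) (use r in \<open>auto simp: degree_monom_le\<close>)
    with c have "degree (monom 1 n - r) = n" by (metis le_antisym le_degree zero_neq_one)
    with c r show "\<exists>p. ?Q p" by (intro exI[of _ "monom 1 n - r"]) (simp add: ip_monom_right)
  next
    fix p q assume p: "?Q p" and q: "?Q q"
    show "p = q"
    proof (cases "n = 0")
      case True
      thus ?thesis using p q by (metis degree_0_id)
    next
      case False
      have "degree (p - q) \<le> n" by (rule degree_diff_le) (use p q in auto)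
      moreover have "coeff p n = 1" "coeff q n = 1" using p q by metis+
      hence "coeff (p - q) n = 0" by simp
      ultimately have d: "degree (p - q) < n" using False
        by (metis coeff_0_degree_minus_1 degree_0 le_neq_implies_less less_nat_zero_code nat_less_le neq0_conv leading_coeff_0_iff)
      have "ip (p - q) (p - q) = 0"
        by (rule ip_eq_0_left[OF d]) (use p q in \<open>auto simp: ip_monom_right ip_cnj[of "monom 1 _"] ip_diff_left\<close>)
      thus ?thesis by (simp add: ip_self_eq_0_iff)
    qed
  qed
  hence "?Q (P n)" unfolding P_def monic_orth_poly_def by (rule theI')
  thus "degree (P n) = n" "lead_coeff (P n) = 1" "j < n \<Longrightarrow> ip (P n) (monom 1 j) = 0"
    by (auto simp: ip_monom_right)
qed

end

section \<open>Orthogonal polynomials and quadrature nodes\<close>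

lemma coeff_star: "coeff (star p) k = (if k > degree p then 0 else cnj (coeff p (degree p - k)))"
  by (simp add: star_def coeff_map_poly coeff_reflect_poly)

lemma degree_star_le: "degree (star p) \<le> degree p"
  by (rule degree_le) (simp add: coeff_star)

lemma poly_star_circle: "cmod z = 1 \<Longrightarrow> poly (star p) z = z ^ degree p * cnj (poly p z)"
proof -
  assume z: "cmod z = 1"
  hence "inverse (cnj z) = z" using cnj_on_circle[OF z] by (metis inverse_unique mult.commute)
  moreover have "z \<noteq> 0" using z by auto
  ultimately show ?thesis by (simp add: poly_star)
qed

lemma degree_linear_mult:
  fixes g :: "complex poly"
  shows "g \<noteq> 0 \<Longrightarrow> degree ([:- w, 1:] * g) = Suc (degree g)"
  by (subst degree_mult_eq) auto

lemma linear_factorE: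
  fixes p :: "complex poly"
  assumes "poly p w = 0"
  obtains g where "p = [:- w, 1:] * g"
  using assms by (auto simp: poly_eq_0_iff_dvd elim: dvdE)

lemma card_roots_eq_degree:
  fixes p :: "complex poly"
  assumes "rsquarefree p"
  shows "card {z. poly p z = 0} = degree p"
proof -
  have p: "p \<noteq> 0" using assms by (simp add: rsquarefree_def)
  have "degree p = size (proots p)" by (simp add: size_proots_complex)
  also have "\<dots> = (\<Sum>z | poly p z = 0. count (proots p) z)"
    using p by (simp add: size_multiset_overloaded_eq)
  also have "\<dots> = (\<Sum>z | poly p z = 0. 1)"
    using assms p by (intro sum.cong refl) (simp add: rsquarefree_root_order)
  finally show ?thesis by simp
qed

locale christoffel_darboux = nontrivial_circle_measure +
  fixes c :: "nat \<Rightarrow> complex" and N :: nat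
  assumes admissible: "admissible_phases \<theta> c"
begin

definition phi :: "complex poly" where "phi = orthonormal_poly \<theta> c (Suc N)"
definition kappa :: complex where "kappa = lead_coeff phi"

lemma phi_altdef: "\<exists>a. a \<noteq> 0 \<and> phi = smult a (monic_orth_poly \<theta> (Suc N)) \<and>
    ip phi phi = 1"
proof -
  let ?P = "monic_orth_poly \<theta> (Suc N)"
  define a where "a = c (Suc N) / of_real (circle_norm \<theta> (poly ?P))"
  have nc: "cmod (c (Suc N)) = 1" using admissible by (simp add: admissible_phases_def)
  have "?P \<noteq> 0" using monic_orth_poly(2)[of "Suc N"] by auto
  hence pos: "Re (ip ?P ?P) > 0" by (rule ip_self_pos)
  have nrm: "circle_norm \<theta> (poly ?P) = sqrt (Re (ip ?P ?P))" by (simp add: circle_norm_def ip_def)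
  have a: "a \<noteq> 0" using nc pos by (auto simp: a_def nrm)
  have ph: "phi = smult a ?P" by (simp add: phi_def orthonormal_poly_def a_def)
  have "ip phi phi = a * cnj a * ip ?P ?P" by (simp add: ph ip_smult_left ip_smult_right)
  also have "a * cnj a = of_real ((cmod a)\<^sup>2)" by (rule mult_cnj_self)
  also have "(cmod a)\<^sup>2 = 1 / Re (ip ?P ?P)" using nc pos by (simp add: a_def nrm norm_divide power_divide)
  also have "of_real \<dots> * ip ?P ?P = 1" using pos ip_self_real[of ?P] by (metis mult.commute nonzero_eq_divide_eq of_real_1 of_real_mult less_irrefl)
  finally show ?thesis using a ph by blast
qed

lemma degree_phi: "degree phi = Suc N" and kappa_nz: "kappa \<noteq> 0"
  and ip_phi: "j \<le> N \<Longrightarrow> ip phi (monom 1 j) = 0" and ip_phi_phi: "ip phi phi = 1"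
proof -
  obtain a where a: "a \<noteq> 0" "phi = smult a (monic_orth_poly \<theta> (Suc N))" "ip phi phi = 1"
    using phi_altdef by blast
  show "degree phi = Suc N" using a monic_orth_poly(1) by simp
  show "kappa \<noteq> 0" using a monic_orth_poly(2) by (simp add: kappa_def)
  show "ip phi (monom 1 j) = 0" if "j \<le> N" using a monic_orth_poly(3)[of j "Suc N"] that
    by (simp add: ip_smult_left)
  show "ip phi phi = 1" by fact
qed

lemma ip_phi_low: "degree p \<le> N \<Longrightarrow> ip p phi = 0"
  using ip_eq_0_left[of p "Suc N" phi] ip_phi by (simp add: ip_cnj[of "monom 1 _"] less_Suc_eq_le)

lemma ip_phi_top: "ip phi (monom 1 (Suc N)) = 1 / cnj kappa"
proof -
  have "degree (phi - smult kappa (monom 1 (Suc N))) \<le> N"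
    by (rule degree_le) (auto simp: kappa_def degree_phi smult_monom coeff_eq_0 less_eq_Suc_le)
  hence "ip (phi - smult kappa (monom 1 (Suc N))) phi = 0" by (rule ip_phi_low)
  hence "kappa * ip (monom 1 (Suc N)) phi = 1"
    by (simp add: ip_diff_left ip_smult_left ip_phi_phi)
  hence "cnj kappa * ip phi (monom 1 (Suc N)) = 1"
    by (metis ip_cnj complex_cnj_mult complex_cnj_one)
  thus ?thesis using kappa_nz by (simp add: field_simps)
qed

lemma ip_star_phi: assumes "j \<le> Suc N"
  shows "ip (star phi) (monom 1 j) = cnj (ip phi (monom 1 (Suc N - j)))"
proof -
  have "E x ^ Suc N * cnj (E x ^ j) = E x ^ (Suc N - j)" for x
  proof -
    have "E x ^ Suc N = E x ^ (Suc N - j) * E x ^ j" using assms by (simp flip: power_add)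
    hence "E x ^ Suc N * cnj (E x ^ j) = E x ^ (Suc N - j) * (E x * cnj (E x)) ^ j"
      by (simp add: power_mult_distrib mult_ac)
    thus ?thesis by (simp add: cnj_on_circle)
  qed
  hence *: "poly (star phi) (E x) * cnj (poly (monom 1 j) (E x)) =
      cnj (poly phi (E x) * cnj (poly (monom 1 (Suc N - j)) (E x)))" for x
    by (simp only: poly_star_circle[OF norm_E] degree_phi poly_monom complex_cnj_mult complex_cnj_cnj mult_1)
       (metis mult.assoc mult.commute)
  show ?thesis unfolding ip_eq by (simp only: *) (rule Bochner_Integration.integral_cnj)
qed

lemma ip_star_phi_0: "1 \<le> j \<Longrightarrow> j \<le> Suc N \<Longrightarrow> ip (star phi) (monom 1 j) = 0"
  by (subst ip_star_phi) (auto simp: ip_phi)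

lemma ip_star_phi_1: "ip (star phi) (monom 1 0) = 1 / kappa"
  by (subst ip_star_phi) (auto simp: ip_phi_top)

text \<open>For \<open>w = 0\<close> the denominator in the definition of the kernel disappears; this is the kernel as a
polynomial in its second argument. The coefficients of degree \<open>N + 1\<close> cancel.\<close>

definition kernel_section_0 :: "complex poly" where "kernel_section_0 = smult kappa (star phi) - smult (cnj (coeff phi 0)) phi"

lemma degree_kernel_section_0: "degree kernel_section_0 \<le> N"
proof (rule degree_le, intro allI impI)
  fix i assume "N < i"
  thus "coeff kernel_section_0 i = 0"
    by (cases "i = Suc N") (auto simp: kernel_section_0_def coeff_star degree_phi kappa_def coeff_eq_0)
qed

text \<open>The polynomial is orthogonal to \<open>z, \<dots>, z ^ N\<close>, because \<open>phi\<close> and \<open>star phi\<close> both are, and its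
inner product with 1 is 1. So pairing with it extracts the constant coefficient.\<close>

lemma reproducing_kernel_section_0: assumes "degree g \<le> N" shows "ip g kernel_section_0 = poly g 0"
proof -
  have 1: "ip kernel_section_0 (monom 1 j) = 0" if "1 \<le> j" "j \<le> N" for j
    using that by (simp add: kernel_section_0_def ip_diff_left ip_smult_left ip_phi ip_star_phi_0)
  have 2: "ip kernel_section_0 (monom 1 0) = 1"
    using kappa_nz ip_phi[of 0] ip_star_phi_1 by (simp add: kernel_section_0_def ip_diff_left ip_smult_left)
  have "ip g kernel_section_0 = ip (g - [:coeff g 0:]) kernel_section_0 + ip [:coeff g 0:] kernel_section_0" by (simp add: ip_diff_left)
  also have "ip [:coeff g 0:] kernel_section_0 = coeff g 0 * ip (monom 1 0) kernel_section_0"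
    by (simp add: ip_smult_left[symmetric] smult_monom monom_0)
  also have "ip (monom 1 0) kernel_section_0 = 1" using 2 ip_cnj[of "monom 1 0" kernel_section_0] by simp
  also have "ip (g - [:coeff g 0:]) kernel_section_0 = 0"
  proof -
    have "g - [:coeff g 0:] = (\<Sum>j\<in>{1..N}. smult (coeff g j) (monom 1 j))"
      using assms by (intro poly_eqI) (auto simp: coeff_sum smult_monom coeff_pCons coeff_eq_0 split: nat.splits)
    thus ?thesis using 1 by (simp add: ip_sum_left ip_smult_left ip_cnj[of "monom 1 _"])
  qed
  finally show ?thesis by (simp add: poly_0_coeff_0)
qed

lemma star_phi_0: "poly (star phi) 0 = cnj kappa"
  by (simp add: poly_0_coeff_0 coeff_star kappa_def)

text \<open>The difference of the squared moduli is the value at 0 of the kernel section, which by the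
reproducing property is the squared norm of that section.\<close>

lemma phi_0_less: "cmod (poly phi 0) < cmod kappa"
proof -
  have "kernel_section_0 \<noteq> 0" using reproducing_kernel_section_0[of 1] by auto
  hence "Re (ip kernel_section_0 kernel_section_0) > 0" by (rule ip_self_pos)
  also have "ip kernel_section_0 kernel_section_0 = poly kernel_section_0 0" by (rule reproducing_kernel_section_0[OF degree_kernel_section_0])
  also have "poly kernel_section_0 0 = kappa * cnj kappa - poly phi 0 * cnj (poly phi 0)"
    by (simp add: kernel_section_0_def star_phi_0 poly_0_coeff_0[of phi, symmetric])
  also have "\<dots> = of_real ((cmod kappa)\<^sup>2 - (cmod (poly phi 0))\<^sup>2)"
    unfolding mult_cnj_self by simp
  finally have "(cmod (poly phi 0))\<^sup>2 < (cmod kappa)\<^sup>2" by simp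
  thus ?thesis by (rule power2_less_imp_less) simp
qed

text \<open>If \<open>phi = (x - z) * g\<close>, then \<open>x * g = phi + z * g\<close> is an orthogonal decomposition of a polynomial
with the same norm as \<open>g\<close>; by Pythagoras \<open>\<bar>z\<bar>\<^sup>2 < 1\<close>.\<close>

lemma phi_nz_circle: assumes z: "cmod z = 1" shows "poly phi z \<noteq> 0"
proof
  assume "poly phi z = 0"
  then obtain g where g: "phi = [:-z, 1:] * g" by (rule linear_factorE)
  have "phi \<noteq> 0" using degree_phi by auto
  hence "g \<noteq> 0" using g by auto
  hence dg: "degree g = N" using degree_phi degree_linear_mult[of g z] unfolding g by simp
  have p: "pCons 0 g = phi + smult z g" by (simp add: g)
  have "ip g g = ip (phi + smult z g) (phi + smult z g)" by (metis ip_shift p)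
  also have "\<dots> = 1 + z * cnj z * ip g g"
    using ip_phi_low[of g] dg ip_cnj[of phi g]
    by (simp add: ip_add_left ip_add_right ip_smult_left ip_smult_right ip_phi_phi)
  finally show False using cnj_on_circle[OF z] by simp
qed

text \<open>Up to the factor \<open>\<i> / 2\<close>, this is the companion polynomial.\<close>

definition node_poly :: "complex poly" where "node_poly = star phi - phi"

lemma node_poly_0: "poly node_poly 0 \<noteq> 0"
proof
  assume "poly node_poly 0 = 0"
  hence "cmod (poly phi 0) = cmod (cnj kappa)" by (simp add: node_poly_def star_phi_0)
  thus False using phi_0_less by simp
qed

lemma degree_node_poly: "degree node_poly = Suc N"
proof (rule antisym)
  show "degree node_poly \<le> Suc N" unfolding node_poly_def
    by (rule degree_diff_le) (use degree_star_le[of phi] degree_phi in auto)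
  have "coeff node_poly (Suc N) = cnj (poly phi 0) - kappa"
    by (simp add: node_poly_def coeff_star degree_phi kappa_def poly_0_coeff_0)
  moreover have "cnj (poly phi 0) \<noteq> kappa" using phi_0_less by (metis complex_mod_cnj less_irrefl)
  ultimately show "Suc N \<le> degree node_poly" by (intro le_degree) simp
qed

lemma node_poly_nz: "node_poly \<noteq> 0" using degree_node_poly by auto

text \<open>These are the degrees to which both terms are orthogonal: \<open>phi\<close> to \<open>1, \<dots>, z ^ N\<close>, and its reflection
\<open>star phi\<close> to \<open>z, \<dots>, z ^ (N + 1)\<close>.\<close>

lemma ip_node_poly: assumes "degree g < N" shows "ip node_poly (pCons 0 g) = 0"
proof -
  have "pCons 0 g = (\<Sum>j\<in>{1..N}. smult (coeff g (j-1)) (monom 1 j))"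
    using assms by (intro poly_eqI) (auto simp: coeff_sum smult_monom coeff_pCons coeff_eq_0 split: nat.splits)
  moreover have "ip node_poly (monom 1 j) = 0" if "1 \<le> j" "j \<le> N" for j
    using that by (simp add: node_poly_def ip_diff_left ip_phi ip_star_phi_0)
  ultimately show ?thesis by (simp add: ip_sum_right ip_smult_right)
qed

text \<open>The two factors are conjugate to each other on the unit circle, up to a constant and a factor \<open>z\<close>.
So the inner product with \<open>z * g\<close>, which vanishes by orthogonality, is a nonzero multiple of the squared
norm of \<open>(z - w) * g\<close>. This single argument excludes zeros off the circle, which come in pairs
\<open>w\<close>, \<open>1 / cnj w\<close>, and double zeros on the circle, where \<open>w = 1 / cnj w\<close>.\<close>

lemma node_poly_no_symmetric_pair:
  assumes w: "w \<noteq> 0" and g: "node_poly = [:-w, 1:] * ([:- inverse (cnj w), 1:] * g)"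
  shows False
proof -
  have "g \<noteq> 0" using g node_poly_nz by auto
  hence "degree node_poly = 2 + degree g" unfolding g
    using degree_linear_mult[of g "inverse (cnj w)"] degree_linear_mult[of "[:- inverse (cnj w), 1:] * g" w]
    by (metis add_2_eq_Suc degree_0 mult_eq_0_iff one_neq_zero pCons_eq_0_iff)
  hence "ip node_poly (pCons 0 g) = 0" using degree_node_poly by (intro ip_node_poly) simp
  moreover have "poly node_poly (E x) * cnj (poly (pCons 0 g) (E x)) =
     - inverse (cnj w) * (poly ([:-w, 1:] * g) (E x) * cnj (poly ([:-w, 1:] * g) (E x)))" for x
  proof -
    have "(E x - inverse (cnj w)) * cnj (E x) = - inverse (cnj w) * cnj (E x - w)"
      using cnj_on_circle[of "E x"] w by (simp add: algebra_simps)
    hence *: "(E x - w) * ((E x - inverse (cnj w)) * cnj (E x)) * (G * cnj G) =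
       (E x - w) * (- inverse (cnj w) * cnj (E x - w)) * (G * cnj G)" for G by simp
    have "poly node_poly (E x) = (E x - w) * ((E x - inverse (cnj w)) * poly g (E x))"
      unfolding g poly_mult by simp
    moreover have "poly ([:-w, 1:] * g) (E x) = (E x - w) * poly g (E x)"
      unfolding poly_mult by simp
    moreover have "poly (pCons 0 g) (E x) = E x * poly g (E x)" by simp
    ultimately show ?thesis using *[of "poly g (E x)"]
      by (simp only: complex_cnj_mult mult.assoc mult.commute mult.left_commute)
  qed
  ultimately have "- inverse (cnj w) * ip ([:-w, 1:] * g) ([:-w, 1:] * g) = 0"
    unfolding ip_eq by (simp only: integral_mult_right_zero)
  hence "[:-w, 1:] * g = 0" using w ip_self_eq_0_iff by simp
  thus False using \<open>g \<noteq> 0\<close> by (metis mult_eq_0_iff one_neq_zero pCons_eq_0_iff)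
qed

definition nodes :: "complex set" where "nodes = {z. poly node_poly z = 0}"

lemma node_poly_reflected_root: assumes "w \<noteq> 0" "poly node_poly w = 0" shows "poly node_poly (inverse (cnj w)) = 0"
proof -
  have "poly (star phi) w = w ^ Suc N * cnj (poly phi (inverse (cnj w)))"
    using assms poly_star[of w phi] by (simp add: degree_phi)
  moreover have "poly (star phi) (inverse (cnj w)) = inverse (cnj w) ^ Suc N * cnj (poly phi w)"
    using assms poly_star[of "inverse (cnj w)" phi] by (simp add: degree_phi)
  moreover have "poly (star phi) w = poly phi w" using assms by (simp add: node_poly_def)
  ultimately show ?thesis using assms(1) by (simp add: node_poly_def power_inverse field_simps)
qed

lemma nodes_circle: assumes "z \<in> nodes" shows "cmod z = 1"
proof (rule ccontr)
  assume nz: "cmod z \<noteq> 1"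
  have z: "poly node_poly z = 0" "z \<noteq> 0" using assms node_poly_0 by (auto simp: nodes_def)
  obtain h where h: "node_poly = [:-z, 1:] * h" using z(1) by (rule linear_factorE)
  have "inverse (cnj z) \<noteq> z"
  proof
    assume "inverse (cnj z) = z"
    hence "z * cnj z = 1" using z by (metis complex_cnj_zero_iff left_inverse)
    hence "(cmod z)\<^sup>2 = 1" by (metis complex_norm_square of_real_eq_1_iff)
    thus False using nz norm_ge_zero[of z] unfolding power2_eq_1_iff by linarith
  qed
  moreover have "poly node_poly (inverse (cnj z)) = 0" by (rule node_poly_reflected_root[OF z(2,1)])
  ultimately have "poly h (inverse (cnj z)) = 0" by (simp add: h)
  then obtain g where "h = [:- inverse (cnj z), 1:] * g" by (rule linear_factorE)
  with h show False using node_poly_no_symmetric_pair[OF z(2)] by blast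
qed

lemma rsquarefree_node_poly: "rsquarefree node_poly"
  unfolding rsquarefree_roots
proof (intro allI notI, elim conjE)
  fix z assume z: "poly node_poly z = 0" "poly (pderiv node_poly) z = 0"
  have nz: "z \<noteq> 0" using z node_poly_0 by auto
  have "cmod z = 1" using nodes_circle[of z] z by (simp add: nodes_def)
  hence inv: "inverse (cnj z) = z" using cnj_on_circle[of z] by (metis inverse_unique mult.commute)
  obtain h where h: "node_poly = [:-z, 1:] * h" using z(1) by (rule linear_factorE)
  have "pderiv node_poly = [:-z, 1:] * pderiv h + h * [:1:]"
    unfolding h pderiv_mult by (simp add: pderiv_pCons)
  hence "poly h z = 0" using z(2) by simp
  then obtain g where "h = [:-z, 1:] * g" by (rule linear_factorE)
  with h inv show False using node_poly_no_symmetric_pair[OF nz] by metis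
qed

lemma card_nodes: "card nodes = Suc N"
  unfolding nodes_def using card_roots_eq_degree[OF rsquarefree_node_poly] degree_node_poly by simp

lemma finite_nodes: "finite nodes"
  using card_nodes by (metis card.infinite nat.distinct(1))

lemma one_in_nodes: "1 \<in> nodes"
proof -
  have "poly phi 1 \<in> \<real>" using admissible by (simp add: admissible_phases_def phi_def)
  hence "cnj (poly phi 1) = poly phi 1" by (simp add: Reals_cnj_iff)
  thus ?thesis by (simp add: nodes_def node_poly_def poly_star_circle)
qed

text \<open>At a node \<open>z\<close> the values of \<open>star phi\<close> and \<open>phi\<close> coincide, so the numerator of the kernel is a multiple
of \<open>node_poly\<close>; moreover \<open>1 - cnj z * x = - cnj z * (x - z)\<close> and \<open>1 / cnj z = z\<close>. This gives the kernel
with first argument \<open>z\<close> as a polynomial in the second.\<close>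

definition kernel_section :: "complex \<Rightarrow> complex poly" where
  "kernel_section z = smult (- z * cnj (poly phi z)) (node_poly div [:-z, 1:])"

lemma node_poly_eq_mult_div: "z \<in> nodes \<Longrightarrow> node_poly = [:-z, 1:] * (node_poly div [:-z, 1:])"
  unfolding nodes_def poly_eq_0_iff_dvd mem_Collect_eq by (rule dvd_mult_div_cancel[symmetric])

lemma degree_kernel_section: assumes "z \<in> nodes" shows "degree (kernel_section z) \<le> N"
proof -
  have "node_poly div [:-z,1:] \<noteq> 0" using node_poly_eq_mult_div[OF assms] node_poly_nz by auto
  hence "degree node_poly = Suc (degree (node_poly div [:-z, 1:]))"
    using degree_linear_mult node_poly_eq_mult_div[OF assms] by metis
  thus ?thesis unfolding kernel_section_def using degree_node_poly by (intro order.trans[OF degree_smult_le]) simp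
qed

lemma poly_kernel_section: assumes "z \<in> nodes"
  shows "(1 - cnj z * x) * poly (kernel_section z) x = cnj (poly phi z) * poly node_poly x"
proof -
  have "poly node_poly x = poly ([:-z, 1:] * (node_poly div [:-z, 1:])) x"
    by (subst node_poly_eq_mult_div[OF assms]) (rule refl)
  hence "poly node_poly x = (x - z) * poly (node_poly div [:-z, 1:]) x"
    unfolding poly_mult by simp
  moreover have "(1 - cnj z * x) * (- z) = x - z"
    using cnj_on_circle[OF nodes_circle[OF assms]] by (simp add: algebra_simps)
  ultimately show ?thesis unfolding kernel_section_def poly_smult by (metis mult.assoc mult.commute)
qed

text \<open>Orthogonality of \<open>node_poly\<close> shows that pairing with the section is evaluation at \<open>z\<close> up to a
constant, namely the pairing with 1. Testing with the section at 0, where both sides are known by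
the reproducing property at 0, identifies the constant as 1.\<close>

lemma reproducing_kernel_section: assumes z: "z \<in> nodes" and f: "degree f \<le> N"
  shows "ip f (kernel_section z) = poly f z"
proof -
  have zc: "cmod z = 1" "z * cnj z = 1" using nodes_circle[OF z] cnj_on_circle by auto
  have multiple: "ip f (kernel_section z) = poly f z * ip 1 (kernel_section z)" if f: "degree f \<le> N" for f :: "complex poly"
  proof -
    have "poly (f - [:poly f z:]) z = 0" by simp
    then obtain g where g: "f - [:poly f z:] = [:-z, 1:] * g" by (rule linear_factorE)
    have "ip ([:-z, 1:] * g) (kernel_section z) = poly phi z * ip (pCons 0 g) node_poly"
    proof -
      have "poly ([:-z, 1:] * g) (E x) * cnj (poly (kernel_section z) (E x)) =
          poly phi z * (poly (pCons 0 g) (E x) * cnj (poly node_poly (E x)))" for x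
      proof -
        have "E x - z = E x * cnj (1 - cnj z * E x)"
          using cnj_on_circle[of "E x"] by (simp add: algebra_simps)
        hence "poly ([:-z, 1:] * g) (E x) * cnj (poly (kernel_section z) (E x)) =
            E x * poly g (E x) * cnj ((1 - cnj z * E x) * poly (kernel_section z) (E x))"
          using cnj_on_circle[OF norm_E[of x]] unfolding poly_mult by (auto simp: algebra_simps)
        also have "\<dots> = poly phi z * (poly (pCons 0 g) (E x) * cnj (poly node_poly (E x)))"
          by (simp only: poly_kernel_section[OF z]) (simp add: mult_ac)
        finally show ?thesis .
      qed
      thus ?thesis unfolding ip_eq by (simp only: integral_mult_right_zero)
    qed
    also have "ip (pCons 0 g) node_poly = 0"
    proof (cases "g = 0")
      case False
      have "degree ([:-z, 1:] * g) \<le> N" unfolding g[symmetric]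
        by (rule degree_diff_le) (use f in auto)
      hence "degree g < N" using degree_linear_mult[OF False, of z] by simp
      thus ?thesis using ip_node_poly[of g] ip_cnj[of "pCons 0 g" node_poly] by simp
    qed simp
    finally have "ip (f - [:poly f z:]) (kernel_section z) = 0" by (simp add: g)
    moreover have "ip [:poly f z:] (kernel_section z) = poly f z * ip 1 (kernel_section z)"
      by (simp add: ip_smult_left[symmetric])
    ultimately show ?thesis by (simp add: ip_diff_left)
  qed
  have "poly phi z \<noteq> 0" by (rule phi_nz_circle[OF zc(1)])
  moreover have d: "kappa - cnj (poly phi 0) \<noteq> 0"
    using phi_0_less by (metis complex_mod_cnj less_irrefl right_minus_eq)
  moreover have "ip kernel_section_0 (kernel_section z) = (kappa - cnj (poly phi 0)) * poly phi z"
  proof -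
    have "poly (kernel_section z) 0 = cnj (poly phi z) * (cnj kappa - poly phi 0)"
      using poly_kernel_section[OF z, of 0] by (simp add: node_poly_def star_phi_0)
    thus ?thesis using reproducing_kernel_section_0[OF degree_kernel_section[OF z]] ip_cnj[of kernel_section_0 "kernel_section z"] by (simp add: mult.commute)
  qed
  moreover have "poly kernel_section_0 z = (kappa - cnj (poly phi 0)) * poly phi z"
  proof -
    have "poly (star phi) z = poly phi z" using z by (simp add: nodes_def node_poly_def)
    thus ?thesis by (simp add: kernel_section_0_def poly_0_coeff_0[of phi] algebra_simps)
  qed
  ultimately have "ip 1 (kernel_section z) = 1" using multiple[OF degree_kernel_section_0] by auto
  thus ?thesis using multiple[OF f] by simp
qed

lemma kernel_section_pos: assumes z: "z \<in> nodes" shows "poly (kernel_section z) z = of_real (Re (poly (kernel_section z) z))" "Re (poly (kernel_section z) z) > 0"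
proof -
  have "kernel_section z \<noteq> 0" using reproducing_kernel_section[OF z, of 1] by auto
  moreover have "poly (kernel_section z) z = ip (kernel_section z) (kernel_section z)" using reproducing_kernel_section[OF z degree_kernel_section[OF z]] by simp
  ultimately show "poly (kernel_section z) z = of_real (Re (poly (kernel_section z) z))" "Re (poly (kernel_section z) z) > 0"
    using ip_self_pos[of "kernel_section z"] ip_self_real[of "kernel_section z"] by simp_all
qed

lemma kernel_section_other_node: assumes "z \<in> nodes" "w \<in> nodes" "w \<noteq> z" shows "poly (kernel_section z) w = 0"
proof -
  have "1 - cnj z * w \<noteq> 0"
  proof
    assume "1 - cnj z * w = 0"
    hence "z * (cnj z * w) = z" by simp
    hence "z = w" using cnj_on_circle[OF nodes_circle[OF assms(1)]] by (simp add: mult.assoc[symmetric])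
    thus False using assms by simp
  qed
  thus ?thesis using poly_kernel_section[OF assms(1), of w] assms(2) by (auto simp: nodes_def)
qed

text \<open>The sections at the nodes vanish at the other nodes, so \<open>f\<close> is the combination of them that
interpolates it, and pairing a section with \<open>g\<close> evaluates \<open>g\<close>.\<close>

lemma gauss_quadrature:
  assumes f: "degree f \<le> N" and g: "degree g \<le> N"
  shows "ip f g = (\<Sum>z\<in>nodes. poly f z * cnj (poly g z) / of_real (Re (poly (kernel_section z) z)))"
proof -
  define h where "h = (\<Sum>z\<in>nodes. smult (poly f z / poly (kernel_section z) z) (kernel_section z))"
  have "poly h w = poly f w" if w: "w \<in> nodes" for w
  proof -
    have "poly h w = (\<Sum>z\<in>nodes. if z = w then poly f w else 0)"
      unfolding h_def poly_sum using kernel_section_other_node[OF _ w] kernel_section_pos[OF w]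
      by (intro sum.cong) auto
    thus ?thesis using w finite_nodes by simp
  qed
  hence r: "nodes \<subseteq> {z. poly (f - h) z = 0}" by auto
  have dh: "degree h \<le> N" unfolding h_def
    by (intro degree_sum_le finite_nodes order.trans[OF degree_smult_le] degree_kernel_section)
  have "f = h"
  proof (rule ccontr)
    assume "f \<noteq> h"
    hence ne: "f - h \<noteq> 0" by simp
    have "card nodes \<le> card {z. poly (f - h) z = 0}" by (intro card_mono r poly_roots_finite ne)
    also have "\<dots> \<le> degree (f - h)" by (rule card_poly_roots_bound[OF ne])
    also have "\<dots> \<le> N" by (rule degree_diff_le) fact+
    finally show False by (simp add: card_nodes)
  qed
  have "ip h g = (\<Sum>z\<in>nodes. poly f z / poly (kernel_section z) z * ip (kernel_section z) g)"
    by (simp add: h_def ip_sum_left ip_smult_left)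
  hence "ip f g = (\<Sum>z\<in>nodes. poly f z / poly (kernel_section z) z * cnj (ip g (kernel_section z)))"
    unfolding \<open>f = h\<close>[symmetric] using ip_cnj[of "kernel_section _" g] by simp
  also have "\<dots> = (\<Sum>z\<in>nodes. poly f z * cnj (poly g z) / of_real (Re (poly (kernel_section z) z)))"
    using kernel_section_pos(1) by (intro sum.cong) (auto simp: reproducing_kernel_section g)
  finally show ?thesis .
qed

text \<open>The limit in the definition of the kernel is the value of the polynomial that extends the
quotient.\<close>

lemma kernel_at_node: assumes z: "z \<in> nodes" shows "kernel \<theta> c N z z = poly (kernel_section z) z"
proof -
  have zc: "cnj z * z = 1" using cnj_on_circle[OF nodes_circle[OF z]] by (simp add: mult.commute)
  have "kernel_quotient \<theta> c N z x = poly (kernel_section z) x" if "x \<noteq> z" for x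
  proof -
    have "1 - cnj z * x \<noteq> 0" using that zc by (metis mult_left_cancel mult_zero_left right_minus_eq zero_neq_one)
    moreover have "poly (star phi) z = poly phi z" using z by (simp add: nodes_def node_poly_def)
    moreover have "kernel_quotient \<theta> c N z x =
       (poly (star phi) x * cnj (poly (star phi) z) - poly phi x * cnj (poly phi z)) / (1 - cnj z * x)"
      by (simp add: kernel_quotient_def phi_def Let_def)
    moreover have "poly (kernel_section z) x = cnj (poly phi z) * poly node_poly x / (1 - cnj z * x)"
      using poly_kernel_section[OF z, of x] calculation(1) by (metis nonzero_mult_div_cancel_left)
    ultimately show ?thesis by (simp add: node_poly_def algebra_simps)
  qed
  hence "eventually (\<lambda>x. poly (kernel_section z) x = kernel_quotient \<theta> c N z x) (at z)"
    by (auto simp: eventually_at_filter)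
  moreover have "((\<lambda>x. poly (kernel_section z) x) \<longlongrightarrow> poly (kernel_section z) z) (at z)"
    by (intro isCont_tendsto_compose[OF poly_isCont] tendsto_ident_at)
  ultimately have "(kernel_quotient \<theta> c N z \<longlongrightarrow> poly (kernel_section z) z) (at z)"
    by (rule Lim_transform_eventually[rotated])
  thus ?thesis using zc by (simp add: kernel_def tendsto_Lim)
qed

lemma companion_eq_0_iff: "companion \<theta> c (N + 1) z = 0 \<longleftrightarrow> z \<in> nodes"
  by (simp add: companion_def nodes_def node_poly_def phi_def)

end

section \<open>Real trigonometric polynomials and their zeros\<close>

text \<open>Multiplication by \<open>E x ^ N\<close> turns a trigonometric polynomial of degree at most \<open>N\<close> into an ordinary
polynomial of degree at most \<open>2 * N\<close> on the unit circle. In this form products, derivatives and zeros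
are those of polynomials.\<close>

definition trig_fun :: "nat \<Rightarrow> (real \<Rightarrow> real) \<Rightarrow> bool" where
  "trig_fun N f \<longleftrightarrow> (\<exists>p. degree p \<le> 2 * N \<and> (\<forall>x. of_real (f x) * E x ^ N = poly p (E x)))"

lemma trig_funI: "degree p \<le> 2 * N \<Longrightarrow> (\<And>x. of_real (f x) * E x ^ N = poly p (E x)) \<Longrightarrow> trig_fun N f"
  by (auto simp: trig_fun_def)

lemma trig_funE:
  assumes "trig_fun N f" obtains p where "degree p \<le> 2 * N" "\<And>x. of_real (f x) * E x ^ N = poly p (E x)"
  using assms by (auto simp: trig_fun_def)

lemma trig_fun_const: "trig_fun N (\<lambda>_. a)"
  by (rule trig_funI[of "monom (of_real a) N"]) (auto simp: degree_monom_eq poly_monom intro: order.trans[OF degree_monom_le])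

lemma trig_fun_add: assumes "trig_fun N f" "trig_fun N g" shows "trig_fun N (\<lambda>x. f x + g x)"
proof -
  obtain p where p: "degree p \<le> 2 * N" "\<And>x. of_real (f x) * E x ^ N = poly p (E x)" using assms by (auto elim: trig_funE)
  obtain q where q: "degree q \<le> 2 * N" "\<And>x. of_real (g x) * E x ^ N = poly q (E x)" using assms by (auto elim: trig_funE)
  show ?thesis by (rule trig_funI[of "p + q"]) (auto simp: p q ring_distribs intro: degree_add_le)
qed

lemma trig_fun_mult: assumes "trig_fun N f" "trig_fun M g" shows "trig_fun (N + M) (\<lambda>x. f x * g x)"
proof -
  obtain p where p: "degree p \<le> 2 * N" "\<And>x. of_real (f x) * E x ^ N = poly p (E x)" using assms by (auto elim: trig_funE)
  obtain q where q: "degree q \<le> 2 * M" "\<And>x. of_real (g x) * E x ^ M = poly q (E x)" using assms by (auto elim: trig_funE)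
  show ?thesis
  proof (rule trig_funI[of "p * q"])
    show "degree (p * q) \<le> 2 * (N + M)" using degree_mult_le[of p q] p(1) q(1) by simp
    show "of_real (f x * g x) * E x ^ (N + M) = poly (p * q) (E x)" for x
      by (simp add: p(2)[symmetric] q(2)[symmetric] power_add mult_ac)
  qed
qed

lemma trig_fun_cmult: "trig_fun N f \<Longrightarrow> trig_fun N (\<lambda>x. a * f x)"
  using trig_fun_mult[OF trig_fun_const[of 0 a]] by simp

lemma trig_fun_diff: "trig_fun N f \<Longrightarrow> trig_fun N g \<Longrightarrow> trig_fun N (\<lambda>x. f x - g x)"
  using trig_fun_add[OF _ trig_fun_cmult[of N g "-1"], of f] by simp

lemma trig_fun_sum: "(\<And>i. i \<in> A \<Longrightarrow> trig_fun N (f i)) \<Longrightarrow> trig_fun N (\<lambda>x. \<Sum>i\<in>A. f i x)"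
  by (induction A rule: infinite_finite_induct) (auto intro: trig_fun_const trig_fun_add)

lemma trig_fun_prod: "finite A \<Longrightarrow> (\<And>i. i \<in> A \<Longrightarrow> trig_fun 1 (f i)) \<Longrightarrow> trig_fun (card A) (\<lambda>x. \<Prod>i\<in>A. f i x)"
proof (induction A rule: finite_induct)
  case (insert a A)
  thus ?case using trig_fun_mult[of 1 "f a" "card A" "\<lambda>x. \<Prod>i\<in>A. f i x"] by simp
qed (simp add: trig_fun_const)

lemma trig_fun_periodic: "trig_fun N f \<Longrightarrow> f (x + of_int n) = f x"
proof -
  assume "trig_fun N f"
  then obtain p where p: "\<And>x. of_real (f x) * E x ^ N = poly p (E x)" by (rule trig_funE) auto
  have "complex_of_real (f (x + of_int n)) * E x ^ N = of_real (f x) * E x ^ N"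
    using p[of "x + of_int n"] p[of x] by (simp only: E_add_int)
  thus ?thesis by simp
qed

text \<open>The half-angle factors are not trigonometric polynomials themselves, but by the product formula
a product of two of them is one of degree 1.\<close>

lemma trig_fun_sin_sin: "trig_fun 1 (\<lambda>x. sin (pi * (x - a)) * sin (pi * (x - b)))"
proof (rule trig_funI)
  let ?p = "[: - cis (pi * (a + b)) / 4, of_real (cos (pi * (a - b)) / 2), - cis (- pi * (a + b)) / 4 :]"
  show "degree ?p \<le> 2 * 1" by simp
  fix x
  have "sin (pi * (x - a)) * sin (pi * (x - b)) = cos (pi * (a - b)) / 2 - cos (2 * pi * x - pi * (a + b)) / 2"
    by (simp add: sin_times_sin algebra_simps diff_divide_distrib) (metis cos_minus minus_diff_eq right_diff_distrib mult.commute)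
  moreover have "2 * complex_of_real (cos (2 * pi * x - pi * (a + b))) * E x =
      cis (- pi * (a + b)) * (E x)\<^sup>2 + cis (pi * (a + b))"
  proof -
    have "2 * complex_of_real (cos t) = cis t + cis (- t)" for t
      by (simp add: complex_eq_iff)
    hence "2 * complex_of_real (cos (2 * pi * x - pi * (a + b))) * E x =
        (cis (2 * pi * x - pi * (a + b)) + cis (pi * (a + b) - 2 * pi * x)) * cis (2 * pi * x)"
      by (simp add: E_eq_cis)
    also have "\<dots> = cis (- pi * (a + b)) * (E x)\<^sup>2 + cis (pi * (a + b))"
      by (simp add: ring_distribs cis_mult E_eq_cis power2_eq_square mult.assoc) (simp add: algebra_simps)
    finally show ?thesis .
  qed
  moreover have "complex_of_real (s / 2 - t / 2) * E x = of_real (s / 2) * E x - (2 * complex_of_real t * E x) / 4" for s t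
    by (simp add: algebra_simps)
  ultimately have "complex_of_real (sin (pi * (x - a)) * sin (pi * (x - b))) * E x =
      of_real (cos (pi * (a - b)) / 2) * E x - (cis (- pi * (a + b)) * (E x)\<^sup>2 + cis (pi * (a + b))) / 4"
    by metis
  also have "\<dots> = poly ?p (E x)"
    by (simp add: power2_eq_square diff_divide_distrib add_divide_distrib ring_distribs mult_ac)
  finally show "complex_of_real (sin (pi * (x - a)) * sin (pi * (x - b))) * E x ^ 1 = poly ?p (E x)"
    by (simp only: power_one_right)
qed

lemma has_vector_derivative_E: "(E has_vector_derivative (2 * of_real pi * \<i> * E x)) (at x)"
proof -
  have "((\<lambda>x. exp (2 * of_real pi * \<i> * of_real x)) has_vector_derivative (2 * of_real pi * \<i> * exp (2 * of_real pi * \<i> * of_real x))) (at x)"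
    by (rule has_vector_derivative_real_field) (auto intro!: derivative_eq_intros)
  thus ?thesis unfolding E_def e_def by (simp add: E_def[abs_def] e_def)
qed

text \<open>If \<open>p\<close> represents \<open>f\<close> in degree \<open>N\<close>, this polynomial represents the derivative of \<open>f\<close>: differentiate
\<open>p (E x) / E x ^ N\<close>.\<close>

definition deriv_poly :: "nat \<Rightarrow> complex poly \<Rightarrow> complex poly" where
  "deriv_poly N p = smult (2 * of_real pi * \<i>) (pCons 0 (pderiv p) - smult (of_nat N) p)"

lemma trig_fun_deriv_aux:
  assumes p: "\<And>x. of_real (f x) * E x ^ N = poly p (E x)"
  shows "\<exists>D. (f has_real_derivative D) (at x) \<and> of_real D * E x ^ N = poly (deriv_poly N p) (E x)"
proof -
  have Epow: "E y ^ N = E (of_nat N * y)" for y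
    by (induction N) (simp_all add: E_add ring_distribs)
  have one: "E y * E (- y) = 1" for y by (simp flip: E_add)
  define D where "D = 2 * of_real pi * \<i> * (poly (pderiv p) (E x) * E x - of_nat N * poly p (E x)) * E (- of_nat N * x)"
  have f: "complex_of_real (f y) = poly p (E y) * E (- of_nat N * y)" for y
    using one[of "of_nat N * y"] by (simp flip: p add: Epow mult.assoc)
  have "((\<lambda>y. poly p (E y)) has_vector_derivative (2 * of_real pi * \<i> * E x * poly (pderiv p) (E x))) (at x)"
    using field_vector_diff_chain_at[OF has_vector_derivative_E poly_DERIV] by (simp add: o_def)
  moreover have "((\<lambda>y. E (- of_nat N * y)) has_vector_derivative (- of_nat N) *\<^sub>R (2 * of_real pi * \<i> * E (- of_nat N * x))) (at x)"
  proof -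
    have "((\<lambda>y. - of_nat N * y) has_vector_derivative (- of_nat N :: real)) (at x)"
      unfolding has_real_derivative_iff_has_vector_derivative[symmetric]
      by (auto intro!: derivative_eq_intros)
    from vector_diff_chain_at[OF this has_vector_derivative_E] show ?thesis by (simp only: o_def)
  qed
  ultimately have "((\<lambda>y. poly p (E y) * E (- of_nat N * y)) has_vector_derivative
     poly p (E x) * ((- of_nat N) *\<^sub>R (2 * of_real pi * \<i> * E (- of_nat N * x))) + 2 * of_real pi * \<i> * E x * poly (pderiv p) (E x) * E (- of_nat N * x)) (at x)"
    by (rule has_vector_derivative_mult)
  moreover have "poly p (E x) * ((- of_nat N) *\<^sub>R (2 * of_real pi * \<i> * E (- of_nat N * x))) + 2 * of_real pi * \<i> * E x * poly (pderiv p) (E x) * E (- of_nat N * x) = D"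
    by (simp add: D_def scaleR_conv_of_real algebra_simps)
  ultimately have g: "((\<lambda>y. complex_of_real (f y)) has_vector_derivative D) (at x)"
    by (simp add: f)
  have re: "(f has_vector_derivative Re D) (at x)"
    using bounded_linear.has_vector_derivative[OF bounded_linear_Re g] by simp
  have "((\<lambda>_. 0) has_vector_derivative Im D) (at x)"
    using bounded_linear.has_vector_derivative[OF bounded_linear_Im g] by simp
  moreover have "((\<lambda>_. 0::real) has_vector_derivative 0) (at x)" by simp
  ultimately have "Im D = 0" by (rule vector_derivative_unique_at)
  hence D: "complex_of_real (Re D) = D" by (simp add: complex_eq_iff)
  have "D * E x ^ N = 2 * of_real pi * \<i> * (poly (pderiv p) (E x) * E x - of_nat N * poly p (E x)) * (E (of_nat N * x) * E (- (of_nat N * x)))"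
    by (simp add: D_def Epow mult_ac)
  hence "D * E x ^ N = poly (deriv_poly N p) (E x)"
    by (simp add: one deriv_poly_def mult_ac)
  thus ?thesis using re D by (intro exI[of _ "Re D"]) (simp add: has_real_derivative_iff_has_vector_derivative)
qed

lemma trig_fun_DERIV: assumes "trig_fun N f" shows "(f has_real_derivative deriv f x) (at x)"
  using assms trig_fun_deriv_aux by (metis trig_funE DERIV_imp_deriv)

lemma trig_fun_deriv_poly:
  assumes "\<And>x. of_real (f x) * E x ^ N = poly p (E x)"
  shows "of_real (deriv f x) * E x ^ N = poly (deriv_poly N p) (E x)"
  using trig_fun_deriv_aux[of f N p x] assms by (metis DERIV_imp_deriv)

lemma trig_fun_deriv: assumes "trig_fun N f" shows "trig_fun N (deriv f)"
proof -
  obtain p where p: "degree p \<le> 2 * N" "\<And>x. of_real (f x) * E x ^ N = poly p (E x)" using assms by (auto elim: trig_funE)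
  have "degree (pCons 0 (pderiv p)) \<le> 2 * N"
  proof (cases "pderiv p = 0")
    case False
    hence "degree p \<noteq> 0" using pderiv_eq_0_iff by blast
    thus ?thesis using p(1) False by (simp add: degree_pderiv)
  qed simp
  hence "degree (deriv_poly N p) \<le> 2 * N" unfolding deriv_poly_def
    by (intro order.trans[OF degree_smult_le] degree_diff_le p(1))
  thus ?thesis using trig_fun_deriv_poly[OF p(2)] by (rule trig_funI)
qed

lemma card_roots_with_double_le_degree:
  fixes p :: "complex poly"
  assumes p: "p \<noteq> 0" and A: "finite A" "D \<subseteq> A" and z: "\<And>a. a \<in> A \<Longrightarrow> poly p a = 0"
    and d: "\<And>a. a \<in> D \<Longrightarrow> poly (pderiv p) a = 0"
  shows "card A + card D \<le> degree p"
proof -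
  have D: "finite D" using A finite_subset by blast
  have 2: "2 \<le> order a p" if "a \<in> D" for a
  proof -
    have "poly p a = 0" using z that A by auto
    then obtain h where h: "p = [:-a, 1:] * h" by (auto simp: poly_eq_0_iff_dvd elim: dvdE)
    have "pderiv p = [:-a, 1:] * pderiv h + h * [:1:]"
      unfolding h pderiv_mult by (simp add: pderiv_pCons)
    hence "poly h a = 0" using d[OF that] by simp
    hence "[:-a, 1:] dvd h" by (simp add: poly_eq_0_iff_dvd)
    hence "[:-a, 1:] ^ 2 dvd p" unfolding h power2_eq_square by (rule mult_dvd_mono[OF dvd_refl])
    thus ?thesis using p by (simp add: order_divides)
  qed
  have 1: "1 \<le> order a p" if "a \<in> A" for a
    using z[OF that] p by (metis order_root One_nat_def Suc_leI neq0_conv)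
  have "mset_set A + mset_set D \<subseteq># proots p"
  proof (rule mset_subset_eqI)
    fix a show "count (mset_set A + mset_set D) a \<le> count (proots p) a"
      using 1[of a] 2[of a] A D p by (auto simp: count_mset_set')
  qed
  hence "size (mset_set A + mset_set D) \<le> size (proots p)" by (rule size_mset_mono)
  also have "\<dots> \<le> degree p" by (rule size_proots_le)
  finally show ?thesis by simp
qed

text \<open>The representing polynomial has degree at most \<open>2 * N\<close>, and double zeros of the function are double
zeros of the polynomial.\<close>

lemma trig_fun_eq_0:
  assumes f: "trig_fun N f" and A: "finite A" "A \<subseteq> {0..<1}" "D \<subseteq> A"
    and z: "\<And>a. a \<in> A \<Longrightarrow> f a = 0" and d: "\<And>a. a \<in> D \<Longrightarrow> deriv f a = 0"
    and c: "2 * N < card A + card D"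
  shows "f x = 0"
proof -
  obtain p where p: "degree p \<le> 2 * N" "\<And>x. of_real (f x) * E x ^ N = poly p (E x)" using f by (auto elim: trig_funE)
  have inj: "inj_on E A" "inj_on E D" using inj_on_subset[OF inj_on_E] A by auto
  have "p = 0"
  proof (rule ccontr)
    assume "p \<noteq> 0"
    hence "card (E ` A) + card (E ` D) \<le> degree p"
    proof (rule card_roots_with_double_le_degree)
      fix w assume "w \<in> E ` A"
      thus "poly p w = 0" using z by (auto simp flip: p(2))
    next
      fix w assume "w \<in> E ` D"
      then obtain a where a: "a \<in> D" "w = E a" by auto
      have "poly p w = 0" using z A a by (auto simp flip: p(2))
      moreover have "poly (deriv_poly N p) w = 0"
        using trig_fun_deriv_poly[OF p(2), of a] d[OF a(1)] a(2) by simp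
      ultimately show "poly (pderiv p) w = 0" using a(2) by (simp add: deriv_poly_def)
    qed (use A in auto)
    thus False using c p(1) inj by (simp add: card_image)
  qed
  thus ?thesis using p(2)[of x] by simp
qed

text \<open>Rolle's theorem between consecutive points of \<open>Z\<close>. The zeros found are different from the points of
\<open>Z\<close>, so they can be counted in addition to zeros of the derivative on \<open>Z\<close> itself.\<close>

lemma rolle_finite_set:
  fixes f :: "real \<Rightarrow> real"
  assumes "card Z = Suc k" and "\<And>z. z \<in> Z \<Longrightarrow> f z = 0" and f: "\<And>x. (f has_real_derivative f' x) (at x)"
  shows "\<exists>Y. finite Y \<and> card Y = k \<and> Y \<inter> Z = {} \<and> Y \<subseteq> {Min Z<..<Max Z} \<and> (\<forall>y\<in>Y. f' y = 0)"
  using assms(1,2)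
proof (induction k arbitrary: Z)
  case 0
  show ?case by (intro exI[of _ "{}"]) auto
next
  case (Suc k)
  have fin: "finite Z" using Suc.prems(1) by (metis card.infinite nat.distinct(1))
  have ne: "Z \<noteq> {}" using Suc.prems(1) by auto
  define m where "m = Max Z"
  define Z' where "Z' = Z - {m}"
  have m: "m \<in> Z" unfolding m_def using fin ne by (rule Max_in)
  have c: "card Z' = Suc k" using Suc.prems(1) m fin by (simp add: Z'_def)
  have fin': "finite Z'" using fin by (simp add: Z'_def)
  have ne': "Z' \<noteq> {}" using c by auto
  obtain Y where Y: "finite Y" "card Y = k" "Y \<inter> Z' = {}" "Y \<subseteq> {Min Z'<..<Max Z'}" "\<forall>y\<in>Y. f' y = 0"
    using Suc.IH[OF c] Suc.prems(2) by (auto simp: Z'_def)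
  have M': "Max Z' \<in> Z'" by (rule Max_in[OF fin' ne'])
  have lt: "Max Z' < m" using M' fin unfolding Z'_def m_def by (metis DiffD1 DiffD2 Max_ge insertI1 le_neq_trans)
  have "\<exists>y. Max Z' < y \<and> y < m \<and> (\<lambda>h. h * f' y) = (\<lambda>v. 0)"
  proof (rule Rolle_deriv[OF lt, of f "\<lambda>y h. h * f' y"])
    show "f (Max Z') = f m" using Suc.prems(2) M' m by (auto simp: Z'_def)
    show "continuous_on {Max Z'..m} f" by (intro continuous_at_imp_continuous_on ballI DERIV_isCont[OF f])
    show "(f has_derivative (\<lambda>h. h * f' x)) (at x)" for x
      using f[of x] by (simp add: has_field_derivative_def mult_commute_abs)
  qed
  then obtain y where y: "Max Z' < y" "y < m" "f' y = 0" by (auto dest: fun_cong[of _ _ 1])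
  have Min: "Min Z = Min Z'"
  proof (rule Min_eqI[OF fin])
    show "Min Z' \<in> Z" using Min_in[OF fin' ne'] by (auto simp: Z'_def)
    fix z assume z: "z \<in> Z"
    show "Min Z' \<le> z"
    proof (cases "z = m")
      case True
      have "Min Z' \<le> Max Z'" using fin' ne' by simp
      thus ?thesis using lt True by linarith
    next
      case False thus ?thesis using z fin' by (auto simp: Z'_def)
    qed
  qed
  have zle: "z \<le> Max Z' \<or> z = m" if "z \<in> Z" for z using that fin' by (auto simp: Z'_def)
  have minmax: "Min Z' \<le> Max Z'" using fin' ne' by simp
  show ?case
  proof (intro exI[of _ "insert y Y"] conjI)
    show "card (insert y Y) = Suc k" using Y y by (subst card_insert_disjoint) auto
    have "y \<notin> Z" using zle[of y] y by auto
    moreover have "m \<notin> Y" using Y(4) lt by auto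
    ultimately show "insert y Y \<inter> Z = {}" using Y(3) by (auto simp: Z'_def)
    show "insert y Y \<subseteq> {Min Z<..<Max Z}" using Y y lt minmax unfolding Min m_def[symmetric] by auto
    show "\<forall>y\<in>insert y Y. f' y = 0" using Y y by auto
  qed (use Y in auto)
qed

lemma positive_near_double_zero:
  fixes U V :: "real \<Rightarrow> real"
  assumes U: "\<And>x. (U has_real_derivative V x) (at x)" and V: "(V has_real_derivative c) (at a)"
    and z: "U a = 0" "V a = 0" and c: "c > 0"
  shows "\<exists>d>0. \<forall>x. x \<noteq> a \<and> \<bar>x - a\<bar> < d \<longrightarrow> U x > 0"
proof -
  obtain d1 where d1: "d1 > 0" "\<And>h. 0 < h \<Longrightarrow> h < d1 \<Longrightarrow> V a < V (a + h)"
    using DERIV_pos_inc_right[OF V c] by blast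
  obtain d2 where d2: "d2 > 0" "\<And>h. 0 < h \<Longrightarrow> h < d2 \<Longrightarrow> V (a - h) < V a"
    using DERIV_pos_inc_left[OF V c] by blast
  show ?thesis
  proof (intro exI[of _ "min d1 d2"] conjI allI impI)
    fix x assume x: "x \<noteq> a \<and> \<bar>x - a\<bar> < min d1 d2"
    show "U x > 0"
    proof (cases "x > a")
      case True
      then obtain y where y: "a < y" "y < x" "U x - U a = (x - a) * V y"
        using MVT2[of a x U V] U by blast
      have "V y > 0" using d1(2)[of "y - a"] y x z by auto
      thus ?thesis using y True z by simp
    next
      case False
      hence "x < a" using x by simp
      then obtain y where y: "x < y" "y < a" "U a - U x = (a - x) * V y"
        using MVT2[of x a U V] U by blast
      have "V y < 0" using d2(2)[of "a - y"] y x z by auto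
      thus ?thesis using y \<open>x < a\<close> z mult_pos_neg[of "a - x" "V y"] by simp
    qed
  qed (use d1 d2 in auto)
qed

text \<open>A function on an interval all of whose zeros are nondegenerate local extrema does not change sign:
the sets where it is positive or has a local minimum at height 0, and negative or has a local maximum
at height 0, are open and disjoint, so by connectedness one is empty.\<close>

lemma constant_sign:
  fixes U V C :: "real \<Rightarrow> real"
  assumes U: "\<And>x. (U has_real_derivative V x) (at x)" and V: "\<And>x. (V has_real_derivative C x) (at x)"
    and z: "\<And>x. x \<in> {0<..<1} \<Longrightarrow> U x = 0 \<Longrightarrow> V x = 0 \<and> C x \<noteq> 0"
  shows "(\<forall>x\<in>{0<..<1}. U x \<ge> 0) \<or> (\<forall>x\<in>{0<..<1}. U x \<le> 0)"
proof -
  define P where "P s = {x \<in> {0<..<1}. s * U x > 0 \<or> (U x = 0 \<and> s * C x > 0)}" for s :: real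
  have cont: "continuous_on UNIV U" by (intro continuous_at_imp_continuous_on ballI DERIV_isCont[OF U])
  have op: "open (P s)" for s
  proof (unfold open_dist, intro ballI)
    fix x assume x: "x \<in> P s"
    have "\<exists>d>0. \<forall>y. y \<noteq> x \<and> \<bar>y - x\<bar> < d \<longrightarrow> s * U y > 0"
    proof (cases "U x = 0")
      case True
      hence "((\<lambda>x. s * V x) has_real_derivative (s * C x)) (at x)" by (intro DERIV_cmult V)
      thus ?thesis using True z[of x] x
        by (intro positive_near_double_zero[of "\<lambda>x. s * U x" "\<lambda>x. s * V x"] DERIV_cmult U) (auto simp: P_def)
    next
      case False
      hence p: "s * U x > 0" using x by (auto simp: P_def)
      have "isCont (\<lambda>x. s * U x) x" using U[of x] by (intro continuous_intros DERIV_isCont)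
      hence "\<forall>\<^sub>F y in at x. s * U y > 0" using p by (intro order_tendstoD(1)[of _ "s * U x"]) (auto simp: isCont_def)
      thus ?thesis by (auto simp: eventually_at dist_real_def)
    qed
    then obtain d where d: "d > 0" "\<And>y. y \<noteq> x \<Longrightarrow> \<bar>y - x\<bar> < d \<Longrightarrow> s * U y > 0" by blast
    have x01: "0 < x" "x < 1" using x by (auto simp: P_def)
    show "\<exists>d>0. \<forall>y. dist y x < d \<longrightarrow> y \<in> P s"
    proof (intro exI[of _ "min d (min x (1 - x))"] conjI allI impI)
      fix y assume y: "dist y x < min d (min x (1 - x))"
      show "y \<in> P s"
      proof (cases "y = x")
        case False
        have "s * U y > 0" using d(2)[OF False] y by (simp add: dist_real_def)
        thus ?thesis using y by (auto simp: P_def dist_real_def)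
      qed (use x in simp)
    qed (use d x01 in auto)
  qed
  have cov: "{0<..<1} \<subseteq> P 1 \<union> P (-1)" using z by (force simp: P_def)
  have "P 1 \<inter> P (-1) \<inter> {0<..<1} = {}" by (auto simp: P_def)
  hence "P 1 \<inter> {0<..<1} = {} \<or> P (-1) \<inter> {0<..<1} = {}"
    using connectedD[OF connected_Ioo op op] cov by blast
  thus ?thesis
  proof
    assume *: "P 1 \<inter> {0<..<1} = {}"
    hence "\<forall>x\<in>{0<..<1}. x \<in> P (-1)" using cov by blast
    hence "\<forall>x\<in>{0<..<1}. U x \<le> 0" by (fastforce simp: P_def)
    thus ?thesis ..
  next
    assume *: "P (-1) \<inter> {0<..<1} = {}"
    hence "\<forall>x\<in>{0<..<1}. x \<in> P 1" using cov by blast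
    hence "\<forall>x\<in>{0<..<1}. U x \<ge> 0" by (fastforce simp: P_def)
    thus ?thesis ..
  qed
qed

section \<open>Hermite interpolation on the circle\<close>

text \<open>The set \<open>X\<close> holds the nodes other than 0. Its cardinality \<open>N\<close> is the degree of the
interpolating trigonometric polynomials: values at the \<open>N + 1\<close> nodes and slopes at \<open>N\<close> of them are
\<open>2 * N + 1\<close> conditions.\<close>

locale interpolation_nodes =
  fixes X :: "real set"
  assumes finite_X: "finite X" and X_subset: "X \<subseteq> {0<..<1}"
begin

abbreviation "N \<equiv> card X"

lemma trig_fun_eqI:
  assumes "trig_fun N f" "trig_fun N g" "f 0 = g 0" "\<And>a. a \<in> X \<Longrightarrow> f a = g a" "\<And>a. a \<in> X \<Longrightarrow> deriv f a = deriv g a"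
  shows "f = g"
proof
  fix x
  have h: "trig_fun N (\<lambda>x. f x - g x)" using assms by (intro trig_fun_diff)
  have d: "deriv (\<lambda>x. f x - g x) a = deriv f a - deriv g a" for a
    by (intro DERIV_imp_deriv DERIV_diff trig_fun_DERIV[of N]) fact+
  have "0 \<notin> X" using X_subset by auto
  have "f x - g x = 0"
  proof (rule trig_fun_eq_0[OF h, of "insert 0 X" X])
    show "finite (insert 0 X)" "insert 0 X \<subseteq> {0..<1}" "X \<subseteq> insert 0 X"
      using finite_X X_subset by auto
    show "f a - g a = 0" if "a \<in> insert 0 X" for a using that assms(3,4) by auto
    show "deriv (\<lambda>x. f x - g x) a = 0" if "a \<in> X" for a using that assms(5) d by simp
    show "2 * N < card (insert 0 X) + card X" using \<open>0 \<notin> X\<close> finite_X by simp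
  qed
  thus "f x = g x" by simp
qed

definition sq_prod :: "real set \<Rightarrow> real \<Rightarrow> real" where
  "sq_prod Y x = (\<Prod>a\<in>Y. sin (pi * (x - a)) * sin (pi * (x - a)))"

text \<open>The basis of cardinal functions consists of \<open>bump\<close>, which carries the value at 0,
\<open>slope_fun a\<close>, which carries the slope at \<open>a\<close>, and \<open>value_fun a\<close>, which carries the value at \<open>a\<close>. In the
last one, \<open>value_fun0 a\<close> has the right values but a slope at \<open>a\<close> that has to be corrected. The factors
vanishing at 0 contain \<open>x - 0\<close> so that all factors have the same form.\<close>

definition bump :: "real \<Rightarrow> real" where "bump x = (1 / sq_prod X 0) * sq_prod X x"

definition slope_fun :: "real \<Rightarrow> real \<Rightarrow> real" where
  "slope_fun a x = (1 / (pi * sin (pi * a) * sq_prod (X - {a}) a)) *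
     (sin (pi * (x - 0)) * sin (pi * (x - a)) * sq_prod (X - {a}) x)"

definition value_fun0 :: "real \<Rightarrow> real \<Rightarrow> real" where
  "value_fun0 a x = (1 / (sin (pi * a) * sin (pi * a) * sq_prod (X - {a}) a)) *
     (sin (pi * (x - 0)) * sin (pi * (x - 0)) * sq_prod (X - {a}) x)"

definition value_fun :: "real \<Rightarrow> real \<Rightarrow> real" where
  "value_fun a x = value_fun0 a x - deriv (value_fun0 a) a * slope_fun a x"

lemma sin_nz: assumes "x \<in> {0..<1}" "a \<in> {0..<1}" "x \<noteq> a" shows "sin (pi * (x - a)) \<noteq> 0"
proof
  assume "sin (pi * (x - a)) = 0"
  then obtain n :: int where "pi * (x - a) = of_int n * pi" by (auto simp: sin_zero_iff_int2)
  hence "x - a = of_int n" by simp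
  moreover have "\<bar>x - a\<bar> < 1" using assms by auto
  ultimately have "n = 0" by linarith
  thus False using \<open>x - a = of_int n\<close> assms by simp
qed

lemma sq_prod_nz: assumes "Y \<subseteq> X" "x \<in> {0..<1}" "x \<notin> Y" shows "sq_prod Y x \<noteq> 0"
proof -
  have "finite Y" using assms finite_X finite_subset by blast
  moreover have "sin (pi * (x - a)) \<noteq> 0" if "a \<in> Y" for a
    using assms X_subset that by (intro sin_nz) auto
  ultimately show ?thesis by (simp add: sq_prod_def)
qed

lemma trig_fun_sq_prod: "Y \<subseteq> X \<Longrightarrow> trig_fun (card Y) (sq_prod Y)"
  unfolding sq_prod_def[abs_def] using finite_subset[OF _ finite_X] by (intro trig_fun_prod trig_fun_sin_sin)

lemma card_X_diff: "a \<in> X \<Longrightarrow> 1 + card (X - {a}) = N"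
  using card_Suc_Diff1[OF finite_X, of a] by simp

lemma trig_fun_bump: "trig_fun N bump"
  unfolding bump_def[abs_def] by (intro trig_fun_cmult trig_fun_sq_prod) simp

lemma trig_fun_slope_fun: "a \<in> X \<Longrightarrow> trig_fun N (slope_fun a)"
  unfolding slope_fun_def[abs_def] card_X_diff[symmetric]
  by (intro trig_fun_cmult trig_fun_mult trig_fun_sin_sin trig_fun_sq_prod) auto

lemma trig_fun_value_fun0: "a \<in> X \<Longrightarrow> trig_fun N (value_fun0 a)"
  unfolding value_fun0_def[abs_def] card_X_diff[symmetric]
  by (intro trig_fun_cmult trig_fun_mult trig_fun_sin_sin trig_fun_sq_prod) auto

lemma trig_fun_value_fun: "a \<in> X \<Longrightarrow> trig_fun N (value_fun a)"
  unfolding value_fun_def[abs_def] by (intro trig_fun_diff trig_fun_cmult trig_fun_value_fun0 trig_fun_slope_fun)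

text \<open>A squared factor kills the derivative at its zero, whatever the other factor is.\<close>

lemma deriv_double_zero:
  assumes "\<And>x. f x = g x * (sin (pi * (x - a)) * sin (pi * (x - a)))" "(g has_real_derivative D) (at a)"
  shows "deriv f a = 0"
proof -
  have "((\<lambda>x. g x * (sin (pi * (x - a)) * sin (pi * (x - a)))) has_real_derivative 0) (at a)"
    using assms(2) by (auto intro!: derivative_eq_intros)
  moreover have "f = (\<lambda>x. g x * (sin (pi * (x - a)) * sin (pi * (x - a))))" using assms(1) by auto
  ultimately show ?thesis by (simp add: DERIV_imp_deriv)
qed

lemma sq_prod_split:
  assumes "Y \<subseteq> X" "a \<in> Y"
  shows "sq_prod Y x = sq_prod (Y - {a}) x * (sin (pi * (x - a)) * sin (pi * (x - a)))"
  unfolding sq_prod_def using assms finite_subset[OF _ finite_X, of Y]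
  by (subst prod.remove[of Y a]) (auto simp: mult_ac)

lemma sq_prod_DERIV: "Y \<subseteq> X \<Longrightarrow> \<exists>D. (sq_prod Y has_real_derivative D) (at x)"
  using trig_fun_DERIV[OF trig_fun_sq_prod] by blast

lemma sq_prod_eq_0: "Y \<subseteq> X \<Longrightarrow> a \<in> Y \<Longrightarrow> sq_prod Y a = 0"
  by (simp add: sq_prod_split)

lemma deriv_mult_sq_prod:
  assumes Y: "Y \<subseteq> X" "b \<in> Y" and f: "\<And>x. f x = h x * sq_prod Y x" and h: "(h has_real_derivative D) (at b)"
  shows "deriv f b = 0"
proof -
  obtain D' where "(sq_prod (Y - {b}) has_real_derivative D') (at b)" using sq_prod_DERIV[of "Y - {b}" b] Y by auto
  hence "((\<lambda>x. h x * sq_prod (Y - {b}) x) has_real_derivative (D * sq_prod (Y - {b}) b + D' * h b)) (at b)"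
    by (intro DERIV_mult h)
  moreover have "f x = (h x * sq_prod (Y - {b}) x) * (sin (pi * (x - b)) * sin (pi * (x - b)))" for x
    by (simp add: f sq_prod_split[OF Y] mult_ac)
  ultimately show ?thesis by (intro deriv_double_zero)
qed

lemma bump_0: "bump 0 = 1"
  using sq_prod_nz[of X 0] X_subset by (force simp: bump_def)

lemma bump_node: "a \<in> X \<Longrightarrow> bump a = 0" and deriv_bump_node: "a \<in> X \<Longrightarrow> deriv bump a = 0"
  by (auto simp: bump_def sq_prod_eq_0 intro!: deriv_mult_sq_prod[of X a _ "\<lambda>_. 1 / sq_prod X 0" 0])

lemma slope_fun_0: "slope_fun a 0 = 0" and value_fun0_0: "value_fun0 a 0 = 0"
  by (simp_all add: slope_fun_def value_fun0_def)

lemma node_facts: assumes "a \<in> X"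
  shows "sin (pi * a) \<noteq> 0" "sq_prod (X - {a}) a \<noteq> 0"
proof -
  have a: "a \<in> {0<..<1}" using assms X_subset by blast
  show "sin (pi * a) \<noteq> 0" using sin_nz[of a 0] a by simp
  show "sq_prod (X - {a}) a \<noteq> 0" using a by (intro sq_prod_nz) auto
qed

lemma slope_fun_node: "a \<in> X \<Longrightarrow> b \<in> X \<Longrightarrow> slope_fun a b = 0"
  by (cases "a = b") (auto simp: slope_fun_def sq_prod_eq_0)

lemma value_fun0_node: "a \<in> X \<Longrightarrow> b \<in> X \<Longrightarrow> value_fun0 a b = (if b = a then 1 else 0)"
  using node_facts by (auto simp: value_fun0_def sq_prod_eq_0)

lemma deriv_slope_fun_node: assumes a: "a \<in> X" and b: "b \<in> X" shows "deriv (slope_fun a) b = (if b = a then 1 else 0)"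
proof (cases "b = a")
  case False
  have "deriv (slope_fun a) b = 0"
    by (rule deriv_mult_sq_prod[of "X - {a}" b _ "\<lambda>x. (1 / (pi * sin (pi * a) * sq_prod (X - {a}) a)) * (sin (pi * (x - 0)) * sin (pi * (x - a)))"])
       (use False b node_facts[OF a] in \<open>auto simp: slope_fun_def intro!: derivative_eq_intros\<close>)
  thus ?thesis using False by simp
next
  case True
  obtain D where D: "(sq_prod (X - {a}) has_real_derivative D) (at a)" using sq_prod_DERIV[of "X - {a}" a] by auto
  have "(slope_fun a has_real_derivative 1) (at a)" unfolding slope_fun_def[abs_def]
    by (rule derivative_eq_intros D refl)+ (use node_facts[OF a] in simp)
  thus ?thesis using True by (simp add: DERIV_imp_deriv)
qed

lemma deriv_value_fun0_node: assumes a: "a \<in> X" and b: "b \<in> X" "b \<noteq> a" shows "deriv (value_fun0 a) b = 0"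
  by (rule deriv_mult_sq_prod[of "X - {a}" b _ "\<lambda>x. (1 / (sin (pi * a) * sin (pi * a) * sq_prod (X - {a}) a)) * (sin (pi * (x - 0)) * sin (pi * (x - 0)))"])
     (use b node_facts[OF a] in \<open>auto simp: value_fun0_def intro!: derivative_eq_intros\<close>)

lemma value_fun_0: "value_fun a 0 = 0" by (simp add: value_fun_def slope_fun_0 value_fun0_0)

lemma value_fun_node: "a \<in> X \<Longrightarrow> b \<in> X \<Longrightarrow> value_fun a b = (if b = a then 1 else 0)"
  by (simp add: value_fun_def slope_fun_node value_fun0_node)

lemma deriv_value_fun_node: assumes a: "a \<in> X" and b: "b \<in> X" shows "deriv (value_fun a) b = 0"
proof -
  have "deriv (value_fun a) b = deriv (value_fun0 a) b - deriv (value_fun0 a) a * deriv (slope_fun a) b"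
    unfolding value_fun_def[abs_def]
    by (intro DERIV_imp_deriv DERIV_diff DERIV_cmult trig_fun_DERIV[of N] trig_fun_value_fun0 trig_fun_slope_fun a)
  thus ?thesis using deriv_slope_fun_node[OF a b] deriv_value_fun0_node[OF a b] by auto
qed

definition interpolant :: "real \<Rightarrow> (real \<Rightarrow> real) \<Rightarrow> (real \<Rightarrow> real) \<Rightarrow> real \<Rightarrow> real" where
  "interpolant v0 v d x = v0 * bump x + (\<Sum>a\<in>X. v a * value_fun a x + d a * slope_fun a x)"

lemma trig_fun_interpolant: "trig_fun N (interpolant v0 v d)"
  unfolding interpolant_def[abs_def]
  by (intro trig_fun_add trig_fun_cmult trig_fun_sum trig_fun_bump trig_fun_value_fun trig_fun_slope_fun)

lemma interpolant_0: "interpolant v0 v d 0 = v0"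
  by (simp add: interpolant_def bump_0 value_fun_0 slope_fun_0)

lemma interpolant_node: "b \<in> X \<Longrightarrow> interpolant v0 v d b = v b"
proof -
  assume b: "b \<in> X"
  have "(\<Sum>a\<in>X. v a * value_fun a b + d a * slope_fun a b) = (\<Sum>a\<in>X. if a = b then v b else 0)"
    using b by (intro sum.cong) (auto simp: value_fun_node slope_fun_node)
  thus ?thesis using b finite_X by (simp add: interpolant_def bump_node)
qed

lemma deriv_interpolant_node: "b \<in> X \<Longrightarrow> deriv (interpolant v0 v d) b = d b"
proof -
  assume b: "b \<in> X"
  have "deriv (interpolant v0 v d) b = v0 * deriv bump b + (\<Sum>a\<in>X. v a * deriv (value_fun a) b + d a * deriv (slope_fun a) b)"
    unfolding interpolant_def[abs_def]
    by (intro DERIV_imp_deriv DERIV_add DERIV_cmult DERIV_sum trig_fun_DERIV[of N] trig_fun_bump trig_fun_value_fun trig_fun_slope_fun)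
  also have "(\<Sum>a\<in>X. v a * deriv (value_fun a) b + d a * deriv (slope_fun a) b) = (\<Sum>a\<in>X. if a = b then d b else 0)"
    using b by (intro sum.cong) (auto simp: deriv_value_fun_node deriv_slope_fun_node)
  finally show ?thesis using b finite_X by (simp add: deriv_bump_node)
qed

text \<open>Interpolation reproduces constants. So the constant \<open>1 / l\<close> may be subtracted before and after
interpolating, which makes the limit \<open>l \<rightarrow> 0\<close> below finite.\<close>

lemma interpolant_const: "interpolant a (\<lambda>_. a) (\<lambda>_. 0) x = a"
proof -
  have "interpolant a (\<lambda>_. a) (\<lambda>_. 0) = (\<lambda>_. a)"
    by (intro trig_fun_eqI trig_fun_interpolant trig_fun_const) (auto simp: interpolant_0 interpolant_node deriv_interpolant_node)
  thus ?thesis by metis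
qed

lemma interpolant_diff:
  "interpolant (v0 - w0) (\<lambda>a. v a - w a) (\<lambda>a. d a - d' a) x = interpolant v0 v d x - interpolant w0 w d' x"
  by (simp add: interpolant_def algebra_simps sum.distrib sum_subtractf)

section \<open>One-sided interpolation\<close>

lemma Min_Max_insert_0_1: "Z \<subseteq> {0<..<1} \<Longrightarrow> finite Z \<Longrightarrow> Min (insert 0 (insert 1 Z)) = (0::real) \<and> Max (insert 0 (insert 1 Z)) = 1"
  by (intro conjI Min_eqI Max_eqI) (auto intro: less_imp_le)

text \<open>The interpolated function is the restriction to \<open>[0, 1]\<close> of the periodized truncated exponential.
Its error, multiplied by \<open>exp (l * x)\<close>, is \<open>U\<close>; differentiating removes the linear factor \<open>x * A + B\<close> in
two steps, and \<open>U'' = C = - exp (l * x) * T x\<close> with a trigonometric polynomial \<open>T\<close>. The error vanishes at 0,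
at 1 and doubly on \<open>X\<close>. One further zero in the interval, or a vanishing second derivative on \<open>X\<close>,
would give \<open>T\<close> more than \<open>2 * N\<close> zeros. So the error has constant sign. The sign is found from the corner at 0,
where the slope of the periodized function jumps upwards: a nonpositive \<open>U\<close> would have \<open>V 0 \<le> 0\<close> and
\<open>V 1 \<ge> 0\<close>, contradicting the periodicity of \<open>P\<close>.\<close>

lemma minorant_interpolant:
  fixes l :: real and L :: "real \<Rightarrow> real"
  defines "A \<equiv> 1 / (1 - exp (- l))" and "B \<equiv> exp (- l) / (1 - exp (- l))\<^sup>2"
  assumes l: "l > 0" and L: "trig_fun N L" and L0: "L 0 = B"
    and LX: "\<And>a. a \<in> X \<Longrightarrow> L a = exp (- l * a) * (a * A + B)"
    and dX: "\<And>a. a \<in> X \<Longrightarrow> deriv L a = exp (- l * a) * (A - l * (a * A + B))"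
    and x: "x \<in> {0..1}"
  shows "L x \<le> exp (- l * x) * (x * A + B)"
proof -
  define P where "P x = deriv L x + l * L x" for x
  define T where "T x = deriv P x + l * P x" for x
  define U where "U x = x * A + B - exp (l * x) * L x" for x
  define V where "V x = A - exp (l * x) * P x" for x
  define C where "C x = - exp (l * x) * T x" for x
  have exl: "exp (- l) < 1" using l by simp
  have A: "A > 0" using exl by (simp add: A_def)
  have P: "trig_fun N P" unfolding P_def[abs_def] by (intro trig_fun_add trig_fun_cmult trig_fun_deriv L)
  have T: "trig_fun N T" unfolding T_def[abs_def] by (intro trig_fun_add trig_fun_cmult trig_fun_deriv P)
  have ex: "((\<lambda>x. exp (l * x)) has_real_derivative l * exp (l * x)) (at x)" for x
    by (auto intro!: derivative_eq_intros)
  have dU: "(U has_real_derivative V x) (at x)" for x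
    unfolding U_def[abs_def] V_def P_def
    by (rule derivative_eq_intros ex trig_fun_DERIV[OF L] refl)+ (simp add: algebra_simps)
  have dV: "(V has_real_derivative C x) (at x)" for x
    unfolding V_def[abs_def] C_def T_def
    by (rule derivative_eq_intros ex trig_fun_DERIV[OF P] refl)+ (simp add: algebra_simps)
  have L1: "L 1 = L 0" "P 1 = P 0" using trig_fun_periodic[OF L, of 0 1] trig_fun_periodic[OF P, of 0 1] by auto
  have U0: "U 0 = 0" by (simp add: U_def L0)
  have "1 / (1 - q) + q / (1 - q)\<^sup>2 = 1 / (1 - q)\<^sup>2" if "q < 1" for q :: real
    using that by (simp add: power2_eq_square divide_simps)
  hence "A + B = 1 / (1 - exp (- l))\<^sup>2" using exl by (simp add: A_def B_def)
  also have "\<dots> = exp l * B" by (simp add: B_def flip: exp_add)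
  finally have "A + B = exp l * B" .
  hence U1: "U 1 = 0" by (simp add: U_def L0 L1)
  have ee: "exp (l * a) * exp (- l * a) = 1" for a by (simp flip: exp_add)
  have UX: "U a = 0" if "a \<in> X" for a
    using ee[of a] LX[OF that] by (simp add: U_def flip: mult.assoc)
  have VX: "V a = 0" if "a \<in> X" for a
  proof -
    have "P a = exp (- l * a) * A" using LX[OF that] dX[OF that] by (simp add: P_def algebra_simps)
    thus ?thesis using ee[of a] by (simp add: V_def flip: mult.assoc)
  qed
  have zeros: "\<exists>Y. finite Y \<and> card Y = N + 1 + k \<and> Y \<inter> Z = {} \<and> Y \<subseteq> {0<..<1} \<and> (\<forall>y\<in>Y. V y = 0)"
    if "finite Z" "card Z = N + k" "Z \<subseteq> {0<..<1}" "\<And>z. z \<in> Z \<Longrightarrow> U z = 0" for Z k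
  proof -
    have "card (insert 0 (insert 1 Z)) = Suc (N + 1 + k)" using that by (subst card_insert_disjoint; (subst card_insert_disjoint)?) auto
    moreover have "U z = 0" if "z \<in> insert 0 (insert 1 Z)" for z using that \<open>\<And>z. z \<in> Z \<Longrightarrow> U z = 0\<close> U0 U1 by auto
    ultimately show ?thesis using rolle_finite_set[of "insert 0 (insert 1 Z)" "N + 1 + k" U V] dU Min_Max_insert_0_1[of Z] that
      by auto
  qed
  have zerosT: "\<exists>R. finite R \<and> card R = N + N + k \<and> R \<inter> X = {} \<and> R \<subseteq> {0<..<1} \<and> (\<forall>y\<in>R. T y = 0)"
    if Z: "finite Z" "card Z = N + k" "Z \<subseteq> {0<..<1}" "X \<subseteq> Z" "\<And>z. z \<in> Z \<Longrightarrow> U z = 0" for Z k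
  proof -
    obtain Y where Y: "finite Y" "card Y = N + 1 + k" "Y \<inter> Z = {}" "Y \<subseteq> {0<..<1}" "\<forall>y\<in>Y. V y = 0"
      using zeros[OF Z(1,2,3,5)] by blast
    have "card (X \<union> Y) = Suc (N + N + k)" using Y Z finite_X by (subst card_Un_disjoint) auto
    moreover have "V z = 0" if "z \<in> X \<union> Y" for z using that Y VX by auto
    ultimately obtain R where R: "finite R" "card R = N + N + k" "R \<inter> (X \<union> Y) = {}"
      "R \<subseteq> {Min (X \<union> Y)<..<Max (X \<union> Y)}" "\<forall>y\<in>R. C y = 0"
      using rolle_finite_set[of "X \<union> Y" "N + N + k" V C] dV by blast
    have fin: "finite (X \<union> Y)" and ne: "X \<union> Y \<noteq> {}" using finite_X Y by auto
    have "Min (X \<union> Y) \<in> X \<union> Y" "Max (X \<union> Y) \<in> X \<union> Y" using Min_in[OF fin ne] Max_in[OF fin ne] by auto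
    hence "Min (X \<union> Y) > 0" "Max (X \<union> Y) < 1" using X_subset Y by auto
    hence "R \<subseteq> {0<..<1}" using R(4) by force
    thus ?thesis using R by (intro exI[of _ R]) (auto simp: C_def)
  qed
  \<comment> \<open>If \<open>T = 0\<close>, then \<open>V\<close> is constant, and periodicity of \<open>P\<close> forces \<open>P = 0\<close> and \<open>V = A > 0\<close>; but \<open>V\<close> has a zero by Rolle.\<close>
  have T_nz: False if T0: "\<And>x. T x = 0"
  proof -
    have "C x = 0" for x using T0 by (simp add: C_def)
    hence "(V has_real_derivative 0) (at x)" for x using dV[of x] by simp
    hence Vc: "V x = V y" for x y using DERIV_isconst_all by blast
    have "exp (l * 1) * P 1 = exp (l * 0) * P 0" using Vc[of 1 0] by (simp add: V_def)
    hence "(exp l - 1) * P 0 = 0" by (simp add: L1 algebra_simps)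
    hence "P 0 = 0" using l by simp
    hence "V 0 = A" by (simp add: V_def)
    hence VA: "V x = A" for x using Vc by metis
    obtain Y where "card Y = N + 1 + 0" "\<forall>y\<in>Y. V y = 0"
      using zeros[of X 0] finite_X X_subset UX by auto
    thus False using VA A by (cases "Y = {}") auto
  qed
  have nodes_only: "y \<in> X" if y: "y \<in> {0<..<1}" "U y = 0" for y
  proof (rule ccontr)
    assume "y \<notin> X"
    hence "\<exists>R. finite R \<and> card R = N + N + 1 \<and> R \<inter> X = {} \<and> R \<subseteq> {0<..<1} \<and> (\<forall>y\<in>R. T y = 0)"
      using y finite_X X_subset UX by (intro zerosT[of "insert y X" 1]) auto
    then obtain R where R: "finite R" "card R = N + N + 1" "R \<subseteq> {0<..<1}" "\<forall>y\<in>R. T y = 0" by blast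
    have "T x = 0" for x by (rule trig_fun_eq_0[OF T R(1), of "{}"]) (use R in auto)
    thus False by (rule T_nz)
  qed
  have CX: "C a \<noteq> 0" if a: "a \<in> X" for a
  proof
    assume "C a = 0"
    hence Ta: "T a = 0" by (simp add: C_def)
    obtain R where R: "finite R" "card R = N + N + 0" "R \<inter> X = {}" "R \<subseteq> {0<..<1}" "\<forall>y\<in>R. T y = 0"
      using zerosT[of X 0] finite_X X_subset UX by auto
    have "a \<notin> R" using R(3) a by auto
    hence c: "2 * N < card (insert a R) + card ({} :: real set)" using R by simp
    have sub: "insert a R \<subseteq> {0..<1}" using R(4) a X_subset by auto
    have "T x = 0" for x
      by (rule trig_fun_eq_0[OF T _ sub _ _ _ c]) (use R Ta in auto)
    thus False by (rule T_nz)
  qed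
  have "(\<forall>x\<in>{0<..<1}. U x \<ge> 0) \<or> (\<forall>x\<in>{0<..<1}. U x \<le> 0)"
    by (rule constant_sign[OF dU dV]) (use nodes_only VX CX in auto)
  moreover have "\<not> (\<forall>x\<in>{0<..<1}. U x \<le> 0)"
  proof
    assume neg: "\<forall>x\<in>{0<..<1}. U x \<le> 0"
    have "V 0 \<le> 0"
    proof (rule ccontr)
      assume "\<not> V 0 \<le> 0"
      then obtain d where d: "d > 0" "\<And>h. 0 < h \<Longrightarrow> h < d \<Longrightarrow> U 0 < U (0 + h)"
        using DERIV_pos_inc_right[OF dU[of 0]] by auto
      have "U 0 < U (0 + min (d / 2) (1 / 2))" using d(1) by (intro d(2)) auto
      moreover have "0 + min (d / 2) (1 / 2) \<in> {0<..<1}" using d(1) by (auto simp: min_def)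
      hence "U (0 + min (d / 2) (1 / 2)) \<le> 0" using neg by blast
      ultimately show False using U0 by linarith
    qed
    moreover have "V 1 \<ge> 0"
    proof (rule ccontr)
      assume "\<not> V 1 \<ge> 0"
      then obtain d where d: "d > 0" "\<And>h. 0 < h \<Longrightarrow> h < d \<Longrightarrow> U 1 < U (1 - h)"
        using DERIV_neg_dec_left[OF dU[of 1]] by auto
      have "U 1 < U (1 - min (d / 2) (1 / 2))" using d(1) by (intro d(2)) auto
      moreover have "1 - min (d / 2) (1 / 2) \<in> {0<..<1}" using d(1) by (auto simp: min_def)
      hence "U (1 - min (d / 2) (1 / 2)) \<le> 0" using neg by blast
      ultimately show False using U1 by linarith
    qed
    ultimately have "A \<le> P 0" "exp l * P 0 \<le> A" by (auto simp: V_def L1)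
    moreover have "1 * P 0 < exp l * P 0" using l A \<open>A \<le> P 0\<close> by (intro mult_strict_right_mono) auto
    ultimately show False by linarith
  qed
  ultimately have "U x \<ge> 0" using U0 U1 x by (cases "x = 0 \<or> x = 1") auto
  hence "exp (- l * x) * (exp (l * x) * L x) \<le> exp (- l * x) * (x * A + B)"
    unfolding U_def by (intro mult_left_mono) auto
  also have "exp (- l * x) * (exp (l * x) * L x) = (exp (l * x) * exp (- l * x)) * L x"
    by (simp only: mult_ac)
  finally show ?thesis unfolding ee by (simp only: mult_1)
qed

text \<open>The derivative of the error is itself a trigonometric polynomial, so one application of Rolle's
theorem suffices for the zero count. The sign is found at the right end, where the error is 1.\<close>

lemma sawtooth_majorant_interpolant:
  fixes M :: "real \<Rightarrow> real"
  assumes M: "trig_fun N M" and M0: "M 0 = 1 / 2" and MX: "\<And>a. a \<in> X \<Longrightarrow> M a = 1 / 2 - a"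
    and dX: "\<And>a. a \<in> X \<Longrightarrow> deriv M a = - 1" and x: "x \<in> {0<..<1}"
  shows "1 / 2 - x \<le> M x"
proof -
  define U where "U x = M x - 1 / 2 + x" for x
  define T where "T x = deriv M x + 1" for x
  have T: "trig_fun N T" unfolding T_def[abs_def] by (intro trig_fun_add trig_fun_const trig_fun_deriv M)
  have dU: "(U has_real_derivative T x) (at x)" for x
    unfolding U_def[abs_def] T_def by (rule derivative_eq_intros trig_fun_DERIV[OF M] refl)+ simp
  have dT: "(T has_real_derivative deriv T x) (at x)" for x by (rule trig_fun_DERIV[OF T])
  have U0: "U 0 = 0" by (simp add: U_def M0)
  have U1: "U 1 = 1" using trig_fun_periodic[OF M, of 0 1] by (simp add: U_def M0)
  have UX: "U a = 0" "T a = 0" if "a \<in> X" for a using MX[OF that] dX[OF that] by (auto simp: U_def T_def)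
  have T_nz: False if T0: "\<And>x. T x = 0"
  proof -
    have "(U has_real_derivative 0) (at x)" for x using dU[of x] T0 by simp
    hence "U 1 = U 0" using DERIV_isconst_all by blast
    thus False using U0 U1 by simp
  qed
  have zeros: "\<exists>Y. finite Y \<and> card Y = N + k \<and> Y \<inter> Z = {} \<and> Y \<subseteq> {0<..<1} \<and> (\<forall>y\<in>Y. T y = 0)"
    if Z: "finite Z" "card Z = N + k" "Z \<subseteq> {0<..<1}" "\<And>z. z \<in> Z \<Longrightarrow> U z = 0" for Z k
  proof -
    have "card (insert 0 Z) = Suc (N + k)" using Z by (subst card_insert_disjoint) auto
    moreover have "U z = 0" if "z \<in> insert 0 Z" for z using that Z U0 by auto
    ultimately obtain Y where Y: "finite Y" "card Y = N + k" "Y \<inter> insert 0 Z = {}"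
      "Y \<subseteq> {Min (insert 0 Z)<..<Max (insert 0 Z)}" "\<forall>y\<in>Y. T y = 0"
      using rolle_finite_set[of "insert 0 Z" "N + k" U T] dU by blast
    have "Min (insert 0 Z) = 0" using Z by (intro Min_eqI) (auto intro: less_imp_le)
    moreover have "Max (insert 0 Z) < 1" using Z by (subst Max_less_iff) auto
    ultimately have "Y \<subseteq> {0<..<1}" using Y(4) by force
    thus ?thesis using Y by blast
  qed
  have nodes_only: "y \<in> X" if y: "y \<in> {0<..<1}" "U y = 0" for y
  proof (rule ccontr)
    assume y': "y \<notin> X"
    hence "\<exists>Y. finite Y \<and> card Y = N + 1 \<and> Y \<inter> insert y X = {} \<and> Y \<subseteq> {0<..<1} \<and> (\<forall>y\<in>Y. T y = 0)"
      using y finite_X X_subset UX by (intro zeros[of "insert y X" 1]) auto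
    then obtain Y where Y: "finite Y" "card Y = N + 1" "Y \<inter> X = {}" "Y \<subseteq> {0<..<1}" "\<forall>y\<in>Y. T y = 0" by blast
    have "card (X \<union> Y) = N + (N + 1)" using Y finite_X by (subst card_Un_disjoint) auto
    hence c: "2 * N < card (X \<union> Y) + card ({} :: real set)" by simp
    have sub: "X \<union> Y \<subseteq> {0..<1}" using Y(4) X_subset by auto
    have "T x = 0" for x
      by (rule trig_fun_eq_0[OF T _ sub _ _ _ c]) (use Y UX finite_X in auto)
    thus False by (rule T_nz)
  qed
  have dTX: "deriv T a \<noteq> 0" if a: "a \<in> X" for a
  proof
    assume Ta: "deriv T a = 0"
    obtain Y where Y: "finite Y" "card Y = N + 0" "Y \<inter> X = {}" "Y \<subseteq> {0<..<1}" "\<forall>y\<in>Y. T y = 0"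
      using zeros[of X 0] finite_X X_subset UX by auto
    have "card (X \<union> Y) = N + N" using Y finite_X by (subst card_Un_disjoint) auto
    hence c: "2 * N < card (X \<union> Y) + card {a}" by simp
    have sub: "X \<union> Y \<subseteq> {0..<1}" using Y(4) X_subset by auto
    have "T x = 0" for x
      by (rule trig_fun_eq_0[OF T _ sub _ _ _ c]) (use Y UX finite_X Ta a in auto)
    thus False by (rule T_nz)
  qed
  have "(\<forall>x\<in>{0<..<1}. U x \<ge> 0) \<or> (\<forall>x\<in>{0<..<1}. U x \<le> 0)"
    by (rule constant_sign[OF dU dT]) (use nodes_only UX dTX in auto)
  moreover have "\<not> (\<forall>x\<in>{0<..<1}. U x \<le> 0)"
  proof
    assume neg: "\<forall>x\<in>{0<..<1}. U x \<le> 0"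
    have "(U \<longlongrightarrow> U 1) (at_left 1)" using DERIV_isCont[OF dU[of 1]]
      by (simp add: isCont_def filterlim_at_split)
    moreover have "\<forall>\<^sub>F x in at_left 1. U x \<le> 0"
      using neg eventually_at_left_real[of 0 1] by (auto elim: eventually_mono)
    ultimately have "U 1 \<le> 0" by (rule tendsto_upperbound) simp
    thus False using U1 by simp
  qed
  ultimately have "U x \<ge> 0" using x by blast
  thus ?thesis by (simp add: U_def)
qed

end

section \<open>The periodic transform of a weight\<close>

definition coefA :: "real \<Rightarrow> real" where "coefA l = 1 / (1 - exp (- l))"
definition coefB :: "real \<Rightarrow> real" where "coefB l = exp (- l) / (1 - exp (- l))\<^sup>2"

text \<open>The closed form of \<open>periodic_trunc_exp l\<close> on \<open>[0, 1)\<close>, from summing the geometric series and its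
derivative.\<close>

definition periodized :: "real \<Rightarrow> real \<Rightarrow> real" where "periodized l x = exp (- l * x) * (x * coefA l + coefB l)"
definition periodized_deriv :: "real \<Rightarrow> real \<Rightarrow> real" where
  "periodized_deriv l x = exp (- l * x) * (coefA l - l * (x * coefA l + coefB l))"

lemma periodic_trunc_exp_eq:
  assumes l: "l > 0" and x: "x \<in> {0..<1}"
  shows "periodic_trunc_exp l x = periodized l x"
proof -
  define q where "q = exp (- l)"
  have q: "0 < q" "q < 1" using l by (auto simp: q_def)
  have e: "trunc_exp l (x + of_int (int n)) = exp (- l * x) * ((x - 1) * q ^ n + real (Suc n) * q ^ n)" for n
  proof -
    have "exp (- l * (x + real n)) = exp (- l * x) * q ^ n"
      by (simp add: q_def ring_distribs exp_diff exp_minus exp_of_nat_mult[symmetric] mult_ac field_simps)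
    moreover have "x = 0 \<and> n = 0" if "\<not> x + real n > 0" using x that by auto
    ultimately show ?thesis by (auto simp: trunc_exp_def algebra_simps)
  qed
  have "(\<lambda>n. exp (- l * x) * ((x - 1) * q ^ n + real (Suc n) * q ^ n)) sums
      (exp (- l * x) * ((x - 1) * (1 / (1 - q)) + 1 / (1 - q)\<^sup>2))"
    using q by (intro sums_mult sums_add geometric_sums geometric_deriv_sums) auto
  also have "(x - 1) * (1 / (1 - q)) + 1 / (1 - q)\<^sup>2 = x * coefA l + coefB l"
    using q by (simp add: coefA_def coefB_def flip: q_def) (simp add: divide_simps power2_eq_square, simp add: algebra_simps)
  finally have "(\<lambda>n. trunc_exp l (x + of_int (int n))) sums periodized l x" unfolding e periodized_def .
  moreover have nn: "trunc_exp l y \<ge> 0" for y by (simp add: trunc_exp_def)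
  ultimately have "((\<lambda>n. trunc_exp l (x + of_int (int n))) has_sum periodized l x) UNIV"
    by (intro sums_nonneg_imp_has_sum) auto
  hence "((\<lambda>n. trunc_exp l (x + of_int n)) has_sum periodized l x) (range int)"
    by (subst has_sum_reindex) (auto simp: o_def)
  moreover have "trunc_exp l (x + of_int n) = 0" if "n \<notin> range int" for n
  proof -
    have "n < 0" using that by (metis int_nat_eq not_le rangeI)
    hence "real_of_int n \<le> -1" by linarith
    thus ?thesis using x by (simp add: trunc_exp_def)
  qed
  hence "((\<lambda>n. trunc_exp l (x + of_int n)) has_sum periodized l x) UNIV \<longleftrightarrow>
      ((\<lambda>n. trunc_exp l (x + of_int n)) has_sum periodized l x) (range int)"
    by (intro has_sum_cong_neutral) auto
  ultimately have "((\<lambda>n. trunc_exp l (x + of_int n)) has_sum periodized l x) UNIV" by blast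
  thus ?thesis unfolding periodic_trunc_exp_def by (rule infsumI)
qed

lemma periodic_trunc_exp_add_int: "periodic_trunc_exp l (x + of_int k) = periodic_trunc_exp l x"
  unfolding periodic_trunc_exp_def
  by (rule infsum_reindex_bij_witness[of _ "\<lambda>n. n - k" "\<lambda>n. n + k"]) (auto simp: algebra_simps)

text \<open>Used with limits of \<open>l\<^sup>2 * f l\<close> to compare \<open>f l * m l\<close> with the integrable function \<open>m l / l\<^sup>2\<close>.\<close>

lemma bounded_by_end_limits:
  fixes f :: "real \<Rightarrow> real"
  assumes c: "continuous_on {0<..} f" and a: "(f \<longlongrightarrow> a) (at_right 0)" and b: "(f \<longlongrightarrow> b) at_top"
  shows "\<exists>C. \<forall>x>0. \<bar>f x\<bar> \<le> C"
proof -
  have "\<forall>\<^sub>F x in at_right 0. \<bar>f x\<bar> < \<bar>a\<bar> + 1"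
    by (rule order_tendstoD[OF tendsto_rabs[OF a]]) simp
  then obtain d where d: "d > 0" "\<And>x. 0 < x \<Longrightarrow> x < d \<Longrightarrow> \<bar>f x\<bar> < \<bar>a\<bar> + 1"
    by (auto simp: eventually_at_right_field)
  have "\<forall>\<^sub>F x in at_top. \<bar>f x\<bar> < \<bar>b\<bar> + 1"
    by (rule order_tendstoD[OF tendsto_rabs[OF b]]) simp
  then obtain T where T: "\<And>x. x \<ge> T \<Longrightarrow> \<bar>f x\<bar> < \<bar>b\<bar> + 1" by (auto simp: eventually_at_top_linorder)
  have "compact (f ` {d..T})"
    by (intro compact_continuous_image continuous_on_subset[OF c] compact_Icc) (use d in auto)
  hence "bounded (f ` {d..T})" by (rule compact_imp_bounded)
  then obtain C where C: "\<And>x. x \<in> {d..T} \<Longrightarrow> \<bar>f x\<bar> \<le> C" unfolding bounded_iff by force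
  have "\<bar>f x\<bar> \<le> max C (max (\<bar>a\<bar> + 1) (\<bar>b\<bar> + 1))" if "x > 0" for x
  proof -
    consider "x < d" | "x \<ge> T" | "x \<in> {d..T}" by force
    thus ?thesis
    proof cases
      case 1 thus ?thesis using d(2)[OF that] by (auto simp: le_max_iff_disj intro: less_imp_le)
    next
      case 2 thus ?thesis using T[of x] by (auto simp: le_max_iff_disj intro: less_imp_le)
    next
      case 3 thus ?thesis using C by (auto simp: le_max_iff_disj)
    qed
  qed
  thus ?thesis by blast
qed

locale weight =
  fixes m :: "real \<Rightarrow> real"
  assumes m_nonneg: "0 \<le> m l" and m_le_1: "m l \<le> 1"
    and integrable_m: "set_integrable lborel {0<..} (\<lambda>l. m l / l ^ 2)"
begin

text \<open>Integration against \<open>m l\<close> over the positive half-line, as integration with respect to a measure.\<close>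

definition weight_measure :: "real measure" where "weight_measure = density lborel (\<lambda>l. ennreal (indicator {0<..} l * m l))"

lemma measurable_m: "(\<lambda>l. indicator {0<..} l * m l) \<in> borel_measurable lborel"
proof -
  have "(\<lambda>l. indicator {0<..} l *\<^sub>R (m l / l ^ 2)) \<in> borel_measurable lborel"
    using integrable_m unfolding set_integrable_def by (rule borel_measurable_integrable)
  hence "(\<lambda>l. (indicator {0<..} l *\<^sub>R (m l / l ^ 2)) * l ^ 2) \<in> borel_measurable lborel"
    by (intro borel_measurable_times) auto
  moreover have "(indicator {0<..} l *\<^sub>R (m l / l ^ 2)) * l ^ 2 = indicator {0<..} l * m l" for l
    by (auto simp: indicator_def)
  ultimately show ?thesis by simp
qed

lemma sets_weight_measure [measurable_cong]: "sets weight_measure = sets borel" by (simp add: weight_measure_def)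

lemma AE_weight_measure: "AE l in weight_measure. l > 0"
  unfolding weight_measure_def using measurable_m
  by (subst AE_density) (auto simp: indicator_def split: if_splits)

lemma integral_weight_measure: assumes "f \<in> borel_measurable borel"
  shows "(LINT l|weight_measure. f l) = (LINT l:{0<..}|lborel. f l * m l)"
  unfolding weight_measure_def set_lebesgue_integral_def using measurable_m assms m_nonneg
  by (subst integral_density) (auto simp: mult_ac)

lemma integrable_weight_measure_iff: assumes "f \<in> borel_measurable borel"
  shows "integrable weight_measure f \<longleftrightarrow> set_integrable lborel {0<..} (\<lambda>l. f l * m l)"
  unfolding weight_measure_def set_integrable_def using measurable_m assms m_nonneg
  by (subst integrable_density) (auto simp: mult_ac)

text \<open>The only singularity that matters is of order \<open>1 / l\<^sup>2\<close> at 0, which the weight tolerates by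
assumption.\<close>

lemma integrable_weight_measure:
  assumes f: "f \<in> borel_measurable borel" and c: "continuous_on {0<..} f"
    and a: "((\<lambda>l. l\<^sup>2 * f l) \<longlongrightarrow> a) (at_right 0)" and b: "((\<lambda>l. l\<^sup>2 * f l) \<longlongrightarrow> b) at_top"
  shows "integrable weight_measure f"
proof -
  have "continuous_on {0<..} (\<lambda>l. l\<^sup>2 * f l)" by (intro continuous_intros c)
  then obtain C where C: "\<And>l. l > 0 \<Longrightarrow> \<bar>l\<^sup>2 * f l\<bar> \<le> C"
    using bounded_by_end_limits[OF _ a b] by blast
  have "integrable lborel (\<lambda>l. C * (indicator {0<..} l *\<^sub>R (m l / l\<^sup>2)))"
    using integrable_m unfolding set_integrable_def by (rule integrable_mult_right)
  hence "integrable lborel (\<lambda>l. f l * (indicator {0<..} l * m l))"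
  proof (rule Bochner_Integration.integrable_bound)
    show "(\<lambda>l. f l * (indicator {0<..} l * m l)) \<in> borel_measurable lborel"
      by (intro borel_measurable_times measurable_m) (use f in simp)
    have "\<bar>f l * (indicator {0<..} l * m l)\<bar> \<le> C * (indicator {0<..} l *\<^sub>R (m l / l\<^sup>2))" for l
    proof (cases "l > 0")
      case True
      have "\<bar>f l * m l\<bar> = \<bar>l\<^sup>2 * f l\<bar> * (m l / l\<^sup>2)" using True m_nonneg[of l] by (simp add: abs_mult)
      also have "\<dots> \<le> C * (m l / l\<^sup>2)" using C[OF True] m_nonneg[of l] by (intro mult_right_mono) auto
      finally show ?thesis using True by simp
    qed simp
    thus "AE l in lborel. norm (f l * (indicator {0<..} l * m l)) \<le> norm (C * (indicator {0<..} l *\<^sub>R (m l / l\<^sup>2)))"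
      unfolding real_norm_def by (intro AE_I2 order.trans[OF _ abs_ge_self])
  qed
  thus ?thesis using f by (subst integrable_weight_measure_iff) (auto simp: set_integrable_def mult_ac)
qed

lemma measurable_coef [measurable]: "coefA \<in> borel_measurable borel" "coefB \<in> borel_measurable borel"
  unfolding coefA_def[abs_def] coefB_def[abs_def] by measurable

lemma measurable_periodized [measurable]: "(\<lambda>l. periodized l x) \<in> borel_measurable borel" "(\<lambda>l. periodized_deriv l x) \<in> borel_measurable borel"
  unfolding periodized_def periodized_deriv_def by measurable

lemma integrable_periodized: assumes "x \<ge> 0" shows "integrable weight_measure (\<lambda>l. periodized l x)"
proof (rule integrable_weight_measure)
  show "continuous_on {0<..} (\<lambda>l. periodized l x)" unfolding periodized_def coefA_def coefB_def by (auto intro!: continuous_intros)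
  show "((\<lambda>l. l\<^sup>2 * periodized l x) \<longlongrightarrow> 1) (at_right 0)"
    unfolding periodized_def coefA_def coefB_def by real_asymp
  show "((\<lambda>l. l\<^sup>2 * periodized l x) \<longlongrightarrow> 0) at_top"
  proof (cases "x = 0")
    case True
    thus ?thesis unfolding periodized_def coefA_def coefB_def by simp real_asymp
  next
    case False
    hence "x > 0" using assms by simp
    thus ?thesis unfolding periodized_def coefA_def coefB_def by real_asymp
  qed
qed measurable

lemma integrable_periodized_deriv: assumes "x > 0" shows "integrable weight_measure (\<lambda>l. periodized_deriv l x)"
proof (rule integrable_weight_measure)
  show "continuous_on {0<..} (\<lambda>l. periodized_deriv l x)" unfolding periodized_deriv_def coefA_def coefB_def by (auto intro!: continuous_intros)
  show "((\<lambda>l. l\<^sup>2 * periodized_deriv l x) \<longlongrightarrow> 0) (at_right 0)" "((\<lambda>l. l\<^sup>2 * periodized_deriv l x) \<longlongrightarrow> 0) at_top"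
    using assms unfolding periodized_deriv_def coefA_def coefB_def by real_asymp+
qed measurable

definition F :: "real \<Rightarrow> real" where "F x = (LINT l:{0<..}|lborel. periodic_trunc_exp l x * m l)"

lemma F_eq: assumes "x \<in> {0..<1}" shows "F x = (LINT l|weight_measure. periodized l x)"
  unfolding F_def by (subst integral_weight_measure) (auto intro!: set_lebesgue_integral_cong simp: periodic_trunc_exp_eq[OF _ assms])

lemma F_add_int: "F (x + of_int k) = F x"
  by (simp add: F_def periodic_trunc_exp_add_int)

end

section \<open>Bounds for the transform by interpolants\<close>

text \<open>Up to sign, antiderivatives in \<open>l\<close> of \<open>periodized l x\<close>, of its value at 0 and of its slope. The value at 0
needs its own antiderivative: the sum of \<open>exp (- l * (x + n))\<close> over \<open>n \<ge> 0\<close> jumps at \<open>x = 0\<close>, and there it is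
the left limit, the sum without the term \<open>n = 0\<close>, that belongs to the continuous function
\<open>periodized l\<close>.\<close>

definition primitive :: "real \<Rightarrow> real \<Rightarrow> real" where "primitive l x = exp (- l * x) * coefA l"
definition primitive_0 :: "real \<Rightarrow> real" where "primitive_0 l = coefA l - 1"
definition primitive_deriv :: "real \<Rightarrow> real \<Rightarrow> real" where "primitive_deriv l x = - l * (exp (- l * x) * coefA l)"

lemma DERIV_coefA: assumes "l > 0" shows "(coefA has_real_derivative - coefB l) (at l)"
proof -
  have "1 - exp (- l) \<noteq> 0" using assms by simp
  thus ?thesis unfolding coefA_def[abs_def] coefB_def
    by (auto intro!: derivative_eq_intros simp: power2_eq_square)
qed

lemma DERIV_primitive: "l > 0 \<Longrightarrow> ((\<lambda>l. primitive l x) has_real_derivative - periodized l x) (at l)"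
  unfolding primitive_def periodized_def by (auto intro!: derivative_eq_intros DERIV_coefA simp: algebra_simps)

lemma DERIV_primitive_0: "l > 0 \<Longrightarrow> (primitive_0 has_real_derivative - periodized l 0) (at l)"
  unfolding primitive_0_def[abs_def] periodized_def by (auto intro!: derivative_eq_intros DERIV_coefA)

lemma DERIV_primitive_deriv: "l > 0 \<Longrightarrow> ((\<lambda>l. primitive_deriv l x) has_real_derivative - periodized_deriv l x) (at l)"
  unfolding primitive_deriv_def periodized_deriv_def by (auto intro!: derivative_eq_intros DERIV_coefA simp: algebra_simps)

context interpolation_nodes
begin

lemma tendsto_interpolant:
  assumes "(v0 \<longlongrightarrow> w0) G" "\<And>a. a \<in> X \<Longrightarrow> ((\<lambda>l. v l a) \<longlongrightarrow> w a) G" "\<And>a. a \<in> X \<Longrightarrow> ((\<lambda>l. d l a) \<longlongrightarrow> d' a) G"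
  shows "((\<lambda>l. interpolant (v0 l) (v l) (d l) x) \<longlongrightarrow> interpolant w0 w d' x) G"
  unfolding interpolant_def by (intro tendsto_intros assms)

definition gap :: "real \<Rightarrow> real \<Rightarrow> real" where
  "gap l x = periodized l x - interpolant (periodized l 0) (periodized l) (periodized_deriv l) x"

lemma gap_nonneg: assumes "l > 0" "x \<in> {0..1}" shows "gap l x \<ge> 0"
proof -
  have "interpolant (periodized l 0) (periodized l) (periodized_deriv l) x \<le> exp (- l * x) * (x * (1 / (1 - exp (- l))) + exp (- l) / (1 - exp (- l))\<^sup>2)"
    by (rule minorant_interpolant[OF assms(1) trig_fun_interpolant])
       (use assms in \<open>auto simp: interpolant_0 interpolant_node deriv_interpolant_node periodized_def periodized_deriv_def coefA_def coefB_def\<close>)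
  thus ?thesis unfolding gap_def periodized_def coefA_def coefB_def by simp
qed

text \<open>The interpolation operator commutes with differentiation in \<open>l\<close>, so an antiderivative of the error
\<open>gap l x\<close> is minus the interpolation error of \<open>primitive l\<close>. It tends to 0 as \<open>l \<rightarrow> \<infinity>\<close>. As \<open>l \<rightarrow> 0\<close>,
\<open>primitive l x - 1 / l\<close> tends to the sawtooth \<open>1 / 2 - x\<close> and the value at 0 minus \<open>1 / l\<close> to \<open>- 1 / 2\<close>.
Raising the value of the interpolant at 0 from \<open>- 1 / 2\<close> to \<open>1 / 2\<close> adds \<open>bump\<close> to it and produces the
majorant of the sawtooth, whence the bound.\<close>

lemma integral_gap:
  assumes x: "x \<in> {0<..<1}"
  shows "set_integrable lborel {0<..} (\<lambda>l. gap l x)" "(LINT l:{0<..}|lborel. gap l x) \<le> bump x"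
proof -
  define s where "s = (1 / 2 - x) - interpolant (- 1 / 2) (\<lambda>a. 1 / 2 - a) (\<lambda>_. - 1) x"
  define r where "r l = interpolant (primitive_0 l) (primitive l) (primitive_deriv l) x - primitive l x" for l
  have X: "a > 0" if "a \<in> X" for a using X_subset that by auto
  have x0: "x > 0" using x by simp
  have r_eq: "r = (\<lambda>l. interpolant (primitive_0 l - 1 / l) (\<lambda>a. primitive l a - 1 / l) (\<lambda>a. primitive_deriv l a - 0) x - (primitive l x - 1 / l))"
    unfolding r_def interpolant_diff interpolant_const by simp
  have r0: "(r \<longlongrightarrow> - s) (at_right 0)"
    unfolding r_eq s_def minus_diff_eq
  proof (rule tendsto_diff[OF tendsto_interpolant])
    show "((\<lambda>l. primitive_0 l - 1 / l) \<longlongrightarrow> - 1 / 2) (at_right 0)" unfolding primitive_0_def coefA_def by real_asymp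
    show "((\<lambda>l. primitive l x - 1 / l) \<longlongrightarrow> 1 / 2 - x) (at_right 0)" using x0 unfolding primitive_def coefA_def by real_asymp
    show "((\<lambda>l. primitive l a - 1 / l) \<longlongrightarrow> 1 / 2 - a) (at_right 0)" if "a \<in> X" for a using X[OF that] unfolding primitive_def coefA_def by real_asymp
    show "((\<lambda>l. primitive_deriv l a - 0) \<longlongrightarrow> - 1) (at_right 0)" if "a \<in> X" for a using X[OF that] unfolding primitive_deriv_def coefA_def by real_asymp
  qed
  have "(r \<longlongrightarrow> interpolant 0 (\<lambda>_. 0) (\<lambda>_. 0) x - 0) at_top"
    unfolding r_def
  proof (rule tendsto_diff[OF tendsto_interpolant])
    show "(primitive_0 \<longlongrightarrow> 0) at_top" unfolding primitive_0_def[abs_def] coefA_def by real_asymp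
    show "((\<lambda>l. primitive l x) \<longlongrightarrow> 0) at_top" using x0 unfolding primitive_def coefA_def by real_asymp
    show "((\<lambda>l. primitive l a) \<longlongrightarrow> 0) at_top" if "a \<in> X" for a using X[OF that] unfolding primitive_def coefA_def by real_asymp
    show "((\<lambda>l. primitive_deriv l a) \<longlongrightarrow> 0) at_top" if "a \<in> X" for a using X[OF that] unfolding primitive_deriv_def coefA_def by real_asymp
  qed
  hence r1: "(r \<longlongrightarrow> 0) at_top" by (simp add: interpolant_const)
  have dr: "(r has_real_derivative gap l x) (at l)" if "l > 0" for l
  proof -
    have "(r has_real_derivative (interpolant (- periodized l 0) (\<lambda>a. - periodized l a) (\<lambda>a. - periodized_deriv l a) x - (- periodized l x))) (at l)"
      unfolding r_def[abs_def] interpolant_def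
      by (intro DERIV_diff DERIV_add DERIV_sum DERIV_cmult_right DERIV_primitive_0 DERIV_primitive DERIV_primitive_deriv that)
    moreover have "interpolant (- periodized l 0) (\<lambda>a. - periodized l a) (\<lambda>a. - periodized_deriv l a) x = - interpolant (periodized l 0) (periodized l) (periodized_deriv l) x"
      using interpolant_diff[of 0 "periodized l 0" "\<lambda>_. 0" "periodized l" "\<lambda>_. 0" "periodized_deriv l" x] by (simp add: interpolant_const)
    ultimately show ?thesis by (simp add: gap_def)
  qed
  have cont: "isCont (\<lambda>l. gap l x) l" if "l > 0" for l
    unfolding gap_def interpolant_def periodized_def periodized_deriv_def coefA_def coefB_def
    by (intro continuous_intros) (use that in auto)
  have r0': "((r \<circ> real_of_ereal) \<longlongrightarrow> - s) (at_right (ereal 0))"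
    using r0 by (simp add: ereal_tendsto_simps)
  have r1': "((r \<circ> real_of_ereal) \<longlongrightarrow> 0) (at_left \<infinity>)"
    using r1 by (simp add: ereal_tendsto_simps)
  have ae: "AE l in lborel. ereal 0 < ereal l \<longrightarrow> ereal l < \<infinity> \<longrightarrow> 0 \<le> gap l x"
    using gap_nonneg[of _ x] x by auto
  note ftc = interval_integral_FTC_nonneg[of "ereal 0" \<infinity> r "\<lambda>l. gap l x", OF _ _ _ ae r0' r1']
  show "set_integrable lborel {0<..} (\<lambda>l. gap l x)"
    using ftc(1) dr cont by simp
  have "(LBINT l=ereal 0..\<infinity>. gap l x) = s"
    using ftc(2) dr cont by simp
  hence "(LINT l:{0<..}|lborel. gap l x) = s"
    by (simp add: interval_lebesgue_integral_def)
  also have "s \<le> bump x"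
  proof -
    have "1 / 2 - x \<le> interpolant (1 / 2) (\<lambda>a. 1 / 2 - a) (\<lambda>_. - 1) x"
      by (rule sawtooth_majorant_interpolant[OF trig_fun_interpolant])
         (use x in \<open>auto simp: interpolant_0 interpolant_node deriv_interpolant_node\<close>)
    also have "\<dots> = interpolant (- 1 / 2) (\<lambda>a. 1 / 2 - a) (\<lambda>_. - 1) x + bump x"
      by (simp add: interpolant_def algebra_simps)
    finally show ?thesis by (simp add: s_def)
  qed
  finally show "(LINT l:{0<..}|lborel. gap l x) \<le> bump x" .
qed

end

locale weight_interpolation = weight m + interpolation_nodes X for m X
begin

text \<open>The slopes are the integrals of the slopes of \<open>periodized l\<close>. That every one-sided approximation touching
\<open>F\<close> has these slopes will follow from the two-sided bounds below, in place of a
differentiation of \<open>F\<close> under the integral sign.\<close>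

definition best_minorant :: "real \<Rightarrow> real" where "best_minorant = interpolant (F 0) F (\<lambda>a. LINT l|weight_measure. periodized_deriv l a)"

lemma F_diff_best_minorant: assumes x: "x \<in> {0..<1}"
  shows "integrable weight_measure (\<lambda>l. gap l x)" "F x - best_minorant x = (LINT l|weight_measure. gap l x)"
proof -
  have X: "a > 0" "a \<in> {0..<1}" if "a \<in> X" for a using X_subset that by auto
  have i: "integrable weight_measure (\<lambda>l. periodized l x)" "integrable weight_measure (\<lambda>l. periodized l 0)" using x by (auto intro: integrable_periodized)
  have ia: "integrable weight_measure (\<lambda>l. periodized l a)" "integrable weight_measure (\<lambda>l. periodized_deriv l a)" if "a \<in> X" for a
    using X[OF that] by (auto intro: integrable_periodized integrable_periodized_deriv)
  have s: "integrable weight_measure (\<lambda>l. \<Sum>a\<in>X. periodized l a * value_fun a x + periodized_deriv l a * slope_fun a x)"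
    by (intro Bochner_Integration.integrable_sum Bochner_Integration.integrable_add integrable_mult_left ia)
  have p: "integrable weight_measure (\<lambda>l. periodized l 0 * bump x)" by (intro integrable_mult_left i)
  show "integrable weight_measure (\<lambda>l. gap l x)" unfolding gap_def interpolant_def
    by (intro Bochner_Integration.integrable_diff Bochner_Integration.integrable_add i s p)
  have "(LINT l|weight_measure. gap l x) = (LINT l|weight_measure. periodized l x) - ((LINT l|weight_measure. periodized l 0 * bump x) + (LINT l|weight_measure. (\<Sum>a\<in>X. periodized l a * value_fun a x + periodized_deriv l a * slope_fun a x)))"
    unfolding gap_def interpolant_def using i s p by simp
  also have "(LINT l|weight_measure. (\<Sum>a\<in>X. periodized l a * value_fun a x + periodized_deriv l a * slope_fun a x)) =
     (\<Sum>a\<in>X. (LINT l|weight_measure. periodized l a * value_fun a x + periodized_deriv l a * slope_fun a x))"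
    by (intro Bochner_Integration.integral_sum Bochner_Integration.integrable_add integrable_mult_left ia)
  also have "\<dots> = (\<Sum>a\<in>X. F a * value_fun a x + (LINT l|weight_measure. periodized_deriv l a) * slope_fun a x)"
  proof (intro sum.cong refl)
    fix a assume a: "a \<in> X"
    have "(LINT l|weight_measure. periodized l a * value_fun a x + periodized_deriv l a * slope_fun a x) = (LINT l|weight_measure. periodized l a * value_fun a x) + (LINT l|weight_measure. periodized_deriv l a * slope_fun a x)"
      by (intro Bochner_Integration.integral_add integrable_mult_left ia a)
    thus "(LINT l|weight_measure. periodized l a * value_fun a x + periodized_deriv l a * slope_fun a x) = F a * value_fun a x + (LINT l|weight_measure. periodized_deriv l a) * slope_fun a x"
      by (simp add: F_eq[OF X(2)[OF a]])
  qed
  finally show "F x - best_minorant x = (LINT l|weight_measure. gap l x)" using x by (simp add: best_minorant_def interpolant_def F_eq)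
qed

lemma best_minorant_le_F: assumes x: "x \<in> {0..<1}" shows "best_minorant x \<le> F x"
proof -
  have "(LINT l|weight_measure. gap l x) \<ge> 0"
    using AE_weight_measure gap_nonneg[of _ x] x by (intro integral_nonneg_AE) (auto elim: eventually_mono)
  thus ?thesis using F_diff_best_minorant(2)[OF x] by simp
qed

lemma measurable_gap [measurable]: "(\<lambda>l. gap l x) \<in> borel_measurable borel"
  unfolding gap_def interpolant_def by measurable

text \<open>Here \<open>m \<le> 1\<close> and the nonnegativity of the error allow \<open>m\<close> to be replaced by 1.\<close>

lemma F_le_best_minorant_bump: assumes x: "x \<in> {0<..<1}" shows "F x \<le> best_minorant x + bump x"
proof -
  have x': "x \<in> {0..<1}" "x \<in> {0..1}" using x by auto
  have "(LINT l|weight_measure. gap l x) = (LINT l:{0<..}|lborel. gap l x * m l)" by (rule integral_weight_measure) measurable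
  also have "\<dots> \<le> (LINT l:{0<..}|lborel. gap l x)"
  proof (rule set_integral_mono)
    show "set_integrable lborel {0<..} (\<lambda>l. gap l x * m l)"
      using F_diff_best_minorant(1)[OF x'(1)] integrable_weight_measure_iff[of "\<lambda>l. gap l x"] by simp
    show "set_integrable lborel {0<..} (\<lambda>l. gap l x)" by (rule integral_gap[OF x])
    fix l :: real assume "l \<in> {0<..}"
    hence "gap l x \<ge> 0" using gap_nonneg[of l x] x' by simp
    thus "gap l x * m l \<le> gap l x" using m_le_1[of l] by (rule mult_left_le[rotated])
  qed
  also have "\<dots> \<le> bump x" by (rule integral_gap[OF x])
  finally show ?thesis using F_diff_best_minorant(2)[OF x'(1)] by simp
qed

end

section \<open>The jump at zero\<close>

lemma integrable_indicator_Ioc: "integrable lborel (indicator {0<..y::real} :: real \<Rightarrow> real)"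
  by (rule integrable_real_indicator) (cases "0 \<le> y"; simp)+

lemma integral_exp_tail:
  fixes x Y :: real
  assumes x: "x > 0" and Y: "Y \<ge> 0"
  shows "set_integrable lborel {Y<..} (\<lambda>l. x * exp (- l * x))" "(LINT l:{Y<..}|lborel. x * exp (- l * x)) = exp (- Y * x)"
proof -
  let ?r = "\<lambda>l::real. - exp (- l * x)"
  have dr: "(?r has_real_derivative x * exp (- l * x)) (at l)" for l
    by (auto intro!: derivative_eq_intros)
  have "(?r \<longlongrightarrow> - exp (- Y * x)) (at_right Y)" by (intro tendsto_intros)
  hence r0: "((?r \<circ> real_of_ereal) \<longlongrightarrow> - exp (- Y * x)) (at_right (ereal Y))"
    by (simp add: ereal_tendsto_simps)
  have "(?r \<longlongrightarrow> 0) at_top" using x by real_asymp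
  hence r1: "((?r \<circ> real_of_ereal) \<longlongrightarrow> 0) (at_left \<infinity>)"
    by (simp add: ereal_tendsto_simps)
  have ae: "AE l in lborel. ereal Y < ereal l \<longrightarrow> ereal l < \<infinity> \<longrightarrow> 0 \<le> x * exp (- l * x)" using x by simp
  have cont: "isCont (\<lambda>l. x * exp (- l * x)) l" for l by (intro continuous_intros)
  note ftc = interval_integral_FTC_nonneg[of "ereal Y" \<infinity> ?r "\<lambda>l. x * exp (- l * x)", OF _ _ _ ae r0 r1]
  show "set_integrable lborel {Y<..} (\<lambda>l. x * exp (- l * x))" using ftc(1) dr cont by simp
  have "(LBINT l=ereal Y..\<infinity>. x * exp (- l * x)) = exp (- Y * x)" using ftc(2) dr cont by simp
  thus "(LINT l:{Y<..}|lborel. x * exp (- l * x)) = exp (- Y * x)"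
    by (simp add: interval_lebesgue_integral_def)
qed

context weight
begin

lemma set_integrable_m: "set_integrable lborel {0<..y} m"
  unfolding set_integrable_def
proof (rule Bochner_Integration.integrable_bound)
  show "integrable lborel (\<lambda>l. indicator {0<..y} l :: real)" by (rule integrable_indicator_Ioc)
  have "(\<lambda>l. indicator {..y} l * (indicator {0<..} l * m l)) \<in> borel_measurable lborel"
    by (intro borel_measurable_times measurable_m) simp
  moreover have "indicator {..y} l * (indicator {0<..} l * m l) = indicator {0<..y} l *\<^sub>R m l" for l
    by (auto simp: indicator_def)
  ultimately show "(\<lambda>l. indicator {0<..y} l *\<^sub>R m l) \<in> borel_measurable lborel" by simp
  show "AE l in lborel. norm (indicator {0<..y} l *\<^sub>R m l) \<le> norm (indicator {0<..y} l :: real)"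
    using m_nonneg m_le_1 by (auto simp: indicator_def)
qed

text \<open>An average that tends to 1 is eventually nonzero, so the integrals over \<open>{..y}\<close> exist. The contribution
of the negative half-line is then a constant, which disappears after division by \<open>y\<close>.\<close>

lemma average_on_positive_half_line:
  assumes "((\<lambda>y. (1 / y) * (LINT l:{..y}|lborel. m l)) \<longlongrightarrow> 1) at_top"
  shows "((\<lambda>y. (1 / y) * (LINT l:{0<..y}|lborel. m l)) \<longlongrightarrow> 1) at_top"
proof -
  have "\<forall>\<^sub>F y in at_top. (1 / y) * (LINT l:{..y}|lborel. m l) > 0"
    using order_tendstoD(1)[OF assms, of 0] by simp
  hence "\<forall>\<^sub>F y in at_top. 0 < y \<and> (1 / y) * (LINT l:{..y}|lborel. m l) > 0"
    using eventually_gt_at_top[of 0] by eventually_elim simp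
  then obtain y0 where y0: "y0 > 0" "(1 / y0) * (LINT l:{..y0}|lborel. m l) > 0"
    by (metis (mono_tags, lifting) eventually_happens trivial_limit_at_top_linorder)
  have "set_integrable lborel {..y0} m"
  proof (rule ccontr)
    assume "\<not> set_integrable lborel {..y0} m"
    hence "(LINT l:{..y0}|lborel. m l) = 0"
      unfolding set_integrable_def set_lebesgue_integral_def by (rule not_integrable_integral_eq)
    thus False using y0 by simp
  qed
  hence neg: "set_integrable lborel {..0} m" by (rule set_integrable_subset) (use y0 in auto)
  define c where "c = (LINT l:{..0}|lborel. m l)"
  have "(1 / y) * (LINT l:{0<..y}|lborel. m l) = (1 / y) * (LINT l:{..y}|lborel. m l) - c / y" if "y > 0" for y
  proof -
    have "{..y} = {..0} \<union> {0<..y}" using that by auto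
    hence "(LINT l:{..y}|lborel. m l) = c + (LINT l:{0<..y}|lborel. m l)"
      unfolding c_def by (simp only:) (rule set_integral_Un[OF _ neg set_integrable_m], auto)
    thus ?thesis by (simp add: add_divide_distrib)
  qed
  hence "\<forall>\<^sub>F y in at_top. (1 / y) * (LINT l:{..y}|lborel. m l) - c / y = (1 / y) * (LINT l:{0<..y}|lborel. m l)"
    by (intro eventually_mono[OF eventually_gt_at_top[of 0]]) simp
  moreover have "((\<lambda>y. (1 / y) * (LINT l:{..y}|lborel. m l) - c / y) \<longlongrightarrow> 1 - 0) at_top"
    by (intro tendsto_diff assms) real_asymp
  ultimately have "((\<lambda>y. (1 / y) * (LINT l:{0<..y}|lborel. m l)) \<longlongrightarrow> 1 - 0) at_top"
    by (rule Lim_transform_eventually[rotated])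
  thus ?thesis by (simp only: diff_zero)
qed

lemma integrable_exp: assumes "x > 0" shows "integrable weight_measure (\<lambda>l. x * exp (- l * x))"
proof (rule integrable_weight_measure)
  show "continuous_on {0<..} (\<lambda>l. x * exp (- l * x))" by (auto intro!: continuous_intros)
  show "((\<lambda>l. l\<^sup>2 * (x * exp (- l * x))) \<longlongrightarrow> 0) (at_right 0)" by real_asymp
  show "((\<lambda>l. l\<^sup>2 * (x * exp (- l * x))) \<longlongrightarrow> 0) at_top" using assms by real_asymp
qed measurable

text \<open>The weight \<open>m\<close> is compared with 1. Up to \<open>T / x\<close> the factor \<open>exp (- l * x)\<close> is bounded by 1 and the loss is
measured by the average of \<open>1 - m\<close>; beyond \<open>T / x\<close> the loss is at most the tail \<open>exp (- T)\<close>.\<close>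

lemma exp_integral_bounds:
  assumes x: "x > 0" and T: "T > 0"
  shows "(LINT l|weight_measure. x * exp (- l * x)) \<le> 1"
    and "(LINT l|weight_measure. x * exp (- l * x)) \<ge> 1 - (T * (1 - (1 / (T / x)) * (LINT l:{0<..T / x}|lborel. m l)) + exp (- T))"
proof -
  define Y where "Y = T / x"
  have Y: "Y > 0" using x T by (simp add: Y_def)
  let ?f = "\<lambda>l. x * exp (- l * x)"
  have int: "(LINT l|weight_measure. ?f l) = (LINT l:{0<..}|lborel. ?f l * m l)" by (rule integral_weight_measure) measurable
  have i1: "set_integrable lborel {0<..} ?f" "(LINT l:{0<..}|lborel. ?f l) = 1"
    using integral_exp_tail[OF x, of 0] by simp_all
  have i2: "set_integrable lborel {0<..} (\<lambda>l. ?f l * m l)"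
    using integrable_exp[OF x] by (subst integrable_weight_measure_iff[symmetric]) auto
  have "(LINT l:{0<..}|lborel. ?f l * m l) \<le> (LINT l:{0<..}|lborel. ?f l)"
  proof (rule set_integral_mono[OF i2 i1(1)])
    fix l :: real
    show "?f l * m l \<le> ?f l" using m_le_1[of l] x by (intro mult_left_le) auto
  qed
  thus "(LINT l|weight_measure. ?f l) \<le> 1" by (simp only: int i1(2))
  have i3: "set_integrable lborel {Y<..} ?f" "(LINT l:{Y<..}|lborel. ?f l) = exp (- T)"
    using integral_exp_tail[OF x, of Y] Y x by (simp_all add: Y_def)
  have i4: "set_integrable lborel {0<..Y} (\<lambda>l. x * (1 - m l))"
  proof -
    have "set_integrable lborel {0<..Y} (\<lambda>l. 1 - m l)"
      by (intro set_integral_diff set_integrable_m) (simp add: set_integrable_def integrable_indicator_Ioc)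
    thus ?thesis by (rule set_integrable_mult_right)
  qed
  have "(LINT l:{0<..}|lborel. ?f l) - (LINT l:{0<..}|lborel. ?f l * m l) = (LINT l:{0<..}|lborel. ?f l - ?f l * m l)"
    using set_integral_diff(2)[OF i1(1) i2] by simp
  also have "\<dots> \<le> (LINT l|lborel. indicator {0<..Y} l *\<^sub>R (x * (1 - m l)) + indicator {Y<..} l *\<^sub>R ?f l)"
    unfolding set_lebesgue_integral_def
  proof (rule integral_mono)
    show "integrable lborel (\<lambda>l. indicator {0<..} l *\<^sub>R (?f l - ?f l * m l))"
      using set_integral_diff(1)[OF i1(1) i2] by (simp add: set_integrable_def)
    show "integrable lborel (\<lambda>l. indicator {0<..Y} l *\<^sub>R (x * (1 - m l)) + indicator {Y<..} l *\<^sub>R ?f l)"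
      using i3(1) i4 unfolding set_integrable_def by (rule Bochner_Integration.integrable_add[rotated])
    fix l :: real
    have m: "0 \<le> m l" "0 \<le> 1 - m l" using m_nonneg m_le_1[of l] by auto
    have eq: "?f l - ?f l * m l = (1 - m l) * ?f l" by (simp add: algebra_simps)
    have a: "(1 - m l) * ?f l \<le> x * (1 - m l)" if "l > 0"
    proof -
      have "(1 - m l) * ?f l \<le> (1 - m l) * (x * 1)" using that x m by (intro mult_left_mono) auto
      thus ?thesis by (simp add: mult.commute)
    qed
    have b: "(1 - m l) * ?f l \<le> 1 * ?f l" using m x by (intro mult_right_mono) auto
    show "indicator {0<..} l *\<^sub>R (?f l - ?f l * m l) \<le> indicator {0<..Y} l *\<^sub>R (x * (1 - m l)) + indicator {Y<..} l *\<^sub>R ?f l"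
      using a b Y unfolding eq by (cases "l \<le> 0"; cases "l \<le> Y") auto
  qed
  also have "\<dots> = (LINT l:{0<..Y}|lborel. x * (1 - m l)) + (LINT l:{Y<..}|lborel. ?f l)"
    using i3(1) i4 unfolding set_integrable_def set_lebesgue_integral_def by (rule Bochner_Integration.integral_add[rotated])
  also have "(LINT l:{0<..Y}|lborel. x * (1 - m l)) = x * ((LINT l:{0<..Y}|lborel. 1) - (LINT l:{0<..Y}|lborel. m l))"
  proof -
    have "set_integrable lborel {0<..Y} (\<lambda>l. 1 :: real)" by (simp add: set_integrable_def integrable_indicator_Ioc)
    from set_integral_diff(2)[OF this set_integrable_m[of Y]] show ?thesis by simp
  qed
  also have "(LINT l:{0<..Y}|lborel. 1) = Y" using Y by (simp add: set_lebesgue_integral_def)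
  also have "x * (Y - (LINT l:{0<..Y}|lborel. m l)) = T * (1 - (1 / Y) * (LINT l:{0<..Y}|lborel. m l))"
    using x T by (simp add: Y_def field_simps)
  finally show "(LINT l|weight_measure. ?f l) \<ge> 1 - (T * (1 - (1 / (T / x)) * (LINT l:{0<..T / x}|lborel. m l)) + exp (- T))"
    unfolding int i1 i3 Y_def[symmetric] by linarith
qed

lemma exp_integral_tendsto:
  assumes avg: "((\<lambda>y. (1 / y) * (LINT l:{..y}|lborel. m l)) \<longlongrightarrow> 1) at_top"
  shows "((\<lambda>x. LINT l|weight_measure. x * exp (- l * x)) \<longlongrightarrow> 1) (at_right 0)"
proof (rule tendstoI)
  fix \<epsilon> :: real assume \<epsilon>: "\<epsilon> > 0"
  define g where "g y = (1 / y) * (LINT l:{0<..y}|lborel. m l)" for y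
  have g: "(g \<longlongrightarrow> 1) at_top" unfolding g_def[abs_def] by (rule average_on_positive_half_line[OF avg])
  have "((\<lambda>T. exp (- T)) \<longlongrightarrow> (0::real)) at_top" by real_asymp
  hence "\<forall>\<^sub>F T in at_top. exp (- T) < \<epsilon> / 2" using \<epsilon> by (intro order_tendstoD) auto
  hence "\<forall>\<^sub>F T::real in at_top. 0 < T \<and> exp (- T) < \<epsilon> / 2" using eventually_gt_at_top[of 0] by eventually_elim simp
  then obtain T :: real where T: "T > 0" "exp (- T) < \<epsilon> / 2"
    by (metis (mono_tags, lifting) eventually_happens trivial_limit_at_top_linorder)
  have "filterlim (\<lambda>x. T / x) at_top (at_right 0)" using T(1) by real_asymp
  hence "((\<lambda>x. T * (1 - g (T / x))) \<longlongrightarrow> T * (1 - 1)) (at_right 0)"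
    by (intro tendsto_intros filterlim_compose[OF g])
  hence "\<forall>\<^sub>F x in at_right 0. T * (1 - g (T / x)) < \<epsilon> / 2" using \<epsilon> by (intro order_tendstoD) auto
  moreover have "\<forall>\<^sub>F x::real in at_right 0. x > 0" by (simp add: eventually_at_right_less)
  ultimately show "\<forall>\<^sub>F x in at_right 0. dist (LINT l|weight_measure. x * exp (- l * x)) 1 < \<epsilon>"
  proof eventually_elim
    case (elim x)
    show ?case using exp_integral_bounds[OF elim(2) T(1)] elim(1) T(2) unfolding g_def dist_real_def by linarith
  qed
qed

text \<open>Only the summand \<open>x * exp (- l * x)\<close> of the periodization, integrated over \<open>l\<close>, fails to be continuous at 0
from the right. The remaining summands differ from their value at 0 by at most \<open>x\<close> times an
integrable function of \<open>l\<close>.\<close>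

lemma F_at_right_0:
  assumes avg: "((\<lambda>y. (1 / y) * (LINT l:{..y}|lborel. m l)) \<longlongrightarrow> 1) at_top"
  shows "(F \<longlongrightarrow> F 0 + 1) (at_right 0)"
proof -
  let ?g = "\<lambda>l. exp (- l) * coefA l + l * coefB l"
  have ig: "integrable weight_measure ?g"
  proof (rule integrable_weight_measure)
    show "continuous_on {0<..} ?g" unfolding coefA_def coefB_def by (auto intro!: continuous_intros)
    show "((\<lambda>l. l\<^sup>2 * ?g l) \<longlongrightarrow> 0) (at_right 0)" "((\<lambda>l. l\<^sup>2 * ?g l) \<longlongrightarrow> 0) at_top"
      unfolding coefA_def coefB_def by real_asymp+
  qed measurable
  have F0: "F 0 = (LINT l|weight_measure. periodized l 0)" by (rule F_eq) simp
  have bound: "\<bar>F x - (F 0 + (LINT l|weight_measure. x * exp (- l * x)))\<bar> \<le> x * (LINT l|weight_measure. ?g l)" if x: "0 < x" "x < 1" for x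
  proof -
    have i: "integrable weight_measure (\<lambda>l. periodized l x)" "integrable weight_measure (\<lambda>l. periodized l 0)" "integrable weight_measure (\<lambda>l. x * exp (- l * x))"
      using x by (intro integrable_periodized integrable_exp; simp)+
    have "F x - (F 0 + (LINT l|weight_measure. x * exp (- l * x))) = (LINT l|weight_measure. periodized l x - periodized l 0 - x * exp (- l * x))"
      using i by (simp add: F0 F_eq x less_imp_le)
    also have "\<bar>\<dots>\<bar> \<le> (LINT l|weight_measure. \<bar>periodized l x - periodized l 0 - x * exp (- l * x)\<bar>)" by (rule integral_abs_bound)
    also have "\<dots> \<le> (LINT l|weight_measure. x * ?g l)"
    proof (rule integral_mono_AE)
      show "AE l in weight_measure. \<bar>periodized l x - periodized l 0 - x * exp (- l * x)\<bar> \<le> x * ?g l"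
        using AE_weight_measure
      proof eventually_elim
        case (elim l)
        have "exp (- l) < 1" using elim by simp
        hence A: "coefA l \<ge> 0" "coefB l \<ge> 0" "coefA l - 1 = exp (- l) * coefA l"
          by (auto simp: coefA_def coefB_def field_simps)
        have e1: "exp (- l * x) \<le> 1" using elim x by simp
        have e2: "1 - exp (- l * x) \<le> l * x" using exp_ge_add_one_self[of "- l * x"] by linarith
        have "periodized l x - periodized l 0 - x * exp (- l * x) = x * exp (- l * x) * (coefA l - 1) - (1 - exp (- l * x)) * coefB l"
          by (simp add: periodized_def algebra_simps)
        hence "\<bar>periodized l x - periodized l 0 - x * exp (- l * x)\<bar> \<le> \<bar>x * exp (- l * x) * (exp (- l) * coefA l)\<bar> + \<bar>(1 - exp (- l * x)) * coefB l\<bar>"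
          unfolding A(3) by (metis abs_triangle_ineq4)
        also have "\<dots> = x * exp (- l * x) * (exp (- l) * coefA l) + (1 - exp (- l * x)) * coefB l"
          using A e1 x by (simp add: abs_mult)
        also have "\<dots> \<le> x * 1 * (exp (- l) * coefA l) + (l * x) * coefB l"
          using A e1 e2 x by (intro add_mono mult_mono mult_left_mono mult_right_mono) auto
        finally show ?case by (simp add: algebra_simps)
      qed
    qed (use i ig in auto)
    finally show ?thesis by simp
  qed
  have ev: "\<forall>\<^sub>F x::real in at_right 0. 0 < x \<and> x < 1"
    using eventually_at_right_real[of 0 1] by (auto elim: eventually_mono)
  have "((\<lambda>x. F x - (F 0 + (LINT l|weight_measure. x * exp (- l * x)))) \<longlongrightarrow> 0) (at_right 0)"
  proof (rule tendsto_0_le[where K = 1])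
    show "((\<lambda>x. x * (LINT l|weight_measure. ?g l)) \<longlongrightarrow> 0) (at_right 0)"
      by (rule tendsto_eq_intros refl)+ simp
    show "\<forall>\<^sub>F x in at_right 0. norm (F x - (F 0 + (LINT l|weight_measure. x * exp (- l * x)))) \<le> norm (x * (LINT l|weight_measure. ?g l)) * 1"
      using ev by eventually_elim (use bound in \<open>force intro: order.trans[OF _ abs_ge_self]\<close>)
  qed
  from tendsto_add[OF this tendsto_add[OF tendsto_const[of "F 0"] exp_integral_tendsto[OF avg]]]
  show ?thesis by simp
qed

end

section \<open>Complex and real trigonometric polynomials\<close>

lemma E_power: "E x ^ n = E (of_nat n * x)"
  by (induction n) (simp_all add: E_add ring_distribs)

lemma e_of_int_mult: "e (of_int k * complex_of_real x) = E (of_int k * x)"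
  by (simp add: E_def)

lemma E_int_mult_power: assumes "k \<ge> - int N" shows "E (of_int k * x) * E x ^ N = E x ^ nat (k + int N)"
proof -
  have "real (nat (k + int N)) = of_int k + real N" using assms by simp
  thus ?thesis by (simp add: E_power ring_distribs flip: E_add)
qed

text \<open>The coefficients of a trigonometric polynomial, shifted to nonnegative exponents.\<close>

definition trig_to_poly :: "nat \<Rightarrow> (int \<Rightarrow> complex) \<Rightarrow> complex poly" where
  "trig_to_poly N a = (\<Sum>k = - int N..int N. monom (a k) (nat (k + int N)))"

lemma poly_trig_to_poly:
  "(\<Sum>k = - int N..int N. a k * e (of_int k * complex_of_real x)) * E x ^ N = poly (trig_to_poly N a) (E x)"
  unfolding trig_to_poly_def poly_sum poly_monom sum_distrib_right e_of_int_mult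
  by (intro sum.cong refl) (simp add: E_int_mult_power mult.assoc)

lemma degree_trig_to_poly: "degree (trig_to_poly N a) \<le> 2 * N"
  unfolding trig_to_poly_def
  by (intro degree_sum_le order.trans[OF degree_monom_le]) auto

lemma coeff_trig_to_poly: assumes "k \<in> {- int N..int N}" shows "coeff (trig_to_poly N a) (nat (k + int N)) = a k"
proof -
  have "coeff (trig_to_poly N a) (nat (k + int N)) = (\<Sum>j = - int N..int N. if j = k then a k else 0)"
    unfolding trig_to_poly_def coeff_sum coeff_monom using assms by (intro sum.cong) auto
  thus ?thesis using assms by simp
qed

lemma poly_eq_0_on_circle: assumes "\<And>x. poly p (E x) = 0" shows "p = 0"
proof (rule ccontr)
  assume "p \<noteq> 0"
  hence "finite (E ` {0..<1})" by (intro finite_subset[OF _ poly_roots_finite[of p]]) (auto simp: assms)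
  hence "finite {0..<1::real}" using inj_on_E by (rule finite_imageD)
  thus False using infinite_Ico[of 0 "1 :: real"] by simp
qed

text \<open>The values on the real line determine the shifted polynomial on the unit circle, hence all
coefficients.\<close>

lemma trig_poly_eqI:
  assumes "trig_poly N f" "trig_poly N g" "\<And>x. f (complex_of_real x) = g (complex_of_real x)"
  shows "f = g"
proof -
  obtain a where a: "f = (\<lambda>z. \<Sum>k = - int N..int N. a k * e (of_int k * z))" using assms(1) by (auto simp: trig_poly_def)
  obtain b where b: "g = (\<lambda>z. \<Sum>k = - int N..int N. b k * e (of_int k * z))" using assms(2) by (auto simp: trig_poly_def)
  have "poly (trig_to_poly N a - trig_to_poly N b) (E x) = 0" for x
    using assms(3)[of x] poly_trig_to_poly[of a x N] poly_trig_to_poly[of b x N] by (simp add: a b)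
  hence "trig_to_poly N a - trig_to_poly N b = 0" by (rule poly_eq_0_on_circle)
  hence "trig_to_poly N a = trig_to_poly N b" by simp
  hence "a k = b k" if "k \<in> {- int N..int N}" for k
    using coeff_trig_to_poly[OF that, of a] coeff_trig_to_poly[OF that, of b] by simp
  thus ?thesis unfolding a b by (intro ext sum.cong) auto
qed

lemma real_trig_poly_imp_trig_fun:
  assumes "real_trig_poly N L"
  shows "trig_fun N (\<lambda>x. Re (L (complex_of_real x)))" "L (complex_of_real x) = of_real (Re (L (complex_of_real x)))"
proof -
  obtain a where a: "L = (\<lambda>z. \<Sum>k = - int N..int N. a k * e (of_int k * z))"
    using assms by (auto simp: real_trig_poly_def trig_poly_def)
  show re: "L (complex_of_real x) = of_real (Re (L (complex_of_real x)))" for x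
    using assms by (simp add: real_trig_poly_def)
  show "trig_fun N (\<lambda>x. Re (L (complex_of_real x)))"
  proof (rule trig_funI[OF degree_trig_to_poly])
    show "complex_of_real (Re (L (complex_of_real x))) * E x ^ N = poly (trig_to_poly N a) (E x)" for x
      unfolding re[symmetric] unfolding a by (rule poly_trig_to_poly)
  qed
qed

lemma trig_fun_imp_real_trig_poly:
  assumes "trig_fun N f"
  obtains L where "real_trig_poly N L" "\<And>x. L (complex_of_real x) = of_real (f x)"
proof -
  obtain p where p: "degree p \<le> 2 * N" "\<And>x. of_real (f x) * E x ^ N = poly p (E x)" using assms by (auto elim: trig_funE)
  define a where "a k = coeff p (nat (k + int N))" for k
  define L where "L = (\<lambda>z. \<Sum>k = - int N..int N. a k * e (of_int k * z))"
  have "trig_to_poly N a = p"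
  proof (rule poly_eqI)
    fix i show "coeff (trig_to_poly N a) i = coeff p i"
    proof (cases "i \<le> 2 * N")
      case True
      have "coeff (trig_to_poly N a) (nat (int i - int N + int N)) = a (int i - int N)"
        using True by (intro coeff_trig_to_poly) auto
      thus ?thesis by (simp add: a_def)
    next
      case False
      thus ?thesis using degree_trig_to_poly[of N a] p(1) by (simp add: coeff_eq_0)
    qed
  qed
  hence "L (complex_of_real x) * E x ^ N = of_real (f x) * E x ^ N" for x
    using poly_trig_to_poly[of a x N] p(2)[of x] by (simp add: L_def)
  hence eq: "L (complex_of_real x) = of_real (f x)" for x by simp
  show ?thesis
  proof (rule that[OF _ eq])
    show "real_trig_poly N L" unfolding real_trig_poly_def trig_poly_def by (auto simp: eq) (auto simp: L_def)
  qed
qed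

text \<open>Transfers unique existence from functions on the real line to entire functions, which are determined
by their real values.\<close>

lemma ex1_real_trig_poly:
  assumes f: "trig_fun N f" "P f" and uniq: "\<And>g. trig_fun N g \<Longrightarrow> P g \<Longrightarrow> g = f"
  shows "\<exists>!L. real_trig_poly N L \<and> P (\<lambda>x. Re (L (complex_of_real x)))"
proof -
  obtain L where L: "real_trig_poly N L" "\<And>x. L (complex_of_real x) = of_real (f x)"
    using trig_fun_imp_real_trig_poly[OF f(1)] by blast
  show ?thesis
  proof (rule ex1I[of _ L])
    have "(\<lambda>x. Re (L (complex_of_real x))) = f" by (simp add: L(2))
    thus "real_trig_poly N L \<and> P (\<lambda>x. Re (L (complex_of_real x)))" using L(1) f(2) by simp
  next
    fix M assume M: "real_trig_poly N M \<and> P (\<lambda>x. Re (M (complex_of_real x)))"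
    hence "(\<lambda>x. Re (M (complex_of_real x))) = f" using real_trig_poly_imp_trig_fun(1) by (intro uniq) auto
    hence "M (complex_of_real x) = L (complex_of_real x)" for x
      using real_trig_poly_imp_trig_fun(2)[of N M x] M L(2) by (metis (mono_tags, lifting))
    thus "M = L" using M L(1) by (intro trig_poly_eqI[of N]) (auto simp: real_trig_poly_def)
  qed
qed

section \<open>Exact quadrature\<close>

context christoffel_darboux
begin

definition X :: "real set" where "X = {x. 0 < x \<and> x < 1 \<and> companion \<theta> c (N + 1) (e (of_real x)) = 0}"

definition christoffel :: "real \<Rightarrow> real" where
  "christoffel x = Re (kernel \<theta> c N (E x) (E x))"

lemma X_subset: "X \<subseteq> {0<..<1}" and zero_notin_X: "0 \<notin> X"
  by (auto simp: X_def)

lemma X_iff: "x \<in> X \<longleftrightarrow> 0 < x \<and> x < 1 \<and> E x \<in> nodes"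
  unfolding X_def mem_Collect_eq companion_eq_0_iff E_def by simp

lemma E_image_X: "E ` insert 0 X = nodes"
proof
  show "E ` insert 0 X \<subseteq> nodes" using one_in_nodes by (auto simp: X_iff)
  show "nodes \<subseteq> E ` insert 0 X"
  proof
    fix z assume z: "z \<in> nodes"
    then obtain x where x: "x \<in> {0..<1}" "E x = z" using E_surj_circle[OF nodes_circle] by blast
    have "x \<in> insert 0 X" using x z by (cases "x = 0") (auto simp: X_iff)
    thus "z \<in> E ` insert 0 X" using x by blast
  qed
qed

lemma inj_on_X: "inj_on E (insert 0 X)"
  by (rule inj_on_subset[OF inj_on_E]) (auto simp: X_def)

lemma finite_X: "finite X" and card_X: "card X = N"
proof -
  have "finite (insert 0 X)" using inj_on_X finite_nodes unfolding E_image_X[symmetric] by (metis finite_imageD)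
  thus "finite X" by simp
  have "card (insert 0 X) = Suc N" using card_image[OF inj_on_X] unfolding E_image_X card_nodes by simp
  thus "card X = N" using \<open>finite X\<close> zero_notin_X by simp
qed

lemma E_in_nodes: "x \<in> insert 0 X \<Longrightarrow> E x \<in> nodes"
  using E_image_X by blast

lemma christoffel_eq: "x \<in> insert 0 X \<Longrightarrow> christoffel x = Re (poly (kernel_section (E x)) (E x))"
  unfolding christoffel_def using kernel_at_node[OF E_in_nodes] by simp

lemma christoffel_pos: "x \<in> insert 0 X \<Longrightarrow> christoffel x > 0"
  using kernel_section_pos(2)[OF E_in_nodes] by (simp only: christoffel_eq)

lemma quadrature_eq: "quadrature \<theta> c N v0 f = v0 / christoffel 0 + (\<Sum>x\<in>X. f x / christoffel x)"
  by (simp add: quadrature_def christoffel_def X_def E_def) (simp add: e_def)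

text \<open>Each exponent \<open>j - N\<close> with \<open>j \<le> 2 * N\<close> is a power of \<open>z\<close> or of \<open>cnj z\<close> of degree at most \<open>N\<close>, so the
quadrature for inner products applies to every monomial.\<close>

lemma quadrature_exact:
  assumes "trig_fun N f" shows "(LINT x|\<theta>. f x) = quadrature \<theta> c N (f 0) f"
proof -
  obtain p where p: "degree p \<le> 2 * N" "\<And>x. of_real (f x) * E x ^ N = poly p (E x)" using assms by (auto elim: trig_funE)
  define u :: "nat \<Rightarrow> complex poly" where "u j = monom 1 (j - N)" for j
  define v :: "nat \<Rightarrow> complex poly" where "v j = monom 1 (N - j)" for j
  have f: "of_real (f x) = (\<Sum>j\<le>2 * N. coeff p j * (poly (u j) (E x) * cnj (poly (v j) (E x))))" for x
  proof -
    have one: "E x * cnj (E x) = 1" by (simp add: cnj_on_circle)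
    have uv: "E x ^ j * cnj (E x) ^ N = poly (u j) (E x) * cnj (poly (v j) (E x))" for j
    proof (cases "j \<le> N")
      case True
      have "E x ^ j * cnj (E x) ^ N = (E x * cnj (E x)) ^ j * cnj (E x) ^ (N - j)"
        using True by (simp add: power_mult_distrib mult.assoc flip: power_add)
      thus ?thesis using True by (simp add: one u_def v_def poly_monom)
    next
      case False
      have "E x ^ j * cnj (E x) ^ N = E x ^ (j - N) * (E x ^ N * cnj (E x) ^ N)"
        using False by (simp add: mult.assoc[symmetric] flip: power_add)
      also have "E x ^ N * cnj (E x) ^ N = 1" by (simp add: one flip: power_mult_distrib)
      finally show ?thesis using False by (simp add: u_def v_def poly_monom)
    qed
    have "of_real (f x) = of_real (f x) * E x ^ N * cnj (E x) ^ N"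
      by (simp add: one mult.assoc flip: power_mult_distrib)
    also have "\<dots> = (\<Sum>j\<le>2 * N. coeff p j * E x ^ j) * cnj (E x) ^ N"
    proof -
      have "(\<Sum>j\<le>degree p. coeff p j * E x ^ j) = (\<Sum>j\<le>2 * N. coeff p j * E x ^ j)"
        using p(1) by (intro sum.mono_neutral_left) (auto simp: coeff_eq_0)
      thus ?thesis by (simp add: p(2) poly_altdef)
    qed
    also have "\<dots> = (\<Sum>j\<le>2 * N. coeff p j * (poly (u j) (E x) * cnj (poly (v j) (E x))))"
      by (simp add: sum_distrib_right mult.assoc uv)
    finally show ?thesis .
  qed
  have deg: "degree (u j) \<le> N" "degree (v j) \<le> N" if "j \<le> 2 * N" for j
    using that unfolding u_def v_def by (auto intro!: order.trans[OF degree_monom_le])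
  have "of_real (LINT x|\<theta>. f x) = (LINT x|\<theta>. complex_of_real (f x))" by (rule integral_complex_of_real[symmetric])
  also have "\<dots> = (\<Sum>j\<le>2 * N. coeff p j * ip (u j) (v j))"
    unfolding f ip_eq by (subst Bochner_Integration.integral_sum) auto
  also have "\<dots> = (\<Sum>j\<le>2 * N. \<Sum>z\<in>nodes. coeff p j * (poly (u j) z * cnj (poly (v j) z)) / of_real (Re (poly (kernel_section z) z)))"
    using deg by (intro sum.cong refl) (simp add: gauss_quadrature sum_distrib_left)
  also have "\<dots> = (\<Sum>z\<in>nodes. (\<Sum>j\<le>2 * N. coeff p j * (poly (u j) z * cnj (poly (v j) z))) / of_real (Re (poly (kernel_section z) z)))"
    by (subst sum.swap) (simp add: sum_divide_distrib)
  also have "\<dots> = (\<Sum>x\<in>insert 0 X. of_real (f x) / of_real (Re (poly (kernel_section (E x)) (E x))))"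
    unfolding E_image_X[symmetric] sum.reindex[OF inj_on_X] by (simp add: f)
  also have "\<dots> = (\<Sum>x\<in>insert 0 X. of_real (f x / christoffel x))"
    by (intro sum.cong refl) (simp add: christoffel_eq)
  also have "\<dots> = of_real (quadrature \<theta> c N (f 0) f)"
    unfolding quadrature_eq using finite_X zero_notin_X by simp
  finally show ?thesis by (simp only: of_real_eq_iff)
qed

lemma quadrature_mono:
  assumes "v \<le> w" "\<And>x. x \<in> X \<Longrightarrow> f x \<le> g x"
  shows "quadrature \<theta> c N v f \<le> quadrature \<theta> c N w g"
  unfolding quadrature_eq using assms christoffel_pos
  by (intro add_mono sum_mono divide_right_mono) (auto intro: less_imp_le)

lemma quadrature_mono_eq:
  assumes le: "v \<le> w" "\<And>x. x \<in> X \<Longrightarrow> f x \<le> g x" and eq: "quadrature \<theta> c N v f = quadrature \<theta> c N w g"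
  shows "v = w" "x \<in> X \<Longrightarrow> f x = g x"
proof -
  have "quadrature \<theta> c N w g - quadrature \<theta> c N v f = (w - v) / christoffel 0 + (\<Sum>x\<in>X. (g x - f x) / christoffel x)"
    by (simp add: quadrature_eq diff_divide_distrib sum_subtractf)
  hence sum0: "(w - v) / christoffel 0 + (\<Sum>x\<in>X. (g x - f x) / christoffel x) = 0" using eq by simp
  have nn: "(w - v) / christoffel 0 \<ge> 0" "\<And>x. x \<in> X \<Longrightarrow> (g x - f x) / christoffel x \<ge> 0"
    using le christoffel_pos by (auto intro!: divide_nonneg_pos)
  have "(\<Sum>x\<in>X. (g x - f x) / christoffel x) \<ge> 0" using nn by (intro sum_nonneg) auto
  hence z: "(w - v) / christoffel 0 = 0" "(\<Sum>x\<in>X. (g x - f x) / christoffel x) = 0" using sum0 nn by linarith+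
  thus "v = w" using christoffel_pos[of 0] by simp
  show "f x = g x" if "x \<in> X"
    using z(2) nn sum_nonneg_eq_0_iff[OF finite_X, of "\<lambda>x. (g x - f x) / christoffel x"] christoffel_pos[of x] that by auto
qed

end

section \<open>Extremal approximations\<close>

context weight_interpolation
begin

lemma trig_fun_best_minorant: "trig_fun (card X) best_minorant" unfolding best_minorant_def by (rule trig_fun_interpolant)

lemma best_minorant_0: "best_minorant 0 = F 0" and best_minorant_node: "a \<in> X \<Longrightarrow> best_minorant a = F a"
  by (simp_all add: best_minorant_def interpolant_0 interpolant_node)

text \<open>The difference has a local minimum at the point of contact.\<close>

lemma deriv_eq_if_touching:
  assumes g: "trig_fun n g" and h: "trig_fun n h" and le: "\<And>x. x \<in> {0<..<1} \<Longrightarrow> g x \<le> h x" and eq: "g a = h a" and a: "a \<in> {0<..<1}"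
  shows "deriv g a = deriv h a"
proof -
  have "((\<lambda>x. h x - g x) has_real_derivative (deriv h a - deriv g a)) (at a)"
    by (intro DERIV_diff trig_fun_DERIV[OF g] trig_fun_DERIV[OF h])
  moreover have "0 < min a (1 - a)" using a by auto
  moreover have "\<forall>y. \<bar>a - y\<bar> < min a (1 - a) \<longrightarrow> h a - g a \<le> h y - g y"
  proof (intro allI impI)
    fix y assume "\<bar>a - y\<bar> < min a (1 - a)"
    hence "y \<in> {0<..<1}" by (auto simp: abs_less_iff)
    thus "h a - g a \<le> h y - g y" using le[of y] eq by simp
  qed
  ultimately have "deriv h a - deriv g a = 0" by (rule DERIV_local_min)
  thus ?thesis by simp
qed

lemma trig_fun_best_minorant_bump: "trig_fun (card X) (\<lambda>x. best_minorant x + bump x)" by (intro trig_fun_add trig_fun_best_minorant trig_fun_bump)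

lemma deriv_best_minorant_bump: "a \<in> X \<Longrightarrow> deriv (\<lambda>x. best_minorant x + bump x) a = deriv best_minorant a"
  using DERIV_imp_deriv[OF DERIV_add[OF trig_fun_DERIV[OF trig_fun_best_minorant] trig_fun_DERIV[OF trig_fun_bump]], of a] deriv_bump_node by simp

text \<open>Such a function lies below \<open>best_minorant + bump\<close> and touches it on \<open>X\<close>, so it has the same slopes
there.\<close>

lemma minorant_unique:
  assumes g: "trig_fun (card X) g" "\<And>x. g x \<le> F x" "g 0 = F 0" "\<And>a. a \<in> X \<Longrightarrow> g a = F a"
  shows "g = best_minorant"
proof (rule trig_fun_eqI[OF g(1) trig_fun_best_minorant])
  show "deriv g a = deriv best_minorant a" if a: "a \<in> X" for a
  proof -
    have "g x \<le> best_minorant x + bump x" if "x \<in> {0<..<1}" for x using g(2)[of x] F_le_best_minorant_bump[OF that] by simp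
    hence "deriv g a = deriv (\<lambda>x. best_minorant x + bump x) a"
      using g a X_subset by (intro deriv_eq_if_touching[OF g(1) trig_fun_best_minorant_bump]) (auto simp: best_minorant_node bump_node)
    thus ?thesis by (simp add: deriv_best_minorant_bump a)
  qed
qed (auto simp: g best_minorant_0 best_minorant_node)

text \<open>Such a function lies above \<open>best_minorant\<close> and touches it on \<open>X\<close>.\<close>

lemma majorant_unique:
  assumes g: "trig_fun (card X) g" "\<And>x. F x \<le> g x" "g 0 = F 0 + 1" "\<And>a. a \<in> X \<Longrightarrow> g a = F a"
  shows "g = (\<lambda>x. best_minorant x + bump x)"
proof (rule trig_fun_eqI[OF g(1) trig_fun_best_minorant_bump])
  show "deriv g a = deriv (\<lambda>x. best_minorant x + bump x) a" if a: "a \<in> X" for a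
  proof -
    have "best_minorant x \<le> g x" if "x \<in> {0<..<1}" for x using best_minorant_le_F[of x] g(2)[of x] that by simp
    hence "deriv best_minorant a = deriv g a"
      using g a X_subset by (intro deriv_eq_if_touching[OF trig_fun_best_minorant g(1)]) (auto simp: best_minorant_node)
    thus ?thesis by (simp add: deriv_best_minorant_bump a)
  qed
qed (auto simp: g best_minorant_0 best_minorant_node bump_0 bump_node)

lemma periodic_le:
  fixes f g :: "real \<Rightarrow> real"
  assumes "\<And>x. x \<in> {0..<1} \<Longrightarrow> f x \<le> g x" "\<And>x k. f (x + of_int k) = f x" "\<And>x k. g (x + of_int k) = g x"
  shows "f x \<le> g x"
proof -
  have "f (frac x) \<le> g (frac x)" by (intro assms(1)) (auto simp: frac_lt_1)
  thus ?thesis using assms(2)[of "frac x" "\<lfloor>x\<rfloor>"] assms(3)[of "frac x" "\<lfloor>x\<rfloor>"] by (simp add: frac_def)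
qed

lemma minorant: "best_minorant x \<le> F x"
  by (rule periodic_le[OF best_minorant_le_F trig_fun_periodic[OF trig_fun_best_minorant] F_add_int])

lemma majorant: "F x \<le> best_minorant x + bump x"
proof (rule periodic_le[of F "\<lambda>x. best_minorant x + bump x"])
  show "F x \<le> best_minorant x + bump x" if "x \<in> {0..<1}" for x
    using F_le_best_minorant_bump[of x] that by (cases "x = 0") (auto simp: best_minorant_0 bump_0)
qed (auto simp: F_add_int trig_fun_periodic[OF trig_fun_best_minorant] trig_fun_periodic[OF trig_fun_bump])

end

theorem theorem12:
  fixes \<mu> :: "real set \<Rightarrow> real"
    and \<theta> :: "real measure"
    and c :: "nat \<Rightarrow> complex"
    and N :: nat
  assumes "locally_finite_signed_measure \<mu>"
    and "signed_support \<mu> \<subseteq> {0..}"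
    and "\<forall>x. 0 \<le> distribution_function \<mu> x \<and> distribution_function \<mu> x \<le> 1"
    and "set_integrable lborel {0<..} (\<lambda>l. distribution_function \<mu> l / l ^ 2)"
    and "circle_prob \<theta>"
    and "\<not> trivial_measure \<theta>"
    and "admissible_phases \<theta> c"
  defines "F \<equiv> periodic_transform \<mu>"
  shows
    "(\<forall>L :: complex \<Rightarrow> complex.
        real_trig_poly N L \<and> (\<forall>x :: real. Re (L (of_real x)) \<le> F x) \<longrightarrow>
        (LINT x|\<theta>. Re (L (of_real x))) \<le> quadrature \<theta> c N (F 0) F)
     \<and> (\<exists>!L :: complex \<Rightarrow> complex.
        real_trig_poly N L \<and> (\<forall>x :: real. Re (L (of_real x)) \<le> F x) \<and>
        (LINT x|\<theta>. Re (L (of_real x))) = quadrature \<theta> c N (F 0) F)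
     \<and> (((\<lambda>y. (1 / y) * (LINT x:{..y}|lborel. distribution_function \<mu> x)) \<longlongrightarrow> 1) at_top \<longrightarrow>
        (\<forall>M :: complex \<Rightarrow> complex.
          real_trig_poly N M \<and> (\<forall>x :: real. F x \<le> Re (M (of_real x))) \<longrightarrow>
          (LINT x|\<theta>. Re (M (of_real x))) \<ge> quadrature \<theta> c N (Lim (at_right 0) F) F)
        \<and> (\<exists>!M :: complex \<Rightarrow> complex.
          real_trig_poly N M \<and> (\<forall>x :: real. F x \<le> Re (M (of_real x))) \<and>
          (LINT x|\<theta>. Re (M (of_real x))) = quadrature \<theta> c N (Lim (at_right 0) F) F))"
proof -
  interpret cd: christoffel_darboux \<theta> c N
    by unfold_locales (use assms in auto)
  interpret wi: weight_interpolation "distribution_function \<mu>" cd.X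
    by unfold_locales (use assms cd.finite_X cd.X_subset in auto)
  have F: "F = wi.F" by (intro ext) (simp add: F_def periodic_transform_def wi.F_def)
  note card = cd.card_X
  have min: "(LINT x|\<theta>. g x) \<le> quadrature \<theta> c N (F 0) F" if "trig_fun N g" "\<And>x. g x \<le> F x" for g
    unfolding cd.quadrature_exact[OF that(1)] using that(2) by (intro cd.quadrature_mono)
  have min_unique: "g = wi.best_minorant" if g: "trig_fun N g" and le: "\<forall>x. g x \<le> F x" and eq: "(LINT x|\<theta>. g x) = quadrature \<theta> c N (F 0) F" for g
  proof -
    have q: "quadrature \<theta> c N (g 0) g = quadrature \<theta> c N (F 0) F"
      using eq unfolding cd.quadrature_exact[OF g] .
    have "g 0 = F 0" by (rule cd.quadrature_mono_eq(1)[OF _ _ q]) (simp_all add: le)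
    moreover have "g a = F a" if "a \<in> cd.X" for a
      by (rule cd.quadrature_mono_eq(2)[OF _ _ q that]) (simp_all add: le)
    moreover have "trig_fun (card cd.X) g" using g by (simp only: card)
    ultimately show ?thesis
      using le unfolding F by (intro wi.minorant_unique) blast+
  qed
  have min_ex: "(LINT x|\<theta>. wi.best_minorant x) = quadrature \<theta> c N (F 0) F"
    using cd.quadrature_exact[OF wi.trig_fun_best_minorant[unfolded card]] by (simp add: F wi.best_minorant_0 wi.best_minorant_node cd.quadrature_eq)
  have maj: "((\<forall>M. real_trig_poly N M \<and> (\<forall>x::real. F x \<le> Re (M (of_real x))) \<longrightarrow>
          (LINT x|\<theta>. Re (M (of_real x))) \<ge> quadrature \<theta> c N (Lim (at_right 0) F) F)
        \<and> (\<exists>!M. real_trig_poly N M \<and> (\<forall>x::real. F x \<le> Re (M (of_real x))) \<and>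
          (LINT x|\<theta>. Re (M (of_real x))) = quadrature \<theta> c N (Lim (at_right 0) F) F))"
    if avg: "((\<lambda>y. (1 / y) * (LINT x:{..y}|lborel. distribution_function \<mu> x)) \<longlongrightarrow> 1) at_top"
  proof -
    have lim: "(F \<longlongrightarrow> F 0 + 1) (at_right 0)" unfolding F by (rule wi.F_at_right_0[OF avg])
    hence Lim: "Lim (at_right 0) F = F 0 + 1" by (intro tendsto_Lim) auto
    \<comment> \<open>A continuous majorant dominates the right limit at 0, not only the smaller value \<open>F 0\<close>.\<close>
    have at0: "F 0 + 1 \<le> g 0" if g: "trig_fun N g" and le: "\<And>x. F x \<le> g x" for g
    proof (rule tendsto_le[OF _ _ lim])
      have "isCont g 0" by (rule DERIV_isCont[OF trig_fun_DERIV[OF g]])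
      thus "(g \<longlongrightarrow> g 0) (at_right 0)" by (auto simp: isCont_def filterlim_at_split)
    qed (auto simp: le)
    have M_ge: "(LINT x|\<theta>. g x) \<ge> quadrature \<theta> c N (F 0 + 1) F" if "trig_fun N g" "\<And>x. F x \<le> g x" for g
      unfolding cd.quadrature_exact[OF that(1)] using that at0[OF that] by (intro cd.quadrature_mono)
    have M_unique: "g = (\<lambda>x. wi.best_minorant x + wi.bump x)"
      if g: "trig_fun N g" and le: "\<forall>x. F x \<le> g x" and eq: "(LINT x|\<theta>. g x) = quadrature \<theta> c N (F 0 + 1) F" for g
    proof -
      have q: "quadrature \<theta> c N (F 0 + 1) F = quadrature \<theta> c N (g 0) g"
        using eq unfolding cd.quadrature_exact[OF g] by (rule sym)
      have le0: "F 0 + 1 \<le> g 0" using at0[OF g] le by blast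
      have "F 0 + 1 = g 0" by (rule cd.quadrature_mono_eq(1)[OF le0 _ q]) (simp add: le)
      moreover have "F a = g a" if "a \<in> cd.X" for a
        by (rule cd.quadrature_mono_eq(2)[OF le0 _ q that]) (simp add: le)
      moreover have "trig_fun (card cd.X) g" using g by (simp only: card)
      ultimately show ?thesis
        using le unfolding F by (intro wi.majorant_unique) (blast, blast, simp, simp)
    qed
    have M_ex: "(LINT x|\<theta>. wi.best_minorant x + wi.bump x) = quadrature \<theta> c N (F 0 + 1) F"
      using cd.quadrature_exact[OF wi.trig_fun_best_minorant_bump[unfolded card]]
      by (simp add: F wi.best_minorant_0 wi.best_minorant_node wi.bump_0 wi.bump_node cd.quadrature_eq)
    have "\<exists>!M. real_trig_poly N M \<and> (\<lambda>g. (\<forall>x. F x \<le> g x) \<and> (LINT x|\<theta>. g x) = quadrature \<theta> c N (F 0 + 1) F)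
        (\<lambda>x. Re (M (complex_of_real x)))"
      by (rule ex1_real_trig_poly[OF wi.trig_fun_best_minorant_bump[unfolded card]])
         (use wi.majorant M_ex M_unique in \<open>auto simp: F\<close>)
    thus ?thesis unfolding Lim using M_ge real_trig_poly_imp_trig_fun(1) by auto
  qed
  have "\<exists>!L. real_trig_poly N L \<and> (\<lambda>g. (\<forall>x. g x \<le> F x) \<and> (LINT x|\<theta>. g x) = quadrature \<theta> c N (F 0) F)
      (\<lambda>x. Re (L (complex_of_real x)))"
    by (rule ex1_real_trig_poly[OF wi.trig_fun_best_minorant[unfolded card]])
       (use wi.minorant min_ex min_unique in \<open>auto simp: F\<close>)
  thus ?thesis using maj min real_trig_poly_imp_trig_fun(1) by auto
qed

end
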